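(* Let $X$ be an arbitrary Coxeter graph. Then there exists an IC basis for the algebra $TL(X)$ with respect to the triple $(\{t_w\}_{w\in W_c},\ \bar{\ },\ \mathcal{L})$; that is, there exists a unique $\mathbb{Z}[v^{-1}]$-basis $\{c_w\}_{w\in W_c}$ of $\mathcal{L}$ such that $\overline{c_w}=c_w$ and $\pi(c_w)=\pi(v^{-\ell(w)}t_w)$ for all $w\in W_c$.
   Context: Let $\mathcal{A}=\mathbb{Z}[v,v^{-1}]$, $\mathcal{A}^-=\mathbb{Z}[v^{-1}]$, $q=v^2$, where $v$ is an indeterminate. Let $X$ be a Coxeter graph with associated Coxeter group $W=W(X)$, set of generating involutions $S(X)$ and length function $\ell$. The Hecke algebra $\mathcal{H}(X)$ is the $\mathcal{A}$-algebra with $\mathcal{A}$-basis $\{T_w: w\in W\}$ and multiplication determined, for $s\in S(X)$ and $w\in W$, by $T_sT_w=T_{sw}$ if $\ell(sw)>\ell(w)$, and $T_sT_w=qT_{sw}+(q-1)T_w$ if $\ell(sw)<\ell(w)$. Let $J(X)$ be the two-sided ideal of $\mathcal{H}(X)$ generated by all elements $\sum_{w\in\langle s_i,s_j\rangle}T_w$, where $(s_i,s_j)$ runs over all pairs of elements of $S(X)$ corresponding to adjacent nodes of $X$ (pairs joined by a bond of infinite strength are omitted). The generalized Temperley--Lieb algebra is $TL(X)=\mathcal{H}(X)/J(X)$, and $t_w$ denotes the image of $T_w$ in $TL(X)$. For $s_i,s_j\in S(X)$ corresponding to adjacent nodes with $\langle s_i,s_j\rangle$ finite, let $w_{ij}$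 be the longest element of $\langle s_i,s_j\rangle$. An element $w\in W$ is complex if it can be written $w=x_1w_{ij}x_2$ for some such pair, with $x_1,x_2\in W$ and $\ell(w)=\ell(x_1)+\ell(w_{ij})+\ell(x_2)$. Let $W_c=W_c(X)$ be the set of elements of $W$ that are not complex. It is known (Graham) that $\{t_w:w\in W_c\}$ is an $\mathcal{A}$-basis of $TL(X)$. The map $\bar{\ }:TL(X)\to TL(X)$ is the $\mathbb{Z}$-linear ring automorphism of order 2 which sends $v$ to $v^{-1}$ and $t_w$ to $t_{w^{-1}}^{-1}$ (the elements $t_w$ are invertible). Let $\mathcal{L}$ be the free $\mathcal{A}^-$-submodule of $TL(X)$ with basis $\{v^{-\ell(w)}t_w: w\in W_c\}$, and let $\pi:\mathcal{L}\to\mathcal{L}/v^{-1}\mathcal{L}$ be the canonical projection. *)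

theory Defs
  imports "HOL-Library.Poly_Mapping" "HOL-Library.Extended_Nat" "HOL-Algebra.Algebra"
begin

section \<open>Laurent polynomials\<close>

text \<open>
  The ring \<open>\<int>[v, v\<^sup>-\<^sup>1]\<close> is the group ring of the additive group of integers: the library's
  finitely supported functions \<open>int \<Rightarrow>\<^sub>0 int\<close>, multiplied by convolution, where
  \<open>Poly_Mapping.single k 1\<close> is \<open>v\<^sup>k\<close>. Its subring \<open>\<int>[v\<^sup>-\<^sup>1]\<close> consists of the elements
  without positive exponents.
\<close>

type_synonym laurent = "int \<Rightarrow>\<^sub>0 int"

definition v_pow :: "int \<Rightarrow> laurent"
  where "v_pow k = Poly_Mapping.single k 1"

abbreviation q :: laurent
  where "q \<equiv> v_pow 2"

definition laurent_ring :: "laurent ring"  (\<open>\<A>\<close>)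
  where "\<A> = \<lparr>carrier = UNIV, monoid.mult = (*), monoid.one = 1, ring.zero = 0, ring.add = (+)\<rparr>"

definition laurent_minus_ring :: "laurent ring"  (\<open>\<A>minus\<close>)
  where "\<A>minus = \<A>\<lparr>carrier := {a. Poly_Mapping.keys a \<subseteq> {..0}}\<rparr>"


section \<open>Bases of modules\<close>

definition coefficients :: "('a, 'r) ring_scheme \<Rightarrow> 'i set \<Rightarrow> ('i \<Rightarrow> 'a) set"
  where "coefficients R I = {a \<in> I \<rightarrow>\<^sub>E carrier R. finite {i \<in> I. a i \<noteq> \<zero>\<^bsub>R\<^esub>}}"

definition lin_comb ::
    "('a, 'r) ring_scheme \<Rightarrow> ('a, 'b, 'n) module_scheme \<Rightarrow> 'i set \<Rightarrow> ('i \<Rightarrow> 'b) \<Rightarrow> ('i \<Rightarrow> 'a) \<Rightarrow> 'b"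
  where "lin_comb R M I b a = (\<Oplus>\<^bsub>M\<^esub>i\<in>{i \<in> I. a i \<noteq> \<zero>\<^bsub>R\<^esub>}. a i \<odot>\<^bsub>M\<^esub> b i)"

definition lin_span ::
    "('a, 'r) ring_scheme \<Rightarrow> ('a, 'b, 'n) module_scheme \<Rightarrow> 'i set \<Rightarrow> ('i \<Rightarrow> 'b) \<Rightarrow> 'b set"
  where "lin_span R M I b = lin_comb R M I b ` coefficients R I"

definition is_basis ::
    "('a, 'r) ring_scheme \<Rightarrow> ('a, 'b, 'n) module_scheme \<Rightarrow> 'i set \<Rightarrow> ('i \<Rightarrow> 'b) \<Rightarrow> bool"
  where "is_basis R M I b \<longleftrightarrow>
    b \<in> I \<rightarrow> carrier M \<and> bij_betw (lin_comb R M I b) (coefficients R I) (carrier M)"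


section \<open>Coxeter groups\<close>

text \<open>
  A Coxeter graph is given by its set \<open>S\<close> of nodes (of any cardinality) together with its Coxeter
  matrix \<open>m\<close>. Distinct nodes \<open>s\<close>, \<open>t\<close> are joined by a bond of strength \<open>m s t\<close> if \<open>m s t \<ge> 3\<close>, and
  are not joined if \<open>m s t = 2\<close>.
\<close>

locale coxeter_graph =
  fixes S :: "'s set" and m :: "'s \<Rightarrow> 's \<Rightarrow> enat"
  assumes m_diag: "s \<in> S \<Longrightarrow> m s s = 1"
    and m_sym: "\<lbrakk>s \<in> S; t \<in> S\<rbrakk> \<Longrightarrow> m s t = m t s"
    and m_ge_2: "\<lbrakk>s \<in> S; t \<in> S; s \<noteq> t\<rbrakk> \<Longrightarrow> 2 \<le> m s t"
begin

definition adjacent :: "'s \<Rightarrow> 's \<Rightarrow> bool"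
  where "adjacent s t \<longleftrightarrow> s \<in> S \<and> t \<in> S \<and> s \<noteq> t \<and> 3 \<le> m s t"

text \<open>
  The Coxeter group is the group generated by \<open>S\<close> subject to the relations \<open>(s t)\<^bsup>m s t\<^esup> = 1\<close> for
  \<open>m s t < \<infinity>\<close>. As the case \<open>s = t\<close> reads \<open>s s = 1\<close>, formal inverses of the generators are not
  needed: the group consists of the classes of words over \<open>S\<close> modulo the congruence generated
  by these relations.
\<close>

inductive word_eq :: "'s list \<Rightarrow> 's list \<Rightarrow> bool"
  where
    refl: "xs \<in> lists S \<Longrightarrow> word_eq xs xs"
  | sym: "word_eq xs ys \<Longrightarrow> word_eq ys xs"
  | trans: "\<lbrakk>word_eq xs ys; word_eq ys zs\<rbrakk> \<Longrightarrow> word_eq xs zs"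
  | rel: "\<lbrakk>xs \<in> lists S; ys \<in> lists S; s \<in> S; t \<in> S; m s t = enat k\<rbrakk>
      \<Longrightarrow> word_eq (xs @ concat (replicate k [s, t]) @ ys) (xs @ ys)"

definition word_class :: "'s list \<Rightarrow> 's list set"
  where "word_class xs = {ys. word_eq xs ys}"

definition W :: "'s list set monoid"
  where "W = \<lparr>carrier = word_class ` lists S,
    monoid.mult = (\<lambda>x y. \<Union>xs\<in>x. \<Union>ys\<in>y. word_class (xs @ ys)),
    monoid.one = word_class []\<rparr>"

definition gen :: "'s \<Rightarrow> 's list set"
  where "gen s = word_class [s]"

text \<open>An element of the group is the set of all words representing it.\<close>

definition len :: "'s list set \<Rightarrow> nat"
  where "len w = (LEAST n. \<exists>xs\<in>w. length xs = n)"

definition parabolic :: "'s \<Rightarrow> 's \<Rightarrow> 's list set set"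
  where "parabolic s t = generate W {gen s, gen t}"

definition longest :: "'s \<Rightarrow> 's \<Rightarrow> 's list set"
  where "longest s t = arg_max_on len (parabolic s t)"

definition complex :: "'s list set \<Rightarrow> bool"
  where "complex w \<longleftrightarrow>
    (\<exists>s t. adjacent s t \<and> finite (parabolic s t) \<and>
      (\<exists>x\<^sub>1\<in>carrier W. \<exists>x\<^sub>2\<in>carrier W.
        w = x\<^sub>1 \<otimes>\<^bsub>W\<^esub> longest s t \<otimes>\<^bsub>W\<^esub> x\<^sub>2 \<and> len w = len x\<^sub>1 + len (longest s t) + len x\<^sub>2))"

definition W\<^sub>c :: "'s list set set"
  where "W\<^sub>c = {w \<in> carrier W. \<not> complex w}"

end


section \<open>Hecke algebras and generalized Temperley-Lieb algebras\<close>

text \<open>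
  The Hecke algebra \<open>H\<close> is characterized as an \<open>\<A>\<close>-algebra with basis \<open>T\<close> and the prescribed
  multiplication. The library's locale \<open>algebra\<close> is restricted to commutative algebras. The
  condition \<open>T_one\<close> follows from the others unless \<open>S\<close> is empty, in which case they would only
  determine \<open>T \<one>\<close> up to a unit of \<open>\<A>\<close>.
\<close>

locale hecke_algebra = coxeter_graph S m + module \<A> H + ring H
  for S :: "'s set" and m :: "'s \<Rightarrow> 's \<Rightarrow> enat"
    and H :: "(laurent, 'h, 'n) module_scheme" (structure) +
  fixes T :: "'s list set \<Rightarrow> 'h"
  assumes smult_mult_left:
      "\<lbrakk>x \<in> carrier H; y \<in> carrier H\<rbrakk> \<Longrightarrow> (a \<odot> x) \<otimes> y = a \<odot> (x \<otimes> y)"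
    and smult_mult_right:
      "\<lbrakk>x \<in> carrier H; y \<in> carrier H\<rbrakk> \<Longrightarrow> x \<otimes> (a \<odot> y) = a \<odot> (x \<otimes> y)"
    and T_basis: "is_basis \<A> H (carrier W) T"
    and T_one: "T \<one>\<^bsub>W\<^esub> = \<one>"
    and T_mult_up:
      "\<lbrakk>s \<in> S; w \<in> carrier W; len w < len (gen s \<otimes>\<^bsub>W\<^esub> w)\<rbrakk>
        \<Longrightarrow> T (gen s) \<otimes> T w = T (gen s \<otimes>\<^bsub>W\<^esub> w)"
    and T_mult_down:
      "\<lbrakk>s \<in> S; w \<in> carrier W; len (gen s \<otimes>\<^bsub>W\<^esub> w) < len w\<rbrakk>
        \<Longrightarrow> T (gen s) \<otimes> T w = q \<odot> T (gen s \<otimes>\<^bsub>W\<^esub> w) \<oplus> (q - 1) \<odot> T w"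
begin

definition J :: "'h set"
  where "J = Idl\<^bsub>H\<^esub> {\<Oplus>w\<in>parabolic s t. T w | s t. adjacent s t \<and> m s t \<noteq> \<infinity>}"

text \<open>The library's quotient ring, equipped with the induced scalar multiplication.\<close>

definition TL :: "(laurent, 'h set) module"
  where "TL = ring.extend (H Quot J) (module.fields (\<lambda>a C. \<Union>x\<in>C. J +>\<^bsub>H\<^esub> (a \<odot> x)))"

definition t_elem :: "'s list set \<Rightarrow> 'h set"
  where "t_elem w = J +>\<^bsub>H\<^esub> T w"

text \<open>
  The conditions determine \<open>bar\<close> on the carrier of \<open>TL\<close>; outside the carrier its value
  is \<open>undefined\<close>. Being \<open>\<int>\<close>-linear is part of being a ring homomorphism.
\<close>

definition bar :: "'h set \<Rightarrow> 'h set"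
  where "bar = (THE f. f \<in> extensional (carrier TL) \<and> f \<in> ring_iso TL TL \<and>
    (\<forall>x\<in>carrier TL. f (f x) = x) \<and>
    f (v_pow 1 \<odot>\<^bsub>TL\<^esub> \<one>\<^bsub>TL\<^esub>) = v_pow (- 1) \<odot>\<^bsub>TL\<^esub> \<one>\<^bsub>TL\<^esub> \<and>
    (\<forall>w\<in>carrier W. f (t_elem w) = inv\<^bsub>TL\<^esub> (t_elem (inv\<^bsub>W\<^esub> w))))"

definition normalized_t :: "'s list set \<Rightarrow> 'h set"
  where "normalized_t w = v_pow (- int (len w)) \<odot>\<^bsub>TL\<^esub> t_elem w"

definition \<L> :: "(laurent, 'h set) module"
  where "\<L> = TL\<lparr>carrier := lin_span \<A>minus TL W\<^sub>c normalized_t\<rparr>"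

definition \<pi> :: "'h set \<Rightarrow> 'h set set"
  where "\<pi> x = {v_pow (- 1) \<odot>\<^bsub>\<L>\<^esub> y | y. y \<in> carrier \<L>} +>\<^bsub>\<L>\<^esub> x"

definition is_IC_basis :: "('s list set \<Rightarrow> 'h set) \<Rightarrow> bool"
  where "is_IC_basis c \<longleftrightarrow>
    is_basis \<A>minus \<L> W\<^sub>c c \<and>
    (\<forall>w\<in>W\<^sub>c. bar (c w) = c w \<and> \<pi> (c w) = \<pi> (normalized_t w))"

end

end

theory Submission
  imports Defs
begin

text \<open>
  The basis is found by the argument of Kazhdan and Lusztig. In a free module with basis
  \<open>e\<^sub>i\<close>, graded by heights, let a semilinear involution \<open>\<beta>\<close> be given such that \<open>\<beta> e\<^sub>i - e\<^sub>i\<close>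
  has only basis elements of smaller height. A \<open>\<beta>\<close>-invariant element with coefficients in
  \<open>v\<^sup>-\<^sup>1\<int>[v\<^sup>-\<^sup>1]\<close> vanishes, because its coefficients of maximal height are symmetric Laurent
  polynomials with negative exponents only (\<open>invariant_sublattice_zero\<close>): this is
  uniqueness. For existence, \<open>d = \<beta> e\<^sub>i - e\<^sub>i\<close> is antiinvariant, every antiinvariant element
  is \<open>g - \<beta> g\<close> for some \<open>g\<close> with coefficients in \<open>v\<^sup>-\<^sup>1\<int>[v\<^sup>-\<^sup>1]\<close> (\<open>antiinvariant_split\<close>),
  and \<open>e\<^sub>i + g\<close> is invariant. The resulting elements are a unitriangular transform of the
  \<open>e\<^sub>i\<close> and hence a basis of the lattice.

  To apply this to \<open>v\<^bsup>-l(w)\<^esup> t\<^sub>w\<close>, \<open>w \<in> W\<^sub>c\<close>, with height \<open>l\<close>, three facts are needed: that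
  the bar involution of the Hecke algebra exists and preserves the ideal, that it is
  triangular, and that the \<open>t\<^sub>w\<close>, \<open>w \<in> W\<^sub>c\<close>, are a basis of the quotient.

  Let \<open>E\<close> be the sum of the basis elements \<open>T\<^sub>w\<close> over a finite rank two parabolic subgroup.
  It satisfies \<open>T\<^sub>s E = q E\<close> for the two generators \<open>s\<close>, and so does its image under the bar
  involution; but in the span of these \<open>T\<^sub>w\<close> this determines \<open>E\<close> up to a scalar (\<open>hbar_E\<close>).
  Triangularity holds in the Hecke algebra with respect to the length, and rewriting \<open>T\<^sub>w\<close>
  for complex \<open>w\<close> modulo the ideal produces shorter elements only (\<open>H_lt_reduce\<close>), so it is
  inherited by the quotient.

  The same rewriting shows that the \<open>t\<^sub>w\<close>, \<open>w \<in> W\<^sub>c\<close>, span. Their independence, due to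
  Graham, is the hardest part, and is proved in the manner of the diamond lemma. The ideal
  is spanned by products \<open>T\<^sub>a E T\<^sub>b\<close>, where \<open>T\<^sub>a\<close> and \<open>T\<^sub>b\<close> are products along words \<open>a\<close> and
  \<open>b\<close>. Such a product has the leading word \<open>a @ u @ b\<close>, with \<open>u\<close> an alternating word for the
  longest element of the parabolic subgroup. Let \<open>J_lt n\<close> be the span of those with a
  leading word shorter than \<open>n\<close>. If two leading words of length \<open>n\<close> are related by braid
  moves, then the difference of the two products lies in \<open>J_lt n\<close> (\<open>occurs_braid_class\<close>),
  and a product whose leading word is not reduced lies in \<open>J_lt n\<close> itself
  (\<open>occurs_not_reduced\<close>). So modulo \<open>J_lt n\<close> only one generator remains for each complex
  element of length \<open>n\<close>, and a combination of them is recognized by its coefficients at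
  complex elements (\<open>J_lt_independent\<close>).

  As a braid move that is not a commutation leaves the product at its place unchanged, the
  comparison of leading words reduces to two occurrences of alternating words in one class
  of words modulo commutation. By Levi's lemma for such classes (\<open>comm_eq_factor\<close>) the two
  occurrences are disjoint, share an end letter, cross in the pattern \<open>tst\<close>, \<open>rsr\<close> with
  commuting \<open>r\<close> and \<open>t\<close>, or use the same two letters (\<open>overlapping_occurrences\<close>). In each
  case the difference is computed explicitly.

  The facts about Coxeter groups that enter are Matsumoto's theorem and Tits' solution of
  the word problem. Both follow from the exchange condition, which is a consequence of the
  associativity of the Hecke algebra (\<open>folding\<close>), and from the fact that \<open>s t\<close> has order
  exactly \<open>m s t\<close>, seen in the geometric representation (\<open>bond_le_order\<close>).
\<close>

abbreviation "lookup \<equiv> Poly_Mapping.lookup"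
abbreviation "keys \<equiv> Poly_Mapping.keys"
abbreviation "single \<equiv> Poly_Mapping.single"

section \<open>Words and the Coxeter group\<close>

text \<open>
  Words are handled as a whole: classical reasoning is to treat \<open>xs \<in> lists S\<close> as an atom.
\<close>

declare in_listsD [rule del] in_listsI [rule del]

lemma rev_in_lists_iff [simp]: "rev xs \<in> lists A \<longleftrightarrow> xs \<in> lists A"
  by (simp add: in_lists_conv_set)

lemma concat_replicate_in_lists [simp]: "xs \<in> lists A \<Longrightarrow> concat (replicate k xs) \<in> lists A"
  by (induction k) auto

context coxeter_graph
begin

lemma word_eq_lists:
  assumes "word_eq xs ys"
  shows "xs \<in> lists S" and "ys \<in> lists S"
proof -
  have "xs \<in> lists S \<and> ys \<in> lists S"
    using assms by induction auto
  then show "xs \<in> lists S" and "ys \<in> lists S" by auto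
qed

lemma word_eq_append_context:
  assumes "word_eq xs ys" "us \<in> lists S" "vs \<in> lists S"
  shows "word_eq (us @ xs @ vs) (us @ ys @ vs)"
  using assms
proof (induction arbitrary: us vs)
  case (refl xs)
  then show ?case by (intro word_eq.refl) auto
next
  case (sym xs ys)
  then show ?case by (blast intro: word_eq.sym)
next
  case (trans xs ys zs)
  then show ?case by (blast intro: word_eq.trans)
next
  case (rel xs ys s t k)
  then have "word_eq ((us @ xs) @ concat (replicate k [s, t]) @ (ys @ vs)) ((us @ xs) @ (ys @ vs))"
    by (intro word_eq.rel) auto
  then show ?case by simp
qed

lemma word_eq_append:
  assumes "word_eq xs ys" "word_eq us vs"
  shows "word_eq (xs @ us) (ys @ vs)"
proof -
  have "word_eq (xs @ us) (ys @ us)"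
    using word_eq_append_context[of xs ys "[]" us] assms word_eq_lists by auto
  moreover have "word_eq (ys @ us) (ys @ vs)"
    using word_eq_append_context[of us vs ys "[]"] assms word_eq_lists by auto
  ultimately show ?thesis by (rule word_eq.trans)
qed

lemma word_class_eq_iff:
  assumes "xs \<in> lists S"
  shows "word_class xs = word_class ys \<longleftrightarrow> word_eq xs ys"
proof
  assume "word_class xs = word_class ys"
  moreover have "xs \<in> word_class xs"
    using assms by (auto simp: word_class_def intro: word_eq.refl)
  ultimately show "word_eq xs ys"
    by (auto simp: word_class_def intro: word_eq.sym)
next
  assume "word_eq xs ys"
  then show "word_class xs = word_class ys"
    unfolding word_class_def by (blast intro: word_eq.sym word_eq.trans)
qed

lemma in_word_class_iff: "ys \<in> word_class xs \<longleftrightarrow> word_eq xs ys"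
  by (simp add: word_class_def)

lemma carrier_W: "carrier W = word_class ` lists S"
  by (simp add: W_def)

lemma word_class_carrier [simp]: "xs \<in> lists S \<Longrightarrow> word_class xs \<in> carrier W"
  by (simp add: carrier_W)

lemma one_W: "\<one>\<^bsub>W\<^esub> = word_class []"
  by (simp add: W_def)

lemma mult_word_class:
  assumes "xs \<in> lists S" "ys \<in> lists S"
  shows "word_class xs \<otimes>\<^bsub>W\<^esub> word_class ys = word_class (xs @ ys)"
proof -
  have *: "word_class (us @ vs) = word_class (xs @ ys)"
    if "us \<in> word_class xs" "vs \<in> word_class ys" for us vs
  proof -
    have "word_eq (xs @ ys) (us @ vs)"
      using that word_eq_append[of xs us ys vs] by (simp add: in_word_class_iff)
    then show ?thesis using assms by (subst eq_commute) (simp add: word_class_eq_iff)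
  qed
  have "xs \<in> word_class xs" "ys \<in> word_class ys"
    using assms by (auto simp: in_word_class_iff intro: word_eq.refl)
  then have "word_class xs \<noteq> {}" "word_class ys \<noteq> {}" by auto
  then have "(\<Union>us\<in>word_class xs. \<Union>vs\<in>word_class ys. word_class (us @ vs)) = word_class (xs @ ys)"
    using * by (intro SUP_eq_const) auto
  then show ?thesis by (simp add: W_def)
qed

lemma word_eq_cancel_square:
  assumes "s \<in> S" "xs \<in> lists S" "ys \<in> lists S"
  shows "word_eq (xs @ s # s # ys) (xs @ ys)"
  using word_eq.rel[of xs ys s s 1] assms m_diag by (simp add: one_enat_def)

lemma word_eq_rev_cancel:
  assumes "xs \<in> lists S"
  shows "word_eq (rev xs @ xs) []"
  using assms
proof (induction xs)
  case Nil
  then show ?case by (auto intro: word_eq.refl)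
next
  case (Cons s xs)
  then have "word_eq (rev xs @ s # s # xs) (rev xs @ xs)"
    by (intro word_eq_cancel_square) auto
  then have "word_eq (rev xs @ s # s # xs) []"
    using word_eq.trans Cons.IH Cons.hyps by blast
  then show ?case by simp
qed

lemma group_W: "group W"
proof (rule groupI)
  fix x y z assume xyz: "x \<in> carrier W" "y \<in> carrier W" "z \<in> carrier W"
  then show "x \<otimes>\<^bsub>W\<^esub> y \<in> carrier W"
    unfolding carrier_W by (auto simp: mult_word_class)
  show "x \<otimes>\<^bsub>W\<^esub> y \<otimes>\<^bsub>W\<^esub> z = x \<otimes>\<^bsub>W\<^esub> (y \<otimes>\<^bsub>W\<^esub> z)"
    using xyz unfolding carrier_W by (auto simp: mult_word_class)
next
  fix x assume x: "x \<in> carrier W"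
  then show "\<one>\<^bsub>W\<^esub> \<otimes>\<^bsub>W\<^esub> x = x"
    unfolding carrier_W by (auto simp: one_W mult_word_class)
  obtain xs where "xs \<in> lists S" "x = word_class xs"
    using x unfolding carrier_W by auto
  then have "word_class (rev xs) \<otimes>\<^bsub>W\<^esub> x = \<one>\<^bsub>W\<^esub>" "word_class (rev xs) \<in> carrier W"
    using word_eq_rev_cancel by (auto simp: one_W mult_word_class word_class_eq_iff)
  then show "\<exists>y\<in>carrier W. y \<otimes>\<^bsub>W\<^esub> x = \<one>\<^bsub>W\<^esub>" by blast
qed (auto simp: one_W)

lemma inv_word_class:
  assumes "xs \<in> lists S"
  shows "inv\<^bsub>W\<^esub> (word_class xs) = word_class (rev xs)"
proof -
  interpret W: group W by (rule group_W)
  have "word_class (rev xs) \<otimes>\<^bsub>W\<^esub> word_class xs = \<one>\<^bsub>W\<^esub>"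
    using assms word_eq_rev_cancel by (auto simp: one_W mult_word_class word_class_eq_iff)
  then show ?thesis
    using assms by (intro W.inv_equality) auto
qed

lemma gen_mult_word_class:
  "s \<in> S \<Longrightarrow> xs \<in> lists S \<Longrightarrow> gen s \<otimes>\<^bsub>W\<^esub> word_class xs = word_class (s # xs)"
  by (simp add: gen_def mult_word_class)

text \<open>
  The relators have even length. This is what rules out \<open>len (s w) = len w\<close> in \<open>len_Cons\<close>.
\<close>

lemma word_eq_parity: "word_eq xs ys \<Longrightarrow> even (length xs) = even (length ys)"
  by (induction rule: word_eq.induct) (auto simp: length_concat sum_list_replicate)

lemma len_exists:
  assumes "xs \<in> lists S"
  shows "\<exists>ys. word_eq xs ys \<and> length ys = len (word_class xs)"
proof -
  have "\<exists>ys\<in>word_class xs. length ys = len (word_class xs)"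
    unfolding len_def
    by (rule LeastI[of "\<lambda>n. \<exists>ys\<in>word_class xs. length ys = n" "length xs"])
      (use assms in \<open>auto simp: in_word_class_iff intro!: bexI[of _ xs] word_eq.refl\<close>)
  then show ?thesis by (auto simp: in_word_class_iff)
qed

lemma len_le:
  assumes "word_eq xs ys"
  shows "len (word_class xs) \<le> length ys"
  unfolding len_def by (rule Least_le) (use assms in \<open>auto simp: in_word_class_iff\<close>)

lemma len_le_length: "xs \<in> lists S \<Longrightarrow> len (word_class xs) \<le> length xs"
  by (rule len_le) (rule word_eq.refl)

lemma len_parity:
  assumes "xs \<in> lists S"
  shows "even (len (word_class xs)) = even (length xs)"
  using len_exists[OF assms] word_eq_parity by metis

lemma len_append_le:
  assumes "xs \<in> lists S" "ys \<in> lists S"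
  shows "len (word_class (xs @ ys)) \<le> len (word_class xs) + len (word_class ys)"
proof -
  obtain us vs where "word_eq xs us" "length us = len (word_class xs)"
      "word_eq ys vs" "length vs = len (word_class ys)"
    using assms len_exists by meson
  then show ?thesis using len_le[OF word_eq_append] by (metis length_append)
qed

lemma len_Nil [simp]: "len (word_class []) = 0"
  using len_le_length[of "[]"] by simp

lemma len_gen:
  assumes "s \<in> S" shows "len (word_class [s]) = 1"
  using len_le_length[of "[s]"] len_parity[of "[s]"] assms
  by (cases "len (word_class [s])") auto

lemma len_Cons:
  assumes "s \<in> S" "xs \<in> lists S"
  shows "len (word_class (s # xs)) = len (word_class xs) + 1 \<or>
    len (word_class xs) = len (word_class (s # xs)) + 1"
proof -
  have "len (word_class (s # xs)) \<le> len (word_class xs) + 1"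
    using len_append_le[of "[s]" xs] assms len_gen by auto
  moreover have "word_class (s # s # xs) = word_class xs"
    using word_eq_cancel_square[of s "[]" xs] assms by (auto simp: word_class_eq_iff)
  then have "len (word_class xs) \<le> len (word_class (s # xs)) + 1"
    using len_append_le[of "[s]" "s # xs"] assms len_gen by auto
  moreover have "even (len (word_class (s # xs))) \<noteq> even (len (word_class xs))"
    using assms len_parity[of xs] len_parity[of "s # xs"] by simp
  then have "len (word_class (s # xs)) \<noteq> len (word_class xs)" by auto
  ultimately show ?thesis by linarith
qed

lemma word_eq_rev:
  assumes "word_eq xs ys" shows "word_eq (rev xs) (rev ys)"
proof -
  have l: "xs \<in> lists S" "ys \<in> lists S" using assms word_eq_lists by auto
  have "word_class xs = word_class ys" using assms l by (simp add: word_class_eq_iff)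
  then have "inv\<^bsub>W\<^esub> (word_class xs) = inv\<^bsub>W\<^esub> (word_class ys)" by simp
  then show ?thesis using l by (auto simp: inv_word_class word_class_eq_iff)
qed

lemma len_rev:
  assumes "xs \<in> lists S" shows "len (word_class (rev xs)) = len (word_class xs)"
proof -
  have *: "len (word_class (rev xs)) \<le> len (word_class xs)" if "xs \<in> lists S" for xs
    using len_exists[OF that] len_le[OF word_eq_rev] by (metis length_rev)
  show ?thesis using *[OF assms] *[of "rev xs"] assms by (simp add: le_antisym)
qed

definition reduced :: "'s list \<Rightarrow> bool"
  where "reduced xs \<longleftrightarrow> xs \<in> lists S \<and> len (word_class xs) = length xs"

lemma reduced_lists: "reduced xs \<Longrightarrow> xs \<in> lists S"
  by (simp add: reduced_def)

lemma reduced_exists: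
  assumes "w \<in> carrier W"
  obtains xs where "reduced xs" "word_class xs = w"
proof -
  obtain ys where ys: "ys \<in> lists S" "w = word_class ys"
    using assms by (auto simp: carrier_W)
  then obtain xs where xs: "word_eq ys xs" "length xs = len w" using len_exists by blast
  then have "word_class xs = w" using ys word_class_eq_iff[of ys xs] by simp
  moreover have "xs \<in> lists S" using xs word_eq_lists by blast
  ultimately show thesis using that[of xs] xs by (simp add: reduced_def)
qed

lemma reduced_append:
  assumes "reduced (xs @ ys)" shows "reduced xs" and "reduced ys"
  using assms len_append_le[of xs ys] len_le_length[of xs] len_le_length[of ys]
  by (auto simp: reduced_def)

lemma reduced_Cons: "reduced (s # xs) \<Longrightarrow> reduced xs \<and> s \<in> S"
  using reduced_append(2)[of "[s]" xs] reduced_lists by auto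

lemma reduced_rev: "reduced (rev xs) = reduced xs"
  unfolding reduced_def using len_rev[of xs] by auto

lemma reduced_Nil [simp]: "reduced []"
  by (simp add: reduced_def)

lemma word_eq_reduced: "word_eq xs ys \<Longrightarrow> length xs = length ys \<Longrightarrow> reduced xs \<Longrightarrow> reduced ys"
  unfolding reduced_def using word_eq_lists[of xs ys] word_class_eq_iff[of xs ys] by auto

lemma word_eq_left_cancel:
  assumes "word_eq (us @ xs) (us @ ys)"
  shows "word_eq xs ys"
proof -
  have l: "us \<in> lists S" "xs \<in> lists S" "ys \<in> lists S" using word_eq_lists[OF assms] by auto
  interpret W: group W by (rule group_W)
  have "word_class us \<otimes>\<^bsub>W\<^esub> word_class xs = word_class us \<otimes>\<^bsub>W\<^esub> word_class ys"
    using assms l by (simp add: mult_word_class word_class_eq_iff)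
  then show ?thesis using l by (simp add: word_class_eq_iff)
qed

section \<open>The dual geometric representation\<close>

text \<open>
  The representation contragredient to Tits' geometric representation. A function \<open>f\<close> on \<open>S\<close>
  stands for the linear form with value \<open>f s\<close> at the simple root of \<open>s\<close>, so that infinite
  \<open>S\<close> causes no finiteness conditions. The coefficient is \<open>-2 B(s, u)\<close>, where \<open>B\<close> is the
  bilinear form with \<open>B(s, u) = - cos (\<pi> / m s u)\<close>.
\<close>

definition coxeter_coeff :: "'s \<Rightarrow> 's \<Rightarrow> real"
  where "coxeter_coeff s u = (case m s u of enat k \<Rightarrow> 2 * cos (pi / real k) | \<infinity> \<Rightarrow> 2)"

definition reflect :: "'s \<Rightarrow> ('s \<Rightarrow> real) \<Rightarrow> 's \<Rightarrow> real"
  where "reflect s f u = f u + coxeter_coeff s u * f s"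

definition act :: "'s list \<Rightarrow> ('s \<Rightarrow> real) \<Rightarrow> 's \<Rightarrow> real"
  where "act xs f = foldr reflect xs f"

lemma act_append: "act (xs @ ys) f = act xs (act ys f)"
  by (simp add: act_def)

lemma act_cong:
  assumes "xs \<in> lists S" "\<And>u. u \<in> S \<Longrightarrow> f u = g u" "u \<in> S"
  shows "act xs f u = act xs g u"
  using assms by (induction xs arbitrary: u) (auto simp: act_def reflect_def)

lemma coxeter_coeff_self: "s \<in> S \<Longrightarrow> coxeter_coeff s s = -2"
  by (simp add: coxeter_coeff_def m_diag one_enat_def)

lemma coxeter_coeff_sym: "s \<in> S \<Longrightarrow> t \<in> S \<Longrightarrow> coxeter_coeff s t = coxeter_coeff t s"
  by (simp add: coxeter_coeff_def m_sym)

text \<open>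
  The values at \<open>s\<close> and \<open>t\<close> evolve independently of all others, by a rotation through
  \<open>2 * \<theta>\<close> in suitable coordinates; the factor \<open>sin \<theta>\<close> clears the denominators of its matrix.
\<close>

lemma act_alternating_plane:
  fixes \<theta> :: real
  assumes st: "s \<in> S" "t \<in> S" and c: "coxeter_coeff s t = 2 * cos \<theta>"
  shows "act (concat (replicate j [s, t])) f s * sin \<theta> =
      - f s * sin ((2 * real j - 1) * \<theta>) - f t * sin (2 * real j * \<theta>)"
    and "act (concat (replicate j [s, t])) f t * sin \<theta> =
      f s * sin (2 * real j * \<theta>) + f t * sin ((2 * real j + 1) * \<theta>)"
proof -
  have "act (concat (replicate j [s, t])) f s * sin \<theta> =
      - f s * sin ((2 * real j - 1) * \<theta>) - f t * sin (2 * real j * \<theta>) \<and>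
    act (concat (replicate j [s, t])) f t * sin \<theta> =
      f s * sin (2 * real j * \<theta>) + f t * sin ((2 * real j + 1) * \<theta>)"
  proof (induction j)
    case 0
    then show ?case by (simp add: act_def)
  next
    case (Suc j)
    define x y where "x = act (concat (replicate j [s, t])) f s"
      and "y = act (concat (replicate j [s, t])) f t"
    have step: "act (concat (replicate (Suc j) [s, t])) f s = - x - 2 * cos \<theta> * y"
      "act (concat (replicate (Suc j) [s, t])) f t = 2 * cos \<theta> * x + (4 * (cos \<theta>)\<^sup>2 - 1) * y"
      using st c coxeter_coeff_sym[of s t]
      by (simp_all add: act_def reflect_def coxeter_coeff_self x_def y_def power2_eq_square algebra_simps)
    have three: "sin (a + \<theta>) = 2 * cos \<theta> * sin a - sin (a - \<theta>)" for a
      by (simp add: sin_add sin_diff)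
    define a where "a = 2 * real j * \<theta>"
    have e: "(2 * real j - 1) * \<theta> = a - \<theta>" "(2 * real j + 1) * \<theta> = a + \<theta>"
      "(2 * real (Suc j) - 1) * \<theta> = a + \<theta>" "2 * real (Suc j) * \<theta> = (a + \<theta>) + \<theta>"
      "(2 * real (Suc j) + 1) * \<theta> = ((a + \<theta>) + \<theta>) + \<theta>"
      by (simp_all add: a_def algebra_simps)
    have IH: "x * sin \<theta> = - f s * sin (a - \<theta>) - f t * sin a"
      "y * sin \<theta> = f s * sin a + f t * sin (a + \<theta>)"
      using Suc unfolding e x_def y_def a_def[symmetric] by auto
    have r1: "sin (a + \<theta> + \<theta>) = 2 * cos \<theta> * sin (a + \<theta>) - sin a"
      using three[of "a + \<theta>"] by (simp only: add_diff_cancel_right')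
    have r2: "sin (a + \<theta> + \<theta> + \<theta>) = 2 * cos \<theta> * sin (a + \<theta> + \<theta>) - sin (a + \<theta>)"
      using three[of "a + \<theta> + \<theta>"] by (simp only: add_diff_cancel_right')
    have "(- x - 2 * cos \<theta> * y) * sin \<theta> = - (x * sin \<theta>) - 2 * cos \<theta> * (y * sin \<theta>)"
      by (simp add: algebra_simps)
    also have "\<dots> = - f s * sin (a + \<theta>) - f t * sin (a + \<theta> + \<theta>)"
      unfolding IH r1 three[of a] by (simp add: algebra_simps)
    finally have 1: "(- x - 2 * cos \<theta> * y) * sin \<theta> = - f s * sin (a + \<theta>) - f t * sin (a + \<theta> + \<theta>)" .
    have "(2 * cos \<theta> * x + (4 * (cos \<theta>)\<^sup>2 - 1) * y) * sin \<theta>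
        = 2 * cos \<theta> * (x * sin \<theta>) + (4 * (cos \<theta>)\<^sup>2 - 1) * (y * sin \<theta>)"
      by (simp add: algebra_simps)
    also have "\<dots> = f s * sin (a + \<theta> + \<theta>) + f t * sin (a + \<theta> + \<theta> + \<theta>)"
      unfolding IH r2 r1 three[of a] by (simp add: algebra_simps power2_eq_square)
    finally have 2: "(2 * cos \<theta> * x + (4 * (cos \<theta>)\<^sup>2 - 1) * y) * sin \<theta>
        = f s * sin (a + \<theta> + \<theta>) + f t * sin (a + \<theta> + \<theta> + \<theta>)" .
    show ?case unfolding step e using 1 2 by simp
  qed
  then show "act (concat (replicate j [s, t])) f s * sin \<theta> =
      - f s * sin ((2 * real j - 1) * \<theta>) - f t * sin (2 * real j * \<theta>)"
    and "act (concat (replicate j [s, t])) f t * sin \<theta> =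
      f s * sin (2 * real j * \<theta>) + f t * sin ((2 * real j + 1) * \<theta>)" by auto
qed

text \<open>
  The value at a third node \<open>u\<close> is controlled by a linear form in the values at \<open>u\<close>, \<open>s\<close> and
  \<open>t\<close> that is fixed by both reflections. The assumptions on \<open>l\<close> and \<open>k\<close> express that it is
  fixed.
\<close>

lemma act_alternating_invariant:
  assumes st: "s \<in> S" "t \<in> S" "u \<in> S" and c: "coxeter_coeff s t = 2 * cos \<theta>"
    and l: "coxeter_coeff s u - 2 * l + 2 * cos \<theta> * k = 0"
    and k: "coxeter_coeff t u - 2 * k + 2 * cos \<theta> * l = 0"
  shows "(let g = act (concat (replicate j [s, t])) f in g u + l * g s + k * g t) = f u + l * f s + k * f t"
proof (induction j)
  case 0
  then show ?case by (simp add: act_def)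
next
  case (Suc j)
  have inv_s: "reflect s g u + l * reflect s g s + k * reflect s g t = g u + l * g s + k * g t" for g
  proof -
    have "reflect s g u + l * reflect s g s + k * reflect s g t =
      g u + l * g s + k * g t + (coxeter_coeff s u - 2 * l + 2 * cos \<theta> * k) * g s"
      using st c by (simp add: reflect_def coxeter_coeff_self algebra_simps)
    then show ?thesis by (simp add: l)
  qed
  have inv_t: "reflect t g u + l * reflect t g s + k * reflect t g t = g u + l * g s + k * g t" for g
  proof -
    have "reflect t g u + l * reflect t g s + k * reflect t g t =
      g u + l * g s + k * g t + (coxeter_coeff t u - 2 * k + 2 * cos \<theta> * l) * g t"
      using st c coxeter_coeff_sym[of s t] by (simp add: reflect_def coxeter_coeff_self algebra_simps)
    then show ?thesis by (simp add: k)
  qed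
  have "act (concat (replicate (Suc j) [s, t])) f =
      reflect s (reflect t (act (concat (replicate j [s, t])) f))"
    by (simp add: act_def)
  then show ?case using Suc inv_s inv_t by (simp add: Let_def)
qed

lemma sin_pi_div_nonzero: "2 \<le> k \<Longrightarrow> sin (pi / real k) \<noteq> 0"
  by (rule less_imp_neq[symmetric], rule sin_gt_zero) (auto simp: field_simps)

lemma act_relation:
  assumes st: "s \<in> S" "t \<in> S" and k: "m s t = enat k" and u: "u \<in> S"
  shows "act (concat (replicate k [s, t])) f u = f u"
proof (cases "s = t")
  case True
  then have "k = 1" using m_diag[of s] k st by (simp add: one_enat_def)
  then show ?thesis using True st by (simp add: act_def reflect_def coxeter_coeff_self)
next
  case False
  then have k2: "2 \<le> k" using m_ge_2[of s t] st k by (simp add: numeral_eq_enat)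
  define \<theta> where "\<theta> = pi / real k"
  have c: "coxeter_coeff s t = 2 * cos \<theta>" using k by (simp add: coxeter_coeff_def \<theta>_def)
  have sn: "sin \<theta> \<noteq> 0" unfolding \<theta>_def using k2 by (rule sin_pi_div_nonzero)
  have k\<theta>: "2 * real k * \<theta> = 2 * pi" using k2 by (simp add: \<theta>_def)
  have e: "sin (2 * real k * \<theta>) = 0" "sin ((2 * real k + 1) * \<theta>) = sin \<theta>"
    "sin ((2 * real k - 1) * \<theta>) = - sin \<theta>"
    by (simp_all add: k\<theta> distrib_right left_diff_distrib sin_add sin_diff)
  define g where "g = act (concat (replicate k [s, t])) f"
  have "g s * sin \<theta> = f s * sin \<theta>" "g t * sin \<theta> = f t * sin \<theta>"
    using act_alternating_plane[OF st c, of k f] unfolding e g_def by auto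
  then have gst: "g s = f s" "g t = f t" using sn by auto
  \<comment> \<open>\<open>l\<close> and \<open>n\<close> solve the two equations for an invariant linear form by Cramer's rule.\<close>
  define D where "D = 1 - (cos \<theta>)\<^sup>2"
  have D: "D \<noteq> 0" using sn by (simp add: D_def sin_squared_eq[symmetric])
  define a b where "a = coxeter_coeff s u" and "b = coxeter_coeff t u"
  define l n where "l = (a + cos \<theta> * b) / (2 * D)" and "n = (b + cos \<theta> * a) / (2 * D)"
  have "2 * D * (a - 2 * l + 2 * cos \<theta> * n) = 0"
    unfolding l_def n_def using D by (simp add: field_simps) (simp add: D_def algebra_simps power2_eq_square)
  moreover have "2 * D * (b - 2 * n + 2 * cos \<theta> * l) = 0"
    unfolding l_def n_def using D by (simp add: field_simps) (simp add: D_def algebra_simps power2_eq_square)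
  ultimately have "a - 2 * l + 2 * cos \<theta> * n = 0" "b - 2 * n + 2 * cos \<theta> * l = 0"
    using D by auto
  then have "g u + l * g s + n * g t = f u + l * f s + n * f t"
    using act_alternating_invariant[OF st u c, of l n k f] unfolding a_def b_def g_def Let_def by auto
  then show ?thesis unfolding g_def[symmetric] gst by simp
qed

lemma word_eq_act:
  assumes "word_eq xs ys" "u \<in> S"
  shows "act xs f u = act ys f u"
  using assms
proof (induction arbitrary: u f)
  case (rel xs ys s t k)
  have "act (concat (replicate k [s, t])) (act ys f) u = act ys f u" if "u \<in> S" for u
    using that rel act_relation by blast
  then show ?case using rel by (auto simp: act_append intro: act_cong)
qed auto

text \<open>
  For finite strength, \<open>s t\<close> acts on the plane of \<open>s\<close> and \<open>t\<close> as a rotation through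
  \<open>2 * pi / m s t\<close>, so that \<open>(s t)\<^sup>j = 1\<close> forces \<open>m s t\<close> to divide \<open>j\<close>. For infinite
  strength the action on this plane is unipotent and its entries grow linearly with \<open>j\<close>.
\<close>

lemma bond_le_order:
  assumes st: "s \<in> S" "t \<in> S" "s \<noteq> t" and j: "0 < j"
    and eq: "word_eq (concat (replicate j [s, t])) []"
  obtains k where "m s t = enat k" "k \<le> j"
proof (cases "m s t")
  case (enat k)
  have k2: "2 \<le> k" using m_ge_2[of s t] st enat by (simp add: numeral_eq_enat)
  have "k \<le> j"
  proof (rule ccontr)
    assume "\<not> k \<le> j"
    define \<theta> where "\<theta> = pi / real k"
    define f :: "'s \<Rightarrow> real" where "f u = (if u = s then 1 else 0)" for u
    have c: "coxeter_coeff s t = 2 * cos \<theta>" using enat by (simp add: coxeter_coeff_def \<theta>_def)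
    have sn: "0 < sin \<theta>" unfolding \<theta>_def using k2 by (intro sin_gt_zero) (auto simp: field_simps)
    have "act (concat (replicate j [s, t])) f s = f s" "act (concat (replicate j [s, t])) f t = f t"
      using word_eq_act[OF eq] st by (auto simp: act_def)
    then have 1: "sin (2 * real j * \<theta>) = 0" and 2: "sin \<theta> = - sin ((2 * real j - 1) * \<theta>)"
      using act_alternating_plane[OF st(1,2) c, of j f] st by (auto simp: f_def)
    have "sin ((2 * real j - 1) * \<theta>) = - cos (2 * real j * \<theta>) * sin \<theta>"
      using 1 by (simp add: left_diff_distrib sin_diff)
    then have "cos (2 * real j * \<theta>) = 1" using 2 sn by simp
    then obtain n :: int where n: "2 * real j * \<theta> = of_int n * 2 * pi"
      using cos_one_2pi_int by auto
    then have "real j = of_int n * real k" using k2 by (simp add: \<theta>_def field_simps)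
    then have "int j = n * int k" by (metis of_int_eq_iff of_int_mult of_int_of_nat_eq)
    then have "int k dvd int j" by simp
    then have "k dvd j" by presburger
    then show False using \<open>\<not> k \<le> j\<close> j by (simp add: dvd_imp_le)
  qed
  then show thesis using that enat by blast
next
  case infinity
  define f :: "'s \<Rightarrow> real" where "f u = (if u = s then 1 else 0)" for u
  have cc: "coxeter_coeff s t = 2" "coxeter_coeff t s = 2"
    using infinity st m_sym[of s t] by (auto simp: coxeter_coeff_def)
  have "act (concat (replicate i [s, t])) f s = 1 - 2 * real i \<and>
      act (concat (replicate i [s, t])) f t = 2 * real i" for i
    using st cc by (induction i) (auto simp: act_def f_def reflect_def coxeter_coeff_self)
  moreover have "act (concat (replicate j [s, t])) f t = f t"
    using word_eq_act[OF eq] st by (auto simp: act_def)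
  ultimately show thesis using j st by (auto simp: f_def)
qed

section \<open>Alternating words and braid moves\<close>

fun alt :: "'s \<Rightarrow> 's \<Rightarrow> nat \<Rightarrow> 's list" where
  "alt s t 0 = []"
| "alt s t (Suc n) = s # alt t s n"

lemma length_alt [simp]: "length (alt s t n) = n"
  by (induction s t n rule: alt.induct) auto

lemma alt_in_lists [simp]: "s \<in> S \<Longrightarrow> t \<in> S \<Longrightarrow> alt s t n \<in> lists S"
  by (induction s t n rule: alt.induct) auto

lemma alt_in_lists_general: "s \<in> A \<Longrightarrow> t \<in> A \<Longrightarrow> alt s t n \<in> lists A"
  by (induction s t n rule: alt.induct) auto

lemma alt_add: "alt s t (i + j) = alt s t i @ (if even i then alt s t j else alt t s j)"
  by (induction s t i rule: alt.induct) auto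

lemma rev_alt: "rev (alt s t n) = (if even n then alt t s n else alt s t n)"
proof (induction s t n rule: alt.induct)
  case (2 s t n)
  have *: "a # alt b a n = alt a b n @ (if even n then [a] else [b])" for a b
    using alt_add[of a b n 1] by simp
  have "rev (alt s t (Suc n)) = rev (alt t s n) @ [s]" by simp
  also have "\<dots> = (if even n then alt s t n @ [s] else alt t s n @ [s])" using 2 by simp
  also have "\<dots> = (if even n then s # alt t s n else t # alt s t n)" unfolding * by simp
  finally show ?case by simp
qed auto

lemma concat_replicate_alt: "concat (replicate n [s, t]) = alt s t (n + n)"
  by (induction n) auto

lemma alt_double: "alt s t (n + n) = alt s t n @ rev (alt t s n)"
  by (simp add: alt_add rev_alt)

lemma word_eq_append_rev_iff:
  assumes "xs \<in> lists S" "ys \<in> lists S"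
  shows "word_eq (xs @ rev ys) [] \<longleftrightarrow> word_eq xs ys"
proof
  interpret W: group W by (rule group_W)
  assume "word_eq (xs @ rev ys) []"
  then have "word_class xs \<otimes>\<^bsub>W\<^esub> inv\<^bsub>W\<^esub> (word_class ys) = \<one>\<^bsub>W\<^esub>"
    using assms by (simp add: inv_word_class mult_word_class one_W word_class_eq_iff)
  then have "word_class xs = word_class ys"
    using assms by (metis W.inv_closed W.inv_equality W.inv_inv word_class_carrier)
  then show "word_eq xs ys" using assms by (simp add: word_class_eq_iff)
next
  assume "word_eq xs ys"
  then have "word_eq (xs @ rev ys) (ys @ rev ys)"
    using assms by (intro word_eq_append word_eq.refl) auto
  moreover have "word_eq (ys @ rev ys) []"
    using word_eq_rev_cancel[of "rev ys"] assms by simp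
  ultimately show "word_eq (xs @ rev ys) []" by (rule word_eq.trans)
qed

lemma word_eq_alt_iff:
  assumes "s \<in> S" "t \<in> S"
  shows "word_eq (alt s t k) (alt t s k) \<longleftrightarrow> word_eq (concat (replicate k [s, t])) []"
  unfolding concat_replicate_alt alt_double using assms by (simp add: word_eq_append_rev_iff)

lemma word_eq_alt:
  assumes "s \<in> S" "t \<in> S" "m s t = enat k"
  shows "word_eq (alt s t k) (alt t s k)"
  using word_eq.rel[of "[]" "[]" s t k] assms by (simp add: word_eq_alt_iff)

lemma bond_le_alt:
  assumes "s \<in> S" "t \<in> S" "s \<noteq> t" "0 < j" "word_eq (alt s t j) (alt t s j)"
  obtains k where "m s t = enat k" "k \<le> j"
  using bond_le_order[of s t j] assms by (auto simp: word_eq_alt_iff)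

definition commuting :: "'s \<Rightarrow> 's \<Rightarrow> bool"
  where "commuting s t \<longleftrightarrow> s \<in> S \<and> t \<in> S \<and> s \<noteq> t \<and> m s t = 2"

text \<open>These are the bonds that contribute a generator to the ideal.\<close>

definition bond :: "'s \<Rightarrow> 's \<Rightarrow> nat \<Rightarrow> bool"
  where "bond s t k \<longleftrightarrow> s \<in> S \<and> t \<in> S \<and> s \<noteq> t \<and> 3 \<le> k \<and> m s t = enat k"

lemma commuting_sym: "commuting s t \<Longrightarrow> commuting t s"
  by (auto simp: commuting_def m_sym)

lemma bond_sym: "bond s t k \<Longrightarrow> bond t s k"
  by (auto simp: bond_def m_sym)

lemma bond_not_commuting: "bond s t k \<Longrightarrow> \<not> commuting s t"
  by (auto simp: bond_def commuting_def numeral_eq_enat)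

lemma bond_unique: "bond s t k \<Longrightarrow> bond s t l \<Longrightarrow> k = l"
  by (simp add: bond_def)

lemma commuting_or_bond:
  assumes "s \<in> S" "t \<in> S" "s \<noteq> t" "m s t = enat k"
  shows "commuting s t \<and> k = 2 \<or> bond s t k"
  using m_ge_2[of s t] assms unfolding commuting_def bond_def by (auto simp: numeral_eq_enat)

text \<open>
  Commutations are separated from the other braid moves, because occurrences of alternating
  words are compared within classes of words modulo commutation.
\<close>

inductive comm_step :: "'s list \<Rightarrow> 's list \<Rightarrow> bool" where
  "commuting s t \<Longrightarrow> comm_step (us @ [s, t] @ vs) (us @ [t, s] @ vs)"

inductive braid_step :: "'s list \<Rightarrow> 's list \<Rightarrow> bool" where
  comm: "comm_step xs ys \<Longrightarrow> braid_step xs ys"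
| long: "bond s t k \<Longrightarrow> braid_step (us @ alt s t k @ vs) (us @ alt t s k @ vs)"

abbreviation comm_eq :: "'s list \<Rightarrow> 's list \<Rightarrow> bool"
  where "comm_eq \<equiv> comm_step\<^sup>*\<^sup>*"

abbreviation braid_eq :: "'s list \<Rightarrow> 's list \<Rightarrow> bool"
  where "braid_eq \<equiv> braid_step\<^sup>*\<^sup>*"

lemma comm_step_sym: "comm_step xs ys \<Longrightarrow> comm_step ys xs"
  by (auto elim!: comm_step.cases intro: comm_step.intros commuting_sym)

lemma comm_step_context: "comm_step xs ys \<Longrightarrow> comm_step (us @ xs @ vs) (us @ ys @ vs)"
proof (induction rule: comm_step.induct)
  case (1 s t xs ys)
  then show ?case using comm_step.intros[of s t "us @ xs" "ys @ vs"] by simp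
qed

lemma braid_step_sym: "braid_step xs ys \<Longrightarrow> braid_step ys xs"
  by (auto elim!: braid_step.cases intro: braid_step.intros bond_sym comm_step_sym)

lemma braid_step_context: "braid_step xs ys \<Longrightarrow> braid_step (us @ xs @ vs) (us @ ys @ vs)"
proof (induction rule: braid_step.induct)
  case (comm xs ys)
  then show ?case by (intro braid_step.comm comm_step_context)
next
  case (long s t k xs ys)
  then show ?case using braid_step.long[of s t k "us @ xs" "ys @ vs"] by simp
qed

lemma comm_eq_sym: "comm_eq xs ys \<Longrightarrow> comm_eq ys xs"
  by (metis comm_step_sym sympI sympD symp_rtranclp)

lemma comm_eq_context: "comm_eq xs ys \<Longrightarrow> comm_eq (us @ xs @ vs) (us @ ys @ vs)"
  by (induction rule: rtranclp_induct) (auto intro: rtranclp.rtrancl_into_rtrancl comm_step_context)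

lemma comm_eq_append: "comm_eq xs ys \<Longrightarrow> comm_eq us vs \<Longrightarrow> comm_eq (xs @ us) (ys @ vs)"
  using comm_eq_context[of xs ys "[]" us] comm_eq_context[of us vs ys "[]"] by auto

lemma comm_eq_Cons: "comm_eq xs ys \<Longrightarrow> comm_eq (s # xs) (s # ys)"
  using comm_eq_context[of xs ys "[s]" "[]"] by auto

lemma braid_eq_sym: "braid_eq xs ys \<Longrightarrow> braid_eq ys xs"
  by (metis braid_step_sym sympI sympD symp_rtranclp)

lemma braid_eq_Cons: "braid_eq xs ys \<Longrightarrow> braid_eq (s # xs) (s # ys)"
proof (induction rule: rtranclp_induct)
  case (step ys zs)
  have "braid_step (s # ys) (s # zs)"
    using braid_step_context[of ys zs "[s]" "[]"] step by simp
  then show ?case using step by (simp add: rtranclp.rtrancl_into_rtrancl)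
qed auto

lemma comm_eq_length: "comm_eq xs ys \<Longrightarrow> length xs = length ys"
  by (induction rule: rtranclp_induct) (auto elim: comm_step.cases)

lemma comm_eq_set: "comm_eq xs ys \<Longrightarrow> set xs = set ys"
proof (induction rule: rtranclp_induct)
  case (step ys zs)
  have "set ys = set zs" using step.hyps(2) by (auto elim!: comm_step.cases)
  then show ?case using step.IH by simp
qed simp

lemma comm_eq_lists: "comm_eq xs ys \<Longrightarrow> xs \<in> lists S \<longleftrightarrow> ys \<in> lists S"
  using comm_eq_set[of xs ys] by (simp add: in_lists_conv_set)

lemma braid_eq_length: "braid_eq xs ys \<Longrightarrow> length xs = length ys"
proof (induction rule: rtranclp_induct)
  case (step ys zs)
  then show ?case by (auto elim!: braid_step.cases comm_step.cases)
qed auto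

section \<open>Factorizations modulo commutation\<close>

text \<open>
  As \<open>commuting\<close> is irreflexive, such words have no letter in common.
\<close>

definition commuting_words :: "'s list \<Rightarrow> 's list \<Rightarrow> bool"
  where "commuting_words xs ys \<longleftrightarrow> (\<forall>x\<in>set xs. \<forall>y\<in>set ys. commuting x y)"

lemma comm_eq_move_front:
  "(\<And>x. x \<in> set us \<Longrightarrow> commuting x c) \<Longrightarrow> comm_eq (us @ c # vs) (c # us @ vs)"
proof (induction us)
  case (Cons u us)
  have "comm_eq (u # us @ c # vs) (u # c # us @ vs)"
    using Cons by (intro comm_eq_Cons) auto
  moreover have "comm_step (u # c # us @ vs) (c # u # us @ vs)"
    using comm_step.intros[of u c "[]"] Cons by simp
  ultimately show ?case by simp
qed auto

text \<open>
  The first letter \<open>c\<close> can be followed through a sequence of commutations: no second \<open>c\<close>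
  ever passes it, and only letters commuting with \<open>c\<close> get in front of it.
\<close>

lemma comm_eq_first_letter:
  assumes "comm_eq (c # w) u"
  shows "\<exists>us vs. u = us @ c # vs \<and> (\<forall>x\<in>set us. commuting x c) \<and> comm_eq w (us @ vs)"
  using assms
proof (induction rule: rtranclp_induct)
  case base
  show ?case by (rule exI[of _ "[]"]) auto
next
  case (step u u')
  then obtain us vs where u: "u = us @ c # vs" "\<forall>x\<in>set us. commuting x c" "comm_eq w (us @ vs)"
    by blast
  from step.hyps(2) obtain a b p r where ab: "commuting a b" "u = p @ a # b # r" "u' = p @ b # a # r"
    by (auto elim: comm_step.cases)
  have eq: "us @ c # vs = p @ a # b # r" using u ab by simp
  then consider (1) p' where "p = us @ c # p'" "vs = p' @ a # b # r"
    | (2) "us = p" "c = a" "vs = b # r"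
    | (3) "us = p @ [a]" "c = b" "vs = r"
    | (4) r' where "us = p @ a # b # r'" "r = r' @ c # vs"
    by (auto simp: append_eq_append_conv2 append_eq_Cons_conv Cons_eq_append_conv)
  then show ?case
  proof cases
    case 1
    have "comm_step (us @ vs) (us @ p' @ b # a # r)"
      using comm_step.intros[OF ab(1), of "us @ p'" r] 1 by simp
    then have "comm_eq w (us @ p' @ b # a # r)" using u(3) by simp
    then show ?thesis using 1 u ab by (intro exI[of _ us] exI[of _ "p' @ b # a # r"]) auto
  next
    case 2
    then show ?thesis using u ab by (intro exI[of _ "p @ [b]"] exI[of _ r]) (auto intro: commuting_sym)
  next
    case 3
    then show ?thesis using u ab by (intro exI[of _ p] exI[of _ "a # r"]) auto
  next
    case 4
    have "comm_step (us @ vs) (p @ b # a # r' @ vs)"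
      using comm_step.intros[OF ab(1), of p "r' @ vs"] 4 by simp
    then have "comm_eq w (p @ b # a # r' @ vs)" using u(3) by simp
    then show ?thesis using 4 u ab by (intro exI[of _ "p @ b # a # r'"] exI[of _ vs]) auto
  qed
qed

text \<open>
  Levi's lemma for words modulo commutation: two factorizations of one class have a common
  refinement into four pieces, where the pieces that change sides commute. The proof removes
  the letters of \<open>z\<close> one by one, each of which comes either from \<open>x\<close> or from \<open>y\<close>.
\<close>

lemma comm_eq_factor:
  assumes "comm_eq (x @ y) (z @ t)"
  obtains p r s u where "comm_eq x (p @ r)" "comm_eq y (s @ u)" "comm_eq z (p @ s)"
    "comm_eq t (r @ u)" "commuting_words r s"
proof -
  have "\<exists>p r s u. comm_eq x (p @ r) \<and> comm_eq y (s @ u) \<and> comm_eq z (p @ s) \<and>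
    comm_eq t (r @ u) \<and> commuting_words r s"
    using assms
  proof (induction z arbitrary: x y)
    case Nil
    then have "comm_eq t (x @ y)" by (simp add: comm_eq_sym)
    then show ?case
      by (intro exI[of _ "[]"] exI[of _ x] exI[of _ y]) (auto simp: commuting_words_def)
  next
    case (Cons c z)
    then have "comm_eq (c # (z @ t)) (x @ y)" using comm_eq_sym by simp
    then obtain us vs where uv: "x @ y = us @ c # vs" "\<forall>x\<in>set us. commuting x c"
        "comm_eq (z @ t) (us @ vs)"
      using comm_eq_first_letter by blast
    have move: "comm_eq (us @ c # ws) (c # us @ ws)" for ws
      using uv(2) by (intro comm_eq_move_front) auto
    consider (1) x2 where "x = us @ c # x2" "vs = x2 @ y" | (2) y1 where "us = x @ y1" "y = y1 @ c # vs"
      using uv(1) by (auto simp: append_eq_append_conv2 append_eq_Cons_conv Cons_eq_append_conv)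
    then show ?case
    proof cases
      case 1
      have "comm_eq ((us @ x2) @ y) (z @ t)" using uv(3) 1 comm_eq_sym by simp
      then obtain p r s u where IH: "comm_eq (us @ x2) (p @ r)" "comm_eq y (s @ u)" "comm_eq z (p @ s)"
        "comm_eq t (r @ u)" "commuting_words r s"
        using Cons.IH by blast
      have "comm_eq x ((c # p) @ r)"
        using rtranclp_trans[OF move comm_eq_Cons[OF IH(1)]] 1 by simp
      moreover have "comm_eq (c # z) ((c # p) @ s)" using comm_eq_Cons[OF IH(3)] by simp
      ultimately show ?thesis using IH by blast
    next
      case 2
      have "comm_eq (x @ (y1 @ vs)) (z @ t)" using uv(3) 2 comm_eq_sym by simp
      then obtain p r s u where IH: "comm_eq x (p @ r)" "comm_eq (y1 @ vs) (s @ u)" "comm_eq z (p @ s)"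
        "comm_eq t (r @ u)" "commuting_words r s"
        using Cons.IH by blast
      have xc: "\<forall>x\<in>set p \<union> set r \<union> set y1. commuting x c"
        using uv(2) 2 comm_eq_set[OF IH(1)] by auto
      have "comm_eq y (c # y1 @ vs)" unfolding 2 using xc by (intro comm_eq_move_front) auto
      then have "comm_eq y ((c # s) @ u)"
        using rtranclp_trans comm_eq_Cons[OF IH(2), of c] by fastforce
      moreover have "comm_eq (p @ c # s) (c # p @ s)"
        using xc by (intro comm_eq_move_front) auto
      then have "comm_eq (c # z) (p @ (c # s))"
        using rtranclp_trans[OF comm_eq_Cons[OF IH(3), of c] comm_eq_sym] by simp
      moreover have "commuting_words r (c # s)"
        using IH(5) xc by (auto simp: commuting_words_def)
      ultimately show ?thesis using IH by blast
    qed
  qed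
  then show thesis using that by blast
qed

lemma alt_consecutive: "alt s t k = us @ a # b # vs \<Longrightarrow> a = s \<and> b = t \<or> a = t \<and> b = s"
proof (induction s t k arbitrary: us rule: alt.induct)
  case (2 s t n)
  then show ?case
    by (cases us; cases n) auto
qed auto

text \<open>No two neighbouring letters commute, so that no commutation applies at all.\<close>

lemma comm_eq_alt:
  assumes "comm_eq (alt s t k) u" "\<not> commuting s t"
  shows "u = alt s t k"
  using assms
proof (induction rule: rtranclp_induct)
  case (step u u')
  then obtain a b p r where "commuting a b" "alt s t k = p @ a # b # r"
    by (auto elim: comm_step.cases)
  then show ?case using alt_consecutive step.prems commuting_sym by metis
qed auto

end

section \<open>Algebras with a Hecke basis\<close>

text \<open>
  The Hecke algebra is studied inside a type-class ring, in which sums and products can be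
  computed with directly. Here \<open>\<tau> w\<close> is the basis element of \<open>w\<close> and \<open>co\<close> reads off its
  coefficients, which makes the \<open>\<tau> w\<close> independent. The ring may be larger than the span of
  the \<open>\<tau> w\<close>; accordingly \<open>\<tau> \<one>\<close> is only required to be neutral for the \<open>\<tau> w\<close>.
\<close>

locale hecke_rep = coxeter_graph S m + Modules.module scale
  for S :: "'s set" and m :: "'s \<Rightarrow> 's \<Rightarrow> enat"
    and scale :: "laurent \<Rightarrow> 'r::ring \<Rightarrow> 'r" (infixr \<open>*s\<close> 75) +
  fixes \<tau> :: "'s list set \<Rightarrow> 'r" and co :: "'r \<Rightarrow> ('s list set \<Rightarrow>\<^sub>0 laurent)"
  assumes scale_mult_left: "(a *s x) * y = a *s (x * y)"
    and scale_mult_right: "x * (a *s y) = a *s (x * y)"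
    and \<tau>_one_left: "w \<in> carrier W \<Longrightarrow> \<tau> (word_class []) * \<tau> w = \<tau> w"
    and \<tau>_one_right: "w \<in> carrier W \<Longrightarrow> \<tau> w * \<tau> (word_class []) = \<tau> w"
    and \<tau>_up_gen: "\<lbrakk>s \<in> S; w \<in> carrier W; len w < len (gen s \<otimes>\<^bsub>W\<^esub> w)\<rbrakk>
      \<Longrightarrow> \<tau> (gen s) * \<tau> w = \<tau> (gen s \<otimes>\<^bsub>W\<^esub> w)"
    and \<tau>_down_gen: "\<lbrakk>s \<in> S; w \<in> carrier W; len (gen s \<otimes>\<^bsub>W\<^esub> w) < len w\<rbrakk>
      \<Longrightarrow> \<tau> (gen s) * \<tau> w = q *s \<tau> (gen s \<otimes>\<^bsub>W\<^esub> w) + (q - 1) *s \<tau> w"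
    and co_add: "co (x + y) = co x + co y"
    and co_scale: "lookup (co (a *s x)) w = a * lookup (co x) w"
    and co_\<tau>: "w \<in> carrier W \<Longrightarrow> co (\<tau> w) = single w 1"
begin

abbreviation Te :: 'r
  where "Te \<equiv> \<tau> (word_class [])"

abbreviation Tg :: "'s \<Rightarrow> 'r"
  where "Tg s \<equiv> \<tau> (word_class [s])"

fun TT :: "'s list \<Rightarrow> 'r" where
  "TT [] = Te"
| "TT (s # xs) = Tg s * TT xs"

lemma \<tau>_up:
  "s \<in> S \<Longrightarrow> xs \<in> lists S \<Longrightarrow> len (word_class xs) < len (word_class (s # xs)) \<Longrightarrow>
    Tg s * \<tau> (word_class xs) = \<tau> (word_class (s # xs))"
  using \<tau>_up_gen[of s "word_class xs"] by (simp add: gen_mult_word_class gen_def[symmetric])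

lemma \<tau>_down:
  "s \<in> S \<Longrightarrow> xs \<in> lists S \<Longrightarrow> len (word_class (s # xs)) < len (word_class xs) \<Longrightarrow>
    Tg s * \<tau> (word_class xs) = q *s \<tau> (word_class (s # xs)) + (q - 1) *s \<tau> (word_class xs)"
  using \<tau>_down_gen[of s "word_class xs"] by (simp add: gen_mult_word_class gen_def[symmetric])

lemma Te_Te [simp]: "Te * Te = Te" and Te_Tg [simp]: "s \<in> S \<Longrightarrow> Te * Tg s = Tg s"
  and Tg_Te [simp]: "s \<in> S \<Longrightarrow> Tg s * Te = Tg s"
  using \<tau>_one_left \<tau>_one_right by simp_all

lemma Te_TT [simp]: "xs \<in> lists S \<Longrightarrow> Te * TT xs = TT xs"
  by (cases xs) (auto simp: mult.assoc[symmetric])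

lemma TT_append: "ys \<in> lists S \<Longrightarrow> TT (xs @ ys) = TT xs * TT ys"
  by (induction xs) (auto simp: mult.assoc)

lemma TT_Te [simp]: "xs \<in> lists S \<Longrightarrow> TT xs * Te = TT xs"
  using TT_append[of "[]" xs] by simp

lemma TT_snoc: "s \<in> S \<Longrightarrow> TT (xs @ [s]) = TT xs * Tg s"
  by (simp add: TT_append)

lemma TT_reduced: "reduced xs \<Longrightarrow> TT xs = \<tau> (word_class xs)"
proof (induction xs)
  case (Cons s xs)
  then have "reduced xs" "s \<in> S" using reduced_Cons by auto
  then show ?case using Cons \<tau>_up[of s xs] by (auto simp: reduced_def)
qed auto

lemma Tg_square: "s \<in> S \<Longrightarrow> Tg s * Tg s = q *s Te + (q - 1) *s Tg s"
proof -
  assume s: "s \<in> S"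
  have "word_class [s, s] = word_class []"
    using word_eq_cancel_square[of s "[]" "[]"] s by (simp add: word_class_eq_iff)
  then show ?thesis using \<tau>_down[of s "[s]"] s len_gen by simp
qed

text \<open>
  The defining relations of the Hecke algebra concern left multiplication; those for right
  multiplication follow by writing \<open>\<tau> w\<close> as a product along a reduced word.
\<close>

lemma \<tau>_snoc_up:
  assumes "reduced (xs @ [s])"
  shows "\<tau> (word_class xs) * Tg s = \<tau> (word_class (xs @ [s]))"
  using TT_reduced[OF assms] TT_reduced[OF reduced_append(1)[OF assms]] TT_snoc[of s xs]
    reduced_lists[OF assms] by simp

lemma \<tau>_snoc_down:
  assumes "reduced xs" "s \<in> S" "len (word_class (xs @ [s])) < length xs"
  shows "\<tau> (word_class xs) * Tg s = q *s \<tau> (word_class (xs @ [s])) + (q - 1) *s \<tau> (word_class xs)"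
proof -
  have xs: "xs \<in> lists S" using assms reduced_lists by blast
  obtain ys where ys: "reduced ys" "word_class ys = word_class (xs @ [s])"
    using reduced_exists[of "word_class (xs @ [s])"] xs assms(2) by auto
  have ysl: "ys \<in> lists S" using ys reduced_lists by blast
  have "word_class (ys @ [s]) = word_class (xs @ [s] @ [s])"
    using mult_word_class[of ys "[s]"] mult_word_class[of "xs @ [s]" "[s]"] ys ysl xs assms by simp
  also have "\<dots> = word_class xs"
    using word_eq_cancel_square[of s xs "[]"] xs assms by (simp add: word_class_eq_iff)
  finally have ysx: "word_class (ys @ [s]) = word_class xs" .
  have len_ys: "length ys = len (word_class (xs @ [s]))" using ys by (simp add: reduced_def)
  have "length xs \<le> length ys + 1"
    using len_le_length[of "ys @ [s]"] ysx ysl assms by (simp add: reduced_def)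
  then have red: "reduced (ys @ [s])"
    using ysx ysl assms len_ys by (simp add: reduced_def)
  have "\<tau> (word_class xs) * Tg s = TT ys * (Tg s * Tg s)"
    using TT_reduced[OF red] ysx TT_snoc[of s ys] TT_snoc[of s "ys @ [s]"] assms
    by (simp add: mult.assoc[symmetric])
  also have "\<dots> = q *s TT ys + (q - 1) *s (TT ys * Tg s)"
    using Tg_square assms ysl by (simp add: distrib_left scale_mult_right)
  also have "\<dots> = q *s \<tau> (word_class (xs @ [s])) + (q - 1) *s \<tau> (word_class xs)"
    using TT_reduced[OF red] TT_reduced[OF ys(1)] ys ysx TT_snoc[of s ys] assms by simp
  finally show ?thesis .
qed

section \<open>The exchange condition and Matsumoto's theorem\<close>

lemma q_minus_1_nonzero: "q - 1 \<noteq> 0"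
proof
  assume "q - 1 = 0"
  then have "lookup (q - 1) 2 = 0" by simp
  then show False by (simp add: v_pow_def lookup_minus lookup_one)
qed

text \<open>
  The product \<open>T\<^sub>s T\<^sub>w T\<^sub>t\<close>, computed in two ways, is \<open>q T\<^bsub>swt\<^esub> + (q - 1) T\<^bsub>sw\<^esub>\<close> and
  \<open>q T\<^bsub>swt\<^esub> + (q - 1) T\<^bsub>wt\<^esub>\<close>. Comparing coefficients yields \<open>sw = wt\<close>. Associativity of the
  Hecke algebra thus takes the place of roots in the derivation of the exchange condition.
\<close>

lemma folding:
  assumes "s \<in> S" "t \<in> S" "reduced (s # xs)" "reduced (xs @ [t])" "\<not> reduced (s # xs @ [t])"
  shows "word_eq (s # xs) (xs @ [t])"
proof -
  have xs: "reduced xs" "xs \<in> lists S" using assms reduced_Cons reduced_lists by blast+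
  have "len (word_class (s # xs @ [t])) < Suc (Suc (length xs))"
    using len_le_length[of "s # xs @ [t]"] assms xs by (auto simp: reduced_def)
  then have l: "len (word_class (s # xs @ [t])) = length xs"
    using len_Cons[of s "xs @ [t]"] assms xs by (auto simp: reduced_def)
  have "Tg s * \<tau> (word_class xs) * Tg t = \<tau> (word_class (s # xs)) * Tg t"
    using \<tau>_up[of s xs] assms xs by (simp add: reduced_def)
  also have "\<dots> = q *s \<tau> (word_class (s # xs @ [t])) + (q - 1) *s \<tau> (word_class (s # xs))"
    using \<tau>_snoc_down[of "s # xs" t] assms l by simp
  finally have 1: "Tg s * \<tau> (word_class xs) * Tg t = \<dots>" .
  have "Tg s * (\<tau> (word_class xs) * Tg t) = Tg s * \<tau> (word_class (xs @ [t]))"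
    using \<tau>_snoc_up assms by simp
  also have "\<dots> = q *s \<tau> (word_class (s # xs @ [t])) + (q - 1) *s \<tau> (word_class (xs @ [t]))"
    using \<tau>_down[of s "xs @ [t]"] assms l xs by (simp add: reduced_def)
  finally have "(q - 1) *s \<tau> (word_class (s # xs)) = (q - 1) *s \<tau> (word_class (xs @ [t]))"
    using 1 by (simp add: mult.assoc)
  then have eq: "(q - 1) * lookup (co (\<tau> (word_class (s # xs)))) w =
      (q - 1) * lookup (co (\<tau> (word_class (xs @ [t])))) w" for w
    using co_scale by metis
  have "word_class (s # xs) = word_class (xs @ [t])"
    using eq[of "word_class (s # xs)"] q_minus_1_nonzero assms xs
    by (auto simp: co_\<tau> lookup_single when_def split: if_splits)
  then show ?thesis using assms xs by (simp add: word_class_eq_iff)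
qed

text \<open>
  The letter \<open>t\<close> ends the shortest prefix of \<open>xs\<close> that is not reduced after prepending \<open>s\<close>.
\<close>

lemma exchange:
  assumes "reduced xs" "s \<in> S" "\<not> reduced (s # xs)"
  obtains us t vs where "xs = us @ t # vs" "word_eq (s # us) (us @ [t])"
proof -
  have "\<exists>us t vs. xs = us @ t # vs \<and> word_eq (s # us) (us @ [t])"
    using assms
  proof (induction xs rule: rev_induct)
    case Nil
    then show ?case using len_gen by (auto simp: reduced_def)
  next
    case (snoc t xs)
    have xs: "reduced xs" "t \<in> S"
      using reduced_append(1)[OF snoc.prems(1)] reduced_lists[OF snoc.prems(1)] by auto
    show ?case
    proof (cases "reduced (s # xs)")
      case True
      then have "word_eq (s # xs) (xs @ [t])"
        using folding[of s t xs] snoc.prems xs by simp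
      then show ?thesis by auto
    next
      case False
      then obtain us t' vs where "xs = us @ t' # vs" "word_eq (s # us) (us @ [t'])"
        using snoc xs by blast
      then show ?thesis by (intro exI[of _ us] exI[of _ t'] exI[of _ "vs @ [t]"]) auto
    qed
  qed
  then show thesis using that by blast
qed

lemma take_alt: "i \<le> j \<Longrightarrow> take i (alt a b j) = alt a b i"
  using alt_add[of a b i "j - i"] by simp

lemma not_reduced_descent:
  assumes "word_eq w (b # ys)" "length w = Suc (length ys)"
  shows "\<not> reduced (b # w)"
proof
  assume r: "reduced (b # w)"
  have l: "b \<in> S" "ys \<in> lists S" "w \<in> lists S" using word_eq_lists[OF assms(1)] by auto
  have "word_eq (b # w) (b # b # ys)"
    using word_eq_append_context[OF assms(1), of "[b]" "[]"] l by simp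
  moreover have "word_eq (b # b # ys) ys" using word_eq_cancel_square[of b "[]" ys] l by simp
  ultimately have "word_eq (b # w) ys" by (rule word_eq.trans)
  then have "len (word_class (b # w)) \<le> length ys" by (rule len_le)
  then show False using r assms by (simp add: reduced_def)
qed

text \<open>
  Exchanging alternately with respect to the two descents produces reduced words for \<open>w\<close>
  with longer and longer alternating prefixes, until a prefix has length \<open>m s t\<close>.
\<close>

lemma two_descents:
  assumes red: "reduced w" and ws: "word_eq w (s # xs)" "length w = Suc (length xs)"
    and wt: "word_eq w (t # ys)" "length w = Suc (length ys)" and ne: "s \<noteq> t"
  obtains k zs where "m s t = enat k" "word_eq w (alt s t k @ zs)" "length w = k + length zs"
proof -
  have l: "s \<in> S" "t \<in> S" "xs \<in> lists S" "ys \<in> lists S" "w \<in> lists S"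
    using word_eq_lists[OF ws(1)] word_eq_lists[OF wt(1)] by auto
  have "(\<exists>k zs. m s t = enat k \<and> word_eq w (alt s t k @ zs) \<and> length w = k + length zs) \<or>
     (\<exists>a b zs. (a = s \<and> b = t \<or> a = t \<and> b = s) \<and> word_eq w (alt a b (Suc j) @ zs) \<and> length w = Suc j + length zs)"
    for j
  proof (induction j)
    case 0
    have "word_eq w (alt s t (Suc 0) @ xs)" using ws by simp
    then show ?case using ws(2) by (intro disjI2 exI[of _ s] exI[of _ t] exI[of _ xs]) auto
  next
    case (Suc j)
    show ?case
    proof (cases "\<exists>k zs. m s t = enat k \<and> word_eq w (alt s t k @ zs) \<and> length w = k + length zs")
      case False
      with Suc obtain a b zs where ab: "a = s \<and> b = t \<or> a = t \<and> b = s"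
        and w: "word_eq w (alt a b (Suc j) @ zs)" "length w = Suc j + length zs" by auto
      define v where "v = alt a b (Suc j) @ zs"
      have wv: "word_eq w v" "length v = length w" using w by (simp_all add: v_def)
      have v: "reduced v" using word_eq_reduced[OF wv(1) _ red] wv by simp
      have vl: "v \<in> lists S" using v reduced_lists by blast
      have b: "b \<in> S" "a \<in> S" "a \<noteq> b" using ab l ne by auto
      have "\<exists>ys. word_eq v (b # ys) \<and> length v = Suc (length ys)"
        using ab ws wt wv by (metis word_eq.sym word_eq.trans)
      then have "\<not> reduced (b # v)" using not_reduced_descent by blast
      then obtain us c vs where ex: "v = us @ c # vs" "word_eq (b # us) (us @ [c])"
        using exchange v b by blast
      have l': "us \<in> lists S" "vs \<in> lists S" "c \<in> S" using vl ex by auto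
      show ?thesis
      proof (cases "length us < Suc j")
        case True
        define i where "i = length us"
        have "us @ [c] = take (Suc i) v" using ex by (simp add: i_def)
        also have "\<dots> = take (Suc i) (alt a b (Suc j))" using True by (simp add: v_def i_def)
        also have "\<dots> = alt a b (Suc i)" using True by (intro take_alt) (simp add: i_def)
        finally have usc: "us @ [c] = alt a b (Suc i)" .
        then have "take i (us @ [c]) = take i (alt a b (Suc i))" by simp
        then have us: "us = alt a b i" unfolding take_alt[OF le_SucI[OF order_refl]] by (simp add: i_def)
        have "word_eq (alt b a (Suc i)) (alt a b (Suc i))"
          using ex(2) unfolding usc by (simp add: us)
        then obtain k where k: "m b a = enat k" "k \<le> Suc i"
          using bond_le_alt[of b a "Suc i"] b by auto
        have kj: "k \<le> Suc j" using k True by (simp add: i_def)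
        obtain zs' where zs': "v = alt a b k @ zs'"
          unfolding v_def using alt_add[of a b k "Suc j - k"] kj by (metis append.assoc le_add_diff_inverse)
        have mst: "m s t = enat k" using k ab l m_sym by metis
        have zl: "zs' \<in> lists S" using vl zs' by simp
        have "word_eq (alt a b k @ zs') (alt s t k @ zs')"
        proof (intro word_eq_append word_eq.refl zl)
          show "word_eq (alt a b k) (alt s t k)"
            using ab word_eq_alt[of s t k] mst l by (auto intro: word_eq.sym word_eq.refl)
        qed
        then have "word_eq w (alt s t k @ zs')" using wv zs' word_eq.trans by simp
        moreover have "length w = k + length zs'" using wv zs' by simp
        ultimately show ?thesis using mst by blast
      next
        case False
        obtain us' where us': "us = alt a b (Suc j) @ us'"
        proof
          have "take (Suc j) us = take (Suc j) v" using ex(1) False by simp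
          then have "take (Suc j) us = alt a b (Suc j)" by (simp add: v_def)
          then show "us = alt a b (Suc j) @ drop (Suc j) us" by (metis append_take_drop_id)
        qed
        have "word_eq (us @ c # vs) (b # us @ vs)"
          using word_eq_append[OF word_eq.sym[OF ex(2)] word_eq.refl[OF l'(2)]] by simp
        then have "word_eq w (b # us @ vs)" using wv ex word_eq.trans by simp
        moreover have "b # us @ vs = alt b a (Suc (Suc j)) @ us' @ vs" using us' by simp
        moreover have "length w = Suc (Suc j) + length (us' @ vs)" using wv ex us' by simp
        ultimately show ?thesis using ab by metis
      qed
    qed blast
  qed
  \<comment> \<open>A prefix longer than \<open>w\<close> is impossible, which excludes the second alternative.\<close>
  from this[of "length w"] show thesis using that by auto
qed

text \<open>
  Matsumoto's theorem. If the words begin with different letters \<open>s\<close> and \<open>t\<close>, they are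
  connected through the two reduced words that begin with \<open>alt s t k\<close> and \<open>alt t s k\<close>; the
  induction hypothesis applies to pairs of words with the same first letter.
\<close>

lemma matsumoto:
  assumes "reduced xs" "word_eq xs ys" "length xs = length ys"
  shows "braid_eq xs ys"
  using assms
proof (induction "length xs" arbitrary: xs ys)
  case 0
  then show ?case by simp
next
  case (Suc n)
  obtain s xs' t ys' where xy: "xs = s # xs'" "ys = t # ys'"
    using Suc.hyps(2) Suc.prems(3) by (cases xs; cases ys) auto
  have IH: "braid_eq (c # us) (c # vs)"
    if "length us = n" "reduced (c # us)" "word_eq (c # us) (c # vs)" "length us = length vs" for c us vs
  proof (rule braid_eq_Cons, rule Suc.hyps(1))
    show "word_eq us vs" using word_eq_left_cancel[of "[c]" us vs] that by simp
    show "reduced us" using that reduced_Cons by blast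
  qed (use that in auto)
  show ?case
  proof (cases "s = t")
    case True
    then show ?thesis using IH[of xs' s ys'] Suc.prems Suc.hyps(2) unfolding xy by simp
  next
    case False
    have xl: "s \<in> S" "t \<in> S" using word_eq_lists[OF Suc.prems(2)] xy by auto
    have "word_eq xs (s # xs')" using Suc.prems reduced_lists xy by (auto intro: word_eq.refl)
    then obtain k zs where k: "m s t = enat k" "word_eq xs (alt s t k @ zs)" "length xs = k + length zs"
      using two_descents[of xs s xs' t ys'] Suc.prems xy False by auto
    have k2: "2 \<le> k" using m_ge_2[of s t] xl False k by (simp add: numeral_eq_enat)
    then obtain k' where k': "k = Suc k'" by (cases k) auto
    have zl: "zs \<in> lists S" using word_eq_lists[OF k(2)] by auto
    have "word_eq (alt s t k @ zs) (alt t s k @ zs)"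
      using word_eq_alt xl k zl by (intro word_eq_append word_eq.refl) auto
    then have "word_eq xs (alt t s k @ zs)" using k(2) word_eq.trans by blast
    then have ky: "word_eq ys (alt t s k @ zs)" using Suc.prems(2) word_eq.trans word_eq.sym by blast
    have redy: "reduced ys" using word_eq_reduced Suc.prems by blast
    have "braid_eq xs (alt s t k @ zs)"
      using IH[of xs' s "alt t s k' @ zs"] Suc.hyps(2) Suc.prems(1) xy k k' by simp
    moreover have "braid_step (alt s t k @ zs) (alt t s k @ zs)"
      using commuting_or_bond[OF xl False k(1)] comm_step.intros[of s t "[]" zs] braid_step.long[of s t k "[]" zs]
      by (auto simp: numeral_2_eq_2 intro: braid_step.comm)
    moreover have "braid_eq ys (alt t s k @ zs)"
      using IH[of ys' t "alt s t k' @ zs"] Suc.hyps(2) Suc.prems(3) xy k k' ky redy by simp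
    ultimately show ?thesis
      by (meson braid_eq_sym rtranclp.rtrancl_into_rtrancl rtranclp_trans)
  qed
qed

text \<open>
  Tits' solution of the word problem. If \<open>xs\<close> is reduced and \<open>s # xs\<close> is not, the exchange
  condition yields a reduced word for the element of \<open>xs\<close> that begins with \<open>s\<close>.
\<close>

lemma not_reduced_braid_square:
  assumes "xs \<in> lists S" "\<not> reduced xs"
  shows "\<exists>us s vs. braid_eq xs (us @ [s, s] @ vs)"
  using assms
proof (induction xs)
  case (Cons s xs)
  show ?case
  proof (cases "reduced xs")
    case True
    then obtain us t vs where ex: "xs = us @ t # vs" "word_eq (s # us) (us @ [t])"
      using exchange[of xs s] Cons.prems Cons.hyps by auto
    have l: "vs \<in> lists S" using Cons.hyps Cons.prems ex by auto
    have "word_eq (us @ t # vs) (s # us @ vs)"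
      using word_eq_append[OF word_eq.sym[OF ex(2)] word_eq.refl[OF l]] by simp
    then have "braid_eq xs (s # us @ vs)" using matsumoto True ex by simp
    then have "braid_eq (s # xs) (s # s # us @ vs)" by (rule braid_eq_Cons)
    then show ?thesis by (intro exI[of _ "[]"] exI[of _ s] exI[of _ "us @ vs"]) simp
  next
    case False
    then obtain us t vs where "braid_eq xs (us @ [t, t] @ vs)" using Cons by auto
    then have "braid_eq (s # xs) (s # us @ [t, t] @ vs)" by (rule braid_eq_Cons)
    then show ?thesis by (intro exI[of _ "s # us"] exI[of _ t] exI[of _ vs]) simp
  qed
qed simp

end

section \<open>Rank two parabolic subgroups\<close>

context coxeter_graph
begin

lemma parabolic_words:
  assumes "s \<in> S" "t \<in> S"
  shows "parabolic s t = word_class ` lists {s, t}"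
proof
  interpret W: group W by (rule group_W)
  have l: "xs \<in> lists S" if "xs \<in> lists {s, t}" for xs
    using that assms by (auto simp: in_lists_conv_set)
  have "w \<in> word_class ` lists {s, t}" if "w \<in> generate W {gen s, gen t}" for w
    using that
  proof induction
    case one
    then show ?case by (simp add: one_W)
  next
    case (incl h)
    then show ?case by (auto simp: gen_def)
  next
    case (inv h)
    then show ?case using assms by (auto simp: gen_def inv_word_class)
  next
    case (eng h1 h2)
    then obtain xs ys where "xs \<in> lists {s, t}" "ys \<in> lists {s, t}" "h1 = word_class xs" "h2 = word_class ys"
      by auto
    then show ?case by (auto simp: mult_word_class l intro!: imageI)
  qed
  then show "parabolic s t \<subseteq> word_class ` lists {s, t}" unfolding parabolic_def by blast
  have "word_class xs \<in> generate W {gen s, gen t}" if "xs \<in> lists {s, t}" for xs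
    using that
  proof induction
    case Nil
    then show ?case by (metis one_W generate.one)
  next
    case (Cons a xs)
    then have "gen a \<in> generate W {gen s, gen t}" "a \<in> S" using assms by (auto intro: generate.incl)
    then have "gen a \<otimes>\<^bsub>W\<^esub> word_class xs \<in> generate W {gen s, gen t}" using Cons by (auto intro: generate.eng)
    then show ?case using gen_mult_word_class \<open>a \<in> S\<close> Cons l by simp
  qed
  then show "word_class ` lists {s, t} \<subseteq> parabolic s t" unfolding parabolic_def by blast
qed

lemma parabolic_sym: "parabolic s t = parabolic t s"
  by (simp add: parabolic_def insert_commute)

lemma parabolic_carrier: "s \<in> S \<Longrightarrow> t \<in> S \<Longrightarrow> parabolic s t \<subseteq> carrier W"
  by (auto simp: parabolic_words carrier_W in_lists_conv_set intro!: imageI)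

lemma word_eq_alt_of_word:
  assumes st: "s \<in> S" "t \<in> S" "s \<noteq> t" and m: "m s t = enat k" and xs: "xs \<in> lists {s, t}"
  shows "\<exists>a b n. (a = s \<and> b = t \<or> a = t \<and> b = s) \<and> n \<le> k \<and> word_eq xs (alt a b n)"
  using xs
proof induction
  case Nil
  then show ?case by (intro exI[of _ s] exI[of _ t] exI[of _ 0]) (auto intro: word_eq.refl)
next
  case (Cons c xs)
  have k2: "2 \<le> k" using m_ge_2[of s t] st m by (simp add: numeral_eq_enat)
  obtain a b n where ab: "a = s \<and> b = t \<or> a = t \<and> b = s" and n: "n \<le> k" "word_eq xs (alt a b n)"
    using Cons.IH by auto
  have abS: "a \<in> S" "b \<in> S" "c \<in> S" and c: "c = a \<or> c = b" using ab st Cons.hyps by auto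
  have mab: "m a b = enat k" using ab m st m_sym by auto
  have cx: "word_eq (c # xs) (c # alt a b n)"
    using word_eq_append_context[OF n(2), of "[c]" "[]"] abS by simp
  consider "c = a" "n = 0" | n' where "c = a" "n = Suc n'" | "c = b" "n < k" | "c = b" "n = k"
    using c n(1) le_less[of n k] by (cases n) auto
  then show ?case
  proof cases
    case 1
    then have "word_eq (c # xs) (alt a b 1)" using cx by simp
    then show ?thesis using ab k2 by (intro exI[of _ a] exI[of _ b] exI[of _ 1]) auto
  next
    case 2
    then have "word_eq (c # alt a b n) (alt b a n')"
      using word_eq_cancel_square[of a "[]" "alt b a n'"] abS by simp
    then have "word_eq (c # xs) (alt b a n')" using cx word_eq.trans by blast
    then show ?thesis using ab n 2 by (intro exI[of _ b] exI[of _ a] exI[of _ n']) auto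
  next
    case 3
    then have "word_eq (c # xs) (alt b a (Suc n))" using cx by simp
    then show ?thesis using ab 3 by (intro exI[of _ b] exI[of _ a] exI[of _ "Suc n"]) auto
  next
    case 4
    obtain k' where k': "k = Suc k'" using k2 by (cases k) auto
    have "word_eq (alt a b k) (alt b a k)" using word_eq_alt abS mab by blast
    then have "word_eq (b # alt a b k) (b # b # alt a b k')"
      using word_eq_append_context[of _ _ "[b]" "[]"] abS k' by fastforce
    moreover have "word_eq (b # b # alt a b k') (alt a b k')"
      using word_eq_cancel_square[of b "[]" "alt a b k'"] abS by simp
    ultimately have "word_eq (c # xs) (alt a b k')" using cx 4 word_eq.trans by blast
    then show ?thesis using ab k' by (intro exI[of _ a] exI[of _ b] exI[of _ k']) auto
  qed
qed

lemma infinite_parabolic: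
  assumes "s \<in> S" "t \<in> S" "s \<noteq> t" "m s t = \<infinity>"
  shows "infinite (parabolic s t)"
proof -
  have l: "concat (replicate i [s, t]) \<in> lists {s, t}" for i by simp
  have lS: "concat (replicate i [s, t]) \<in> lists S" for i using assms by simp
  have "i = j" if "i \<le> j" "word_eq (concat (replicate i [s, t])) (concat (replicate j [s, t]))" for i j
  proof (rule ccontr)
    assume "i \<noteq> j"
    have "replicate j [s, t] = replicate i [s, t] @ replicate (j - i) [s, t]"
      using that by (simp flip: replicate_add)
    then have "concat (replicate j [s, t]) = concat (replicate i [s, t]) @ concat (replicate (j - i) [s, t])"
      by (simp only: concat_append)
    then have "word_eq (concat (replicate i [s, t]) @ []) (concat (replicate i [s, t]) @ concat (replicate (j - i) [s, t]))"
      using that by (simp only: append_Nil2)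
    then have "word_eq (concat (replicate (j - i) [s, t])) []"
      using word_eq.sym[OF word_eq_left_cancel] by blast
    then show False
      using bond_le_order[of s t "j - i"] assms that \<open>i \<noteq> j\<close> by auto
  qed
  then have "i = j" if "word_eq (concat (replicate i [s, t])) (concat (replicate j [s, t]))" for i j
    using that word_eq.sym by (metis nat_le_linear)
  then have "inj (\<lambda>i. word_class (concat (replicate i [s, t])))"
    using lS by (auto simp: inj_def word_class_eq_iff)
  then have "infinite (range (\<lambda>i. word_class (concat (replicate i [s, t]))))"
    using finite_imageD by blast
  moreover have "range (\<lambda>i. word_class (concat (replicate i [s, t]))) \<subseteq> parabolic s t"
    using assms l by (auto simp: parabolic_words)
  ultimately show ?thesis using finite_subset by blast
qed

end

context hecke_rep
begin

text \<open>
  If the word were not reduced, the exchange condition would yield \<open>alt s t j = alt t s j\<close>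
  in the group for some \<open>j < m s t\<close>, which contradicts the order of \<open>s t\<close>.
\<close>

lemma reduced_alt:
  assumes "s \<in> S" "t \<in> S" "s \<noteq> t" "m s t = enat k" "n \<le> k"
  shows "reduced (alt s t n)"
  using assms
proof (induction s t n rule: alt.induct)
  case (2 s t n)
  show ?case
  proof (rule ccontr)
    assume nr: "\<not> reduced (alt s t (Suc n))"
    have "reduced (alt t s n)" using 2 m_sym by simp
    then obtain us c vs where ex: "alt t s n = us @ c # vs" "word_eq (s # us) (us @ [c])"
      using exchange[of "alt t s n" s] 2 nr by auto
    define i where "i = length us"
    have i: "i < n" using arg_cong[OF ex(1), of length] by (simp add: i_def)
    have "us = take i (alt t s n)" "us @ [c] = take (Suc i) (alt t s n)" using ex by (simp_all add: i_def)
    then have us: "us = alt t s i" "us @ [c] = alt t s (Suc i)" using take_alt[of _ n t s] i by simp_all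
    have "word_eq (alt s t (Suc i)) (alt t s (Suc i))" using ex(2) unfolding us(2) by (simp add: us(1))
    then obtain k' where "m s t = enat k'" "k' \<le> Suc i" using bond_le_alt[of s t "Suc i"] 2 by auto
    then show False using 2 i by simp
  qed
qed auto

lemma parabolic_cases:
  assumes "s \<in> S" "t \<in> S" "s \<noteq> t" "m s t = enat k" "w \<in> parabolic s t"
  obtains a b n where "a = s \<and> b = t \<or> a = t \<and> b = s" "n \<le> k" "w = word_class (alt a b n)" "len w = n"
proof -
  obtain xs where xs: "xs \<in> lists {s, t}" "w = word_class xs" using assms parabolic_words by auto
  obtain a b n where ab: "a = s \<and> b = t \<or> a = t \<and> b = s" "n \<le> k" "word_eq xs (alt a b n)"
    using word_eq_alt_of_word[OF assms(1-4) xs(1)] by blast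
  have "xs \<in> lists S" using ab word_eq_lists by blast
  then have "w = word_class (alt a b n)" using xs ab word_class_eq_iff by simp
  moreover have "m a b = enat k" using ab assms m_sym by auto
  then have "reduced (alt a b n)" using ab assms by (intro reduced_alt) auto
  ultimately show thesis using that ab by (auto simp: reduced_def)
qed

lemma finite_parabolic:
  assumes "s \<in> S" "t \<in> S" "s \<noteq> t" "m s t = enat k"
  shows "finite (parabolic s t)"
proof (rule finite_subset)
  show "parabolic s t \<subseteq> (\<lambda>n. word_class (alt s t n)) ` {..k} \<union> (\<lambda>n. word_class (alt t s n)) ` {..k}"
  proof
    fix w assume w: "w \<in> parabolic s t"
    obtain a b n where "a = s \<and> b = t \<or> a = t \<and> b = s" "n \<le> k" "w = word_class (alt a b n)"
      by (rule parabolic_cases[OF assms w])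
    then show "w \<in> (\<lambda>n. word_class (alt s t n)) ` {..k} \<union> (\<lambda>n. word_class (alt t s n)) ` {..k}"
      by blast
  qed
qed auto

lemma parabolic_len:
  assumes "bond s t k" "w \<in> parabolic s t"
  shows "len w \<le> k" and "len w = k \<Longrightarrow> w = word_class (alt s t k)"
proof -
  obtain a b n where *: "a = s \<and> b = t \<or> a = t \<and> b = s" "n \<le> k" "w = word_class (alt a b n)" "len w = n"
    using parabolic_cases[of s t k w] assms bond_def by auto
  then show "len w \<le> k" by simp
  have "word_class (alt t s k) = word_class (alt s t k)"
    using assms word_eq_alt[of t s k] bond_sym[OF assms(1)] by (auto simp: bond_def word_class_eq_iff)
  then show "w = word_class (alt s t k)" if "len w = k" using that * by auto
qed

lemma bond_parabolic_carrier: "bond s t k \<Longrightarrow> parabolic s t \<subseteq> carrier W"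
  by (simp add: bond_def parabolic_carrier)

lemma bond_finite_parabolic: "bond s t k \<Longrightarrow> finite (parabolic s t)"
  using finite_parabolic[of s t k] by (auto simp: bond_def)

lemma bond_parabolic_word:
  assumes "bond s t k" "w \<in> parabolic s t"
  obtains xs where "xs \<in> lists {s, t}" "reduced xs" "w = word_class xs"
proof -
  obtain a b n where *: "a = s \<and> b = t \<or> a = t \<and> b = s" "n \<le> k" "w = word_class (alt a b n)" "len w = n"
    using parabolic_cases[of s t k w] assms bond_def by auto
  moreover have "alt a b n \<in> lists S" using * assms by (auto simp: bond_def)
  moreover have "alt a b n \<in> lists {s, t}"
    using * by (metis insertCI alt_in_lists_general)
  ultimately show thesis using that[of "alt a b n"] by (auto simp: reduced_def)
qed

section \<open>The length filtration\<close>

text \<open>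
  The terms of lower order: \<open>x - \<tau> w \<in> H_lt (len w)\<close> says that \<open>x\<close> has the leading term
  \<open>\<tau> w\<close>.
\<close>

definition H_lt :: "nat \<Rightarrow> 'r set"
  where "H_lt n = span {\<tau> w | w. w \<in> carrier W \<and> len w < n}"

lemma span_mult_left:
  assumes "x \<in> span B" "\<And>y. y \<in> B \<Longrightarrow> c * y \<in> span C"
  shows "c * x \<in> span C"
  using assms(1)
proof (induction rule: span_induct_alt)
  case base
  then show ?case by (simp add: span_zero)
next
  case (step a y z)
  have "c * (a *s y + z) = a *s (c * y) + c * z" by (simp add: distrib_left scale_mult_right)
  then show ?case using step assms(2) by (simp add: span_add span_scale)
qed

lemma span_mult_right:
  assumes "x \<in> span B" "\<And>y. y \<in> B \<Longrightarrow> y * c \<in> span C"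
  shows "x * c \<in> span C"
  using assms(1)
proof (induction rule: span_induct_alt)
  case base
  then show ?case by (simp add: span_zero)
next
  case (step a y z)
  have "(a *s y + z) * c = a *s (y * c) + z * c" by (simp add: distrib_right scale_mult_left)
  then show ?case using step assms(2) by (simp add: span_add span_scale)
qed

lemma H_lt_mono: "x \<in> H_lt i \<Longrightarrow> i \<le> j \<Longrightarrow> x \<in> H_lt j"
  unfolding H_lt_def by (rule subsetD[OF span_mono]) auto

lemma \<tau>_in_H_lt: "w \<in> carrier W \<Longrightarrow> len w < n \<Longrightarrow> \<tau> w \<in> H_lt n"
  unfolding H_lt_def by (rule span_base) auto

lemma H_lt_Te: "x \<in> H_lt n \<Longrightarrow> Te * x = x" "x \<in> H_lt n \<Longrightarrow> x * Te = x"
proof -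
  have "Te * x = x \<and> x * Te = x" if "x \<in> H_lt n"
    using that unfolding H_lt_def
  proof (induction rule: span_induct_alt)
    case (step a y z)
    then show ?case
      using \<tau>_one_left \<tau>_one_right
      by (auto simp: distrib_left distrib_right scale_mult_right scale_mult_left)
  qed auto
  then show "x \<in> H_lt n \<Longrightarrow> Te * x = x" "x \<in> H_lt n \<Longrightarrow> x * Te = x" by auto
qed

lemma Tg_H_lt:
  assumes "s \<in> S" "x \<in> H_lt n"
  shows "Tg s * x \<in> H_lt (Suc n)"
  using assms(2) unfolding H_lt_def
proof (rule span_mult_left)
  fix y assume "y \<in> {\<tau> w | w. w \<in> carrier W \<and> len w < n}"
  then obtain w where w: "w \<in> carrier W" "len w < n" "y = \<tau> w" by blast
  then obtain xs where xs: "reduced xs" "w = word_class xs" using reduced_exists by metis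
  then have xl: "xs \<in> lists S" using reduced_lists by blast
  have "Tg s * y \<in> H_lt (Suc n)"
    using len_Cons[OF assms(1) xl]
  proof
    assume up: "len (word_class (s # xs)) = len (word_class xs) + 1"
    then have "Tg s * y = \<tau> (word_class (s # xs))" using \<tau>_up[OF assms(1) xl] w xs by simp
    then show ?thesis using up w xs xl assms by (simp add: \<tau>_in_H_lt)
  next
    assume down: "len (word_class xs) = len (word_class (s # xs)) + 1"
    then have "Tg s * y = q *s \<tau> (word_class (s # xs)) + (q - 1) *s \<tau> (word_class xs)"
      using \<tau>_down[OF assms(1) xl] w xs by simp
    moreover have "\<tau> (word_class (s # xs)) \<in> H_lt (Suc n)" "\<tau> (word_class xs) \<in> H_lt (Suc n)"
      using down w xs xl assms by (simp_all add: \<tau>_in_H_lt)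
    ultimately show ?thesis unfolding H_lt_def by (simp add: span_add span_scale)
  qed
  then show "Tg s * y \<in> span {\<tau> w | w. w \<in> carrier W \<and> len w < Suc n}" by (simp add: H_lt_def)
qed

lemma TT_in_H_lt: "xs \<in> lists S \<Longrightarrow> length xs < n \<Longrightarrow> TT xs \<in> H_lt n"
proof (induction xs arbitrary: n)
  case Nil
  then show ?case by (simp add: \<tau>_in_H_lt)
next
  case (Cons s xs)
  then obtain n' where "n = Suc n'" "length xs < n'" by (cases n) auto
  then show ?case using Cons Tg_H_lt by simp
qed

section \<open>Sums over rank two parabolic subgroups\<close>

text \<open>The generators of the Temperley--Lieb ideal.\<close>

definition E :: "'s \<Rightarrow> 's \<Rightarrow> 'r"
  where "E s t = (\<Sum>w\<in>parabolic s t. \<tau> w)"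

lemma E_sym: "E s t = E t s"
  by (simp add: E_def parabolic_sym)

lemma E_in_H_lt: "bond s t k \<Longrightarrow> E s t \<in> H_lt (Suc k)"
  unfolding E_def H_lt_def using parabolic_len bond_parabolic_carrier
  by (intro span_sum span_base) fastforce

lemma E_top:
  assumes "bond s t k"
  shows "E s t - TT (alt s t k) \<in> H_lt k"
proof -
  let ?w = "word_class (alt s t k)"
  have red: "reduced (alt s t k)" using assms reduced_alt[of s t k k] by (simp add: bond_def)
  have "?w \<in> parabolic s t"
    using assms by (auto simp: bond_def parabolic_words intro!: imageI alt_in_lists_general)
  then have "E s t = \<tau> ?w + (\<Sum>w\<in>parabolic s t - {?w}. \<tau> w)"
    unfolding E_def using bond_finite_parabolic[OF assms] by (intro sum.remove) auto
  then have "E s t - TT (alt s t k) = (\<Sum>w\<in>parabolic s t - {?w}. \<tau> w)"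
    using TT_reduced[OF red] by simp
  also have "\<dots> \<in> H_lt k"
    unfolding H_lt_def
  proof (intro span_sum span_base)
    fix w assume "w \<in> parabolic s t - {?w}"
    then have "w \<in> carrier W" "len w < k"
      using parabolic_len[OF assms, of w] bond_parabolic_carrier[OF assms] by auto
    then show "\<tau> w \<in> {\<tau> w | w. w \<in> carrier W \<and> len w < k}" by auto
  qed
  finally show ?thesis .
qed

text \<open>
  The map \<open>\<sigma>\<close> is left or right multiplication by a generator of the parabolic subgroup. It
  pairs the elements, \<open>D\<close> consists of the shorter partners, and the partner \<open>v\<close> of the
  longest element is the only element of maximal length in \<open>D\<close>.
\<close>

lemma parabolic_half_sum:
  assumes bond: "bond s t k"
    and \<sigma>: "\<And>w. w \<in> parabolic s t \<Longrightarrow> \<sigma> w \<in> parabolic s t" "\<And>w. w \<in> parabolic s t \<Longrightarrow> \<sigma> (\<sigma> w) = w"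
    and len: "\<And>w. w \<in> parabolic s t \<Longrightarrow> len (\<sigma> w) = len w + 1 \<or> len w = len (\<sigma> w) + 1"
    and v: "v \<in> parabolic s t" "\<sigma> v = word_class (alt s t k)" "k = Suc (len v)"
  obtains D where "D \<subseteq> parabolic s t" "\<And>w. w \<in> D \<Longrightarrow> len w < len (\<sigma> w)"
    "E s t = (\<Sum>w\<in>D. \<tau> w) + (\<Sum>w\<in>D. \<tau> (\<sigma> w))"
    "(\<Sum>w\<in>D. \<tau> w) \<in> H_lt k" "(\<Sum>w\<in>D. \<tau> w) - \<tau> v \<in> H_lt (len v)"
proof -
  let ?P = "parabolic s t"
  define D where "D = {w \<in> ?P. len w < len (\<sigma> w)}"
  have DP: "D \<subseteq> ?P" by (auto simp: D_def)
  have fin: "finite ?P" and PW: "?P \<subseteq> carrier W"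
    using bond bond_finite_parabolic bond_parabolic_carrier by blast+
  have compl: "?P - D = \<sigma> ` D"
  proof (intro equalityI subsetI)
    fix w assume w: "w \<in> ?P - D"
    then have "\<sigma> w \<in> D" using len[of w] \<sigma> by (auto simp: D_def)
    then show "w \<in> \<sigma> ` D" using w \<sigma>(2) by (metis DiffD1 imageI)
  next
    fix w assume "w \<in> \<sigma> ` D"
    then show "w \<in> ?P - D" using \<sigma> by (auto simp: D_def)
  qed
  have inj: "inj_on \<sigma> D" using DP \<sigma>(2) by (metis inj_onI subsetD)
  have "E s t = (\<Sum>w\<in>D. \<tau> w) + (\<Sum>w\<in>?P - D. \<tau> w)"
    unfolding E_def using fin DP by (simp add: sum.subset_diff add.commute)
  also have "(\<Sum>w\<in>?P - D. \<tau> w) = (\<Sum>w\<in>D. \<tau> (\<sigma> w))"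
    unfolding compl using inj by (simp add: sum.reindex)
  finally have sum: "E s t = (\<Sum>w\<in>D. \<tau> w) + (\<Sum>w\<in>D. \<tau> (\<sigma> w))" .
  have lenD: "len w < k" if "w \<in> D" for w
    using that parabolic_len(1)[OF bond \<sigma>(1)[of w]] by (auto simp: D_def)
  have low: "(\<Sum>w\<in>D. \<tau> w) \<in> H_lt k"
    unfolding H_lt_def using lenD DP PW by (intro span_sum span_base) blast
  have "len (\<sigma> v) = k" using reduced_alt[of s t k k] bond v(2) by (simp add: bond_def reduced_def)
  then have vD: "v \<in> D" using v by (auto simp: D_def)
  then have "(\<Sum>w\<in>D. \<tau> w) - \<tau> v = (\<Sum>w\<in>D - {v}. \<tau> w)"
    using finite_subset[OF DP fin] by (simp add: sum.remove)
  also have "\<dots> \<in> H_lt (len v)" unfolding H_lt_def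
  proof (intro span_sum span_base)
    fix w assume w: "w \<in> D - {v}"
    have "len w < len v"
    proof (rule ccontr)
      assume "\<not> len w < len v"
      then have "len (\<sigma> w) = k"
        using w lenD[of w] len[of w] parabolic_len(1)[OF bond \<sigma>(1)[of w]] v(3) by (auto simp: D_def)
      then have "\<sigma> w = \<sigma> v" using parabolic_len(2)[OF bond \<sigma>(1)[of w]] w v(2) by (auto simp: D_def)
      then have "w = v" using inj_onD[OF inj] w vD by blast
      then show False using w by simp
    qed
    then show "\<tau> w \<in> {\<tau> w | w. w \<in> carrier W \<and> len w < len v}" using w DP PW by auto
  qed
  finally show thesis using that[OF DP _ sum low] by (auto simp: D_def)
qed

lemma gen_square: "c \<in> S \<Longrightarrow> gen c \<otimes>\<^bsub>W\<^esub> gen c = \<one>\<^bsub>W\<^esub>"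
  using word_eq_cancel_square[of c "[]" "[]"] by (simp add: gen_def mult_word_class one_W word_class_eq_iff)

text \<open>
  The factorization \<open>E = F (1 + T\<^sub>c)\<close>, where \<open>F\<close> sums over the minimal representatives of
  the cosets of \<open>{1, c}\<close> and has the leading term \<open>TT a\<close>.
\<close>

lemma E_right:
  assumes bond: "bond s t k" and A: "alt s t k = a @ [c]"
  obtains F where "E s t = F + F * Tg c" "F \<in> H_lt k" "F - TT a \<in> H_lt (length a)"
proof -
  let ?P = "parabolic s t" and ?\<sigma> = "\<lambda>w. w \<otimes>\<^bsub>W\<^esub> gen c"
  interpret W: group W by (rule group_W)
  have st: "s \<in> S" "t \<in> S" using bond by (auto simp: bond_def)
  have "a @ [c] \<in> lists {s, t}" using A alt_in_lists_general[of s "{s, t}" t k] by simp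
  then have a: "a \<in> lists {s, t}" and c: "c = s \<or> c = t" "c \<in> S" using st by auto
  have gc: "gen c \<in> carrier W" "gen c \<in> generate W {gen s, gen t}"
    using c by (auto simp: gen_def intro: generate.incl)
  have PW: "w \<in> carrier W" if "w \<in> ?P" for w using that bond bond_parabolic_carrier by blast
  have 1: "?\<sigma> w \<in> ?P" if "w \<in> ?P" for w
    using that gc(2) unfolding parabolic_def by (simp add: generate.eng)
  have 2: "?\<sigma> (?\<sigma> w) = w" if "w \<in> ?P" for w
    using PW[OF that] gc(1) gen_square[OF c(2)] by (simp add: W.m_assoc)
  have 3: "len (?\<sigma> w) = len w + 1 \<or> len w = len (?\<sigma> w) + 1" if wP: "w \<in> ?P" for w
  proof -
    obtain xs where "xs \<in> lists S" "w = word_class xs" using PW[OF wP] unfolding carrier_W by auto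
    then show ?thesis using len_Cons[of c "rev xs"] len_rev[of "xs @ [c]"] len_rev[of xs] c
      by (simp add: gen_def mult_word_class)
  qed
  have red: "reduced (a @ [c])" using bond reduced_alt[of s t k k] A by (simp add: bond_def)
  then have reda: "reduced a" "a \<in> lists S" using reduced_append(1) reduced_lists by auto
  have "k = Suc (length a)" using arg_cong[OF A, of length] by simp
  then have v: "word_class a \<in> ?P" "?\<sigma> (word_class a) = word_class (alt s t k)" "k = Suc (len (word_class a))"
    using st a reda c A
    by (auto simp: parabolic_words gen_def mult_word_class reduced_def)
  obtain D where D: "D \<subseteq> ?P" "\<And>w. w \<in> D \<Longrightarrow> len w < len (?\<sigma> w)"
    "E s t = (\<Sum>w\<in>D. \<tau> w) + (\<Sum>w\<in>D. \<tau> (?\<sigma> w))"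
    "(\<Sum>w\<in>D. \<tau> w) \<in> H_lt k" "(\<Sum>w\<in>D. \<tau> w) - \<tau> (word_class a) \<in> H_lt (len (word_class a))"
    using parabolic_half_sum[OF bond 1 2 3 v] by blast
  have "\<tau> (?\<sigma> w) = \<tau> w * Tg c" if wD: "w \<in> D" for w
  proof -
    have wW: "w \<in> carrier W" using wD D(1) PW by blast
    obtain xs where xs: "reduced xs" "word_class xs = w" using wW by (rule reduced_exists)
    have xl: "xs \<in> lists S" using xs reduced_lists by blast
    have "len (word_class (xs @ [c])) = Suc (length xs)"
      using 3[OF subsetD[OF D(1) wD]] D(2)[OF wD] xs xl c(2) by (auto simp: gen_def mult_word_class reduced_def)
    then have "reduced (xs @ [c])" using xl c by (simp add: reduced_def)
    then show ?thesis using \<tau>_snoc_up xs xl c by (auto simp: gen_def mult_word_class)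
  qed
  then have "E s t = (\<Sum>w\<in>D. \<tau> w) + (\<Sum>w\<in>D. \<tau> w) * Tg c" using D(3) by (simp add: sum_distrib_right)
  then show thesis using that D(4,5) TT_reduced[OF reda(1)] reda by (simp add: reduced_def)
qed

lemma E_left:
  assumes bond: "bond s t k" and A: "alt s t k = c # f"
  obtains G where "E s t = G + Tg c * G" "G \<in> H_lt k" "G - TT f \<in> H_lt (length f)"
proof -
  let ?P = "parabolic s t" and ?\<sigma> = "\<lambda>w. gen c \<otimes>\<^bsub>W\<^esub> w"
  interpret W: group W by (rule group_W)
  have st: "s \<in> S" "t \<in> S" using bond by (auto simp: bond_def)
  have "c # f \<in> lists {s, t}" using A alt_in_lists_general[of s "{s, t}" t k] by simp
  then have f: "f \<in> lists {s, t}" and c: "c = s \<or> c = t" "c \<in> S" using st by auto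
  have gc: "gen c \<in> carrier W" "gen c \<in> generate W {gen s, gen t}"
    using c by (auto simp: gen_def intro: generate.incl)
  have PW: "w \<in> carrier W" if "w \<in> ?P" for w using that bond bond_parabolic_carrier by blast
  have 1: "?\<sigma> w \<in> ?P" if "w \<in> ?P" for w
    using that gc(2) unfolding parabolic_def by (simp add: generate.eng)
  have 2: "?\<sigma> (?\<sigma> w) = w" if "w \<in> ?P" for w
    using PW[OF that] gc(1) gen_square[OF c(2)] by (simp flip: W.m_assoc)
  have 3: "len (?\<sigma> w) = len w + 1 \<or> len w = len (?\<sigma> w) + 1" if wP: "w \<in> ?P" for w
  proof -
    obtain xs where "xs \<in> lists S" "w = word_class xs" using PW[OF wP] unfolding carrier_W by auto
    then show ?thesis using len_Cons[of c xs] c by (simp add: gen_mult_word_class)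
  qed
  have red: "reduced (c # f)" using bond reduced_alt[of s t k k] A by (simp add: bond_def)
  then have redf: "reduced f" "f \<in> lists S" using reduced_Cons reduced_lists by auto
  have "k = Suc (length f)" using arg_cong[OF A, of length] by simp
  then have v: "word_class f \<in> ?P" "?\<sigma> (word_class f) = word_class (alt s t k)" "k = Suc (len (word_class f))"
    using st f redf c A
    by (auto simp: parabolic_words gen_mult_word_class reduced_def)
  obtain D where D: "D \<subseteq> ?P" "\<And>w. w \<in> D \<Longrightarrow> len w < len (?\<sigma> w)"
    "E s t = (\<Sum>w\<in>D. \<tau> w) + (\<Sum>w\<in>D. \<tau> (?\<sigma> w))"
    "(\<Sum>w\<in>D. \<tau> w) \<in> H_lt k" "(\<Sum>w\<in>D. \<tau> w) - \<tau> (word_class f) \<in> H_lt (len (word_class f))"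
    using parabolic_half_sum[OF bond 1 2 3 v] by blast
  have "\<tau> (?\<sigma> w) = Tg c * \<tau> w" if wD: "w \<in> D" for w
    using \<tau>_up_gen[of c w] c D(1,2) PW wD by (auto simp: gen_def)
  then have "E s t = (\<Sum>w\<in>D. \<tau> w) + Tg c * (\<Sum>w\<in>D. \<tau> w)" using D(3) by (simp add: sum_distrib_left)
  then show thesis using that D(4,5) TT_reduced[OF redf(1)] redf by (simp add: reduced_def)
qed

text \<open>
  This follows from \<open>T\<^sub>c (1 + T\<^sub>c) = q (1 + T\<^sub>c)\<close> and the factorization of \<open>E\<close> with
  \<open>1 + T\<^sub>c\<close> on the left.
\<close>

lemma Tg_E:
  assumes "bond s t k" "c = s \<or> c = t"
  shows "Tg c * E s t = q *s E s t"
proof -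
  have *: "Tg s * E s t = q *s E s t" if b: "bond s t k" for s t
  proof -
    obtain k' where "k = Suc k'" using b by (cases k) (auto simp: bond_def)
    then obtain G where G: "E s t = G + Tg s * G" "G \<in> H_lt k" using E_left[OF b] by auto
    have "Tg s * (Tg s * G) = (Tg s * Tg s) * G" by (simp add: mult.assoc)
    also have "\<dots> = q *s G + (q - 1) *s (Tg s * G)"
      using Tg_square[of s] b H_lt_Te(1)[OF G(2)] by (simp add: bond_def distrib_right scale_mult_left)
    finally show ?thesis unfolding G(1) by (simp add: distrib_left algebra_simps)
  qed
  show ?thesis using assms(2) *[OF assms(1)] *[OF bond_sym[OF assms(1)]] E_sym[of s t] by auto
qed

lemma E_Tg:
  assumes "bond s t k" "c = s \<or> c = t"
  shows "E s t * Tg c = q *s E s t"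
proof -
  obtain k' where k': "k = Suc k'" using assms by (cases k) (auto simp: bond_def)
  \<comment> \<open>Of the two alternating words of length \<open>k\<close>, \<open>alt u v k\<close> is the one that ends in \<open>c\<close>.\<close>
  define u v where "u = (if c = t \<longleftrightarrow> even k then s else t)" and "v = (if c = t \<longleftrightarrow> even k then t else s)"
  have b: "bond u v k" "E u v = E s t" using assms bond_sym E_sym by (auto simp: u_def v_def)
  have "alt u v k = alt u v k' @ [c]"
    using alt_add[of u v k' 1] assms k' by (auto simp: u_def v_def bond_def)
  then obtain F where F: "E u v = F + F * Tg c" "F \<in> H_lt k" using E_right[OF b(1)] by metis
  have "F * Tg c * Tg c = F * (Tg c * Tg c)" by (simp add: mult.assoc)
  also have "\<dots> = q *s F + (q - 1) *s (F * Tg c)"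
    using Tg_square[of c] assms H_lt_Te(2)[OF F(2)] by (auto simp: bond_def distrib_left scale_mult_right)
  finally show ?thesis unfolding b(2)[symmetric] F(1) by (simp add: distrib_right algebra_simps)
qed

lemma TT_E:
  "bond s t k \<Longrightarrow> xs \<in> lists {s, t} \<Longrightarrow> TT xs * E s t = q ^ length xs *s E s t"
  using H_lt_Te(1)[OF E_in_H_lt, of s t k]
  by (induction xs) (auto simp: mult.assoc Tg_E scale_mult_right mult.commute)

lemma E_TT:
  "bond s t k \<Longrightarrow> xs \<in> lists {s, t} \<Longrightarrow> E s t * TT xs = q ^ length xs *s E s t"
  using H_lt_Te(2)[OF E_in_H_lt, of s t k]
  by (induction xs) (auto simp: mult.assoc[symmetric] E_Tg scale_mult_left mult.commute)

section \<open>The filtered ideal and its critical pairs\<close>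

text \<open>
  The leading word of the generator \<open>TT a * E s t * TT b\<close> is \<open>a @ alt s t k @ b\<close>. An
  identity modulo \<open>J_lt n\<close> is one up to generators with a leading word shorter than \<open>n\<close>.
\<close>

definition J_lt_gens :: "nat \<Rightarrow> 'r set"
  where "J_lt_gens n = {TT a * E s t * TT b | a b s t.
    a \<in> lists S \<and> b \<in> lists S \<and> (\<exists>k. bond s t k \<and> length a + k + length b < n)}"

definition J_lt :: "nat \<Rightarrow> 'r set"
  where "J_lt n = span (J_lt_gens n)"

lemma J_lt_gen:
  "a \<in> lists S \<Longrightarrow> b \<in> lists S \<Longrightarrow> bond s t k \<Longrightarrow> length a + k + length b < n \<Longrightarrow>
    TT a * E s t * TT b \<in> J_lt n"
  unfolding J_lt_def J_lt_gens_def by (rule span_base) blast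

lemma J_lt_mono: "x \<in> J_lt i \<Longrightarrow> i \<le> j \<Longrightarrow> x \<in> J_lt j"
  unfolding J_lt_def J_lt_gens_def by (erule subsetD[OF span_mono, rotated]) fastforce

lemma J_lt_zero [simp]: "0 \<in> J_lt n"
  and J_lt_add: "x \<in> J_lt n \<Longrightarrow> y \<in> J_lt n \<Longrightarrow> x + y \<in> J_lt n"
  and J_lt_diff: "x \<in> J_lt n \<Longrightarrow> y \<in> J_lt n \<Longrightarrow> x - y \<in> J_lt n"
  and J_lt_minus: "x \<in> J_lt n \<Longrightarrow> - x \<in> J_lt n"
  and J_lt_scale: "x \<in> J_lt n \<Longrightarrow> c *s x \<in> J_lt n"
  unfolding J_lt_def by (simp_all add: span_zero span_add span_diff span_neg span_scale)

lemma TT_J_lt: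
  assumes "c \<in> lists S" "x \<in> J_lt n"
  shows "TT c * x \<in> J_lt (length c + n)"
  using assms(2) unfolding J_lt_def
proof (rule span_mult_left)
  fix y assume "y \<in> J_lt_gens n"
  then obtain a b s t k where y: "y = TT a * E s t * TT b" "a \<in> lists S" "b \<in> lists S" "bond s t k"
    "length a + k + length b < n" by (auto simp: J_lt_gens_def)
  then have "TT c * y = TT (c @ a) * E s t * TT b" by (simp add: TT_append mult.assoc)
  then have "TT c * y \<in> J_lt (length c + n)" using y assms(1) J_lt_gen[of "c @ a" b s t k] by simp
  then show "TT c * y \<in> span (J_lt_gens (length c + n))"
    by (simp add: J_lt_def)
qed

lemma J_lt_TT:
  assumes "c \<in> lists S" "x \<in> J_lt n"
  shows "x * TT c \<in> J_lt (n + length c)"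
  using assms(2) unfolding J_lt_def
proof (rule span_mult_right)
  fix y assume "y \<in> J_lt_gens n"
  then obtain a b s t k where y: "y = TT a * E s t * TT b" "a \<in> lists S" "b \<in> lists S" "bond s t k"
    "length a + k + length b < n" by (auto simp: J_lt_gens_def)
  then have "y * TT c = TT a * E s t * TT (b @ c)" using assms by (simp add: TT_append mult.assoc)
  then have "y * TT c \<in> J_lt (n + length c)" using y assms(1) J_lt_gen[of a "b @ c" s t k] by simp
  then show "y * TT c \<in> span (J_lt_gens (n + length c))"
    by (simp add: J_lt_def)
qed

lemma \<tau>_word:
  assumes "w \<in> carrier W"
  obtains xs where "xs \<in> lists S" "length xs = len w" "\<tau> w = TT xs"
proof -
  obtain xs where "reduced xs" "word_class xs = w" using assms by (rule reduced_exists)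
  then show thesis using that[of xs] TT_reduced[of xs] by (auto simp: reduced_def)
qed

text \<open>
  The summands of \<open>x\<close> are products along words shorter than \<open>i\<close>, hence the weak inequality.
\<close>

lemma H_lt_mult_gen:
  assumes "x \<in> H_lt i" "a \<in> lists S" "b \<in> lists S" "bond s t k" "i + length a + k + length b \<le> n"
  shows "x * (TT a * E s t * TT b) \<in> J_lt n"
  using assms(1) unfolding H_lt_def J_lt_def
proof (rule span_mult_right)
  fix y assume "y \<in> {\<tau> w | w. w \<in> carrier W \<and> len w < i}"
  then obtain w where "w \<in> carrier W" "len w < i" "y = \<tau> w" by blast
  then obtain xs where xs: "xs \<in> lists S" "length xs < i" "y = TT xs" by (metis \<tau>_word)
  then have "y * (TT a * E s t * TT b) = TT (xs @ a) * E s t * TT b"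
    using assms by (simp add: TT_append mult.assoc)
  then have "y * (TT a * E s t * TT b) \<in> J_lt n" using J_lt_gen[of "xs @ a" b s t k n] assms xs by simp
  then show "y * (TT a * E s t * TT b) \<in> span (J_lt_gens n)"
    by (simp add: J_lt_def)
qed

lemma gen_mult_H_lt:
  assumes "x \<in> H_lt i" "a \<in> lists S" "b \<in> lists S" "bond s t k" "length a + k + length b + i \<le> n"
  shows "(TT a * E s t * TT b) * x \<in> J_lt n"
  using assms(1) unfolding H_lt_def J_lt_def
proof (rule span_mult_left)
  fix y assume "y \<in> {\<tau> w | w. w \<in> carrier W \<and> len w < i}"
  then obtain w where "w \<in> carrier W" "len w < i" "y = \<tau> w" by blast
  then obtain xs where xs: "xs \<in> lists S" "length xs < i" "y = TT xs" by (metis \<tau>_word)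
  then have "(TT a * E s t * TT b) * y = TT a * E s t * TT (b @ xs)"
    using assms by (simp add: TT_append mult.assoc)
  then have "(TT a * E s t * TT b) * y \<in> J_lt n" using J_lt_gen[of a "b @ xs" s t k n] assms xs by simp
  then show "(TT a * E s t * TT b) * y \<in> span (J_lt_gens n)"
    by (simp add: J_lt_def)
qed

lemma E_Te: "bond s t k \<Longrightarrow> E s t * Te = E s t" and Te_E: "bond s t k \<Longrightarrow> Te * E s t = E s t"
  using H_lt_Te[OF E_in_H_lt] by auto

lemma commuting_Tg:
  assumes "commuting s t"
  shows "Tg s * Tg t = Tg t * Tg s"
proof -
  have st: "s \<in> S" "t \<in> S" "s \<noteq> t" "m s t = enat 2" using assms by (auto simp: commuting_def numeral_eq_enat)
  have "reduced (alt s t 2)" "reduced (alt t s 2)"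
    using reduced_alt[of s t 2 2] reduced_alt[of t s 2 2] st m_sym by auto
  moreover have "word_class (alt s t 2) = word_class (alt t s 2)"
    using word_eq_alt[of s t 2] st by (simp add: word_class_eq_iff)
  ultimately have "TT (alt s t 2) = TT (alt t s 2)" using TT_reduced by metis
  then show ?thesis using st by (simp add: numeral_2_eq_2)
qed

lemma commuting_Tg_TT:
  assumes "s \<in> S" "ys \<in> lists S" "\<And>y. y \<in> set ys \<Longrightarrow> commuting s y"
  shows "Tg s * TT ys = TT ys * Tg s"
  using assms(2,3)
proof (induction ys)
  case (Cons y ys)
  have "Tg s * TT (y # ys) = Tg y * (Tg s * TT ys)"
    using commuting_Tg[of s y] Cons.prems by (simp flip: mult.assoc)
  also have "Tg s * TT ys = TT ys * Tg s" using Cons by simp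
  finally show ?case by (simp add: mult.assoc)
qed (use assms(1) in simp)

lemma commuting_TT:
  assumes "xs \<in> lists S" "ys \<in> lists S" "commuting_words xs ys"
  shows "TT xs * TT ys = TT ys * TT xs"
  using assms(1,3)
proof (induction xs)
  case (Cons x xs)
  then have "Tg x * TT ys = TT ys * Tg x"
    using assms(2) by (intro commuting_Tg_TT) (auto simp: commuting_words_def)
  moreover have IH: "TT xs * TT ys = TT ys * TT xs" using Cons by (auto simp: commuting_words_def)
  ultimately have "Tg x * (TT xs * TT ys) = TT ys * Tg x * TT xs"
    unfolding IH by (simp flip: mult.assoc)
  then show ?case by (simp add: mult.assoc)
qed (use assms(2) in simp)

lemma commuting_TT_E:
  assumes "xs \<in> lists S" "bond s t k" "commuting_words xs [s, t]"
  shows "TT xs * E s t = E s t * TT xs"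
  unfolding E_def sum_distrib_left sum_distrib_right
proof (rule sum.cong)
  fix w assume w: "w \<in> parabolic s t"
  obtain ys where ys: "ys \<in> lists {s, t}" "reduced ys" "w = word_class ys"
    by (rule bond_parabolic_word[OF assms(2) w])
  have "commuting_words xs ys"
    using ys(1) assms(3) by (auto simp: commuting_words_def in_lists_conv_set)
  then show "TT xs * \<tau> w = \<tau> w * TT xs"
    using commuting_TT[of xs ys] TT_reduced[OF ys(2)] reduced_lists[OF ys(2)] ys(3) assms(1) by simp
qed simp

lemma comm_eq_TT:
  assumes "comm_eq xs ys" "xs \<in> lists S"
  shows "TT xs = TT ys"
  using assms
proof (induction rule: rtranclp_induct)
  case (step ys zs)
  have yl: "ys \<in> lists S" using comm_eq_lists[OF step.hyps(1)] step.prems by simp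
  obtain s t us vs where st: "commuting s t" "ys = us @ [s, t] @ vs" "zs = us @ [t, s] @ vs"
    using step.hyps(2) by (auto elim: comm_step.cases)
  then have "s \<in> S" "t \<in> S" "vs \<in> lists S" using yl by auto
  then have "TT ys = TT us * (Tg s * Tg t) * TT vs" "TT zs = TT us * (Tg t * Tg s) * TT vs"
    using st by (simp_all add: TT_append mult.assoc)
  then show ?case using commuting_Tg[OF st(1)] step by simp
qed simp

text \<open>
  Both elements have the leading word \<open>A b B\<close>, where \<open>A\<close> and \<open>B\<close> are the two alternating
  words. They arise from \<open>E\<^sub>A b E\<^sub>B\<close> by replacing one of the two sums by its leading term,
  which costs products of the other sum with terms of lower order.
\<close>

lemma disjoint_pair:
  assumes A: "bond s t k" and B: "bond u v l" and b: "b \<in> lists S"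
  shows "E s t * TT b * TT (alt u v l) - TT (alt s t k) * TT b * E u v \<in> J_lt (k + length b + l)"
proof -
  have "(E s t - TT (alt s t k)) * (TT b * E u v * TT []) \<in> J_lt (k + length b + l)"
    using H_lt_mult_gen[OF E_top[OF A] b _ B, of "[]"] by simp
  moreover have "(TT [] * E s t * TT b) * (E u v - TT (alt u v l)) \<in> J_lt (k + length b + l)"
    using gen_mult_H_lt[OF E_top[OF B] _ b A, of "[]"] by simp
  ultimately have "(E s t - TT (alt s t k)) * (TT b * E u v * TT []) -
      (TT [] * E s t * TT b) * (E u v - TT (alt u v l)) \<in> J_lt (k + length b + l)"
    by (rule J_lt_diff)
  moreover have "(E s t - TT (alt s t k)) * (TT b * E u v * TT []) -
      (TT [] * E s t * TT b) * (E u v - TT (alt u v l)) =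
      E s t * TT b * TT (alt u v l) - TT (alt s t k) * TT b * E u v"
    by (simp add: mult.assoc E_Te[OF B]) (simp add: Te_E[OF A] algebra_simps flip: mult.assoc)
  ultimately show ?thesis by simp
qed

text \<open>
  Both elements have the leading word \<open>a b c f\<close>: the alternating words share the letter \<open>c\<close>,
  the last one of \<open>A = a c\<close> and the first one of \<open>B = c f\<close>, and \<open>b\<close> commutes with it. From
  \<open>E\<^sub>A = F (1 + T\<^sub>c)\<close> and \<open>E\<^sub>B = (1 + T\<^sub>c) G\<close> one gets \<open>E\<^sub>A b G = F b E\<^sub>B\<close>, in which \<open>G\<close> and
  \<open>F\<close> are then replaced by their leading terms \<open>TT f\<close> and \<open>TT a\<close>.
\<close>

lemma end_pair:
  assumes A: "bond s t k" "alt s t k = a @ [c]" and B: "bond u v l" "alt u v l = c # f"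
    and b: "b \<in> lists S" "commuting_words b [c]"
  shows "E s t * TT b * TT f - TT a * TT b * E u v \<in> J_lt (k + length b + length f)"
proof -
  obtain F where F: "E s t = F + F * Tg c" "F - TT a \<in> H_lt (length a)" using E_right[OF A] by metis
  obtain G where G: "E u v = G + Tg c * G" "G - TT f \<in> H_lt (length f)" using E_left[OF B] by metis
  have ka: "k = Suc (length a)" "l = Suc (length f)"
    using arg_cong[OF A(2), of length] arg_cong[OF B(2), of length] by simp_all
  have "set (c # f) \<subseteq> S"
    using B alt_in_lists[of u v l] by (auto simp: bond_def in_lists_conv_set)
  then have c: "c \<in> S" by simp
  have bc: "Tg c * TT b = TT b * Tg c"
    using commuting_TT[of b "[c]"] b c by simp
  have "(TT [] * E s t * TT b) * (G - TT f) \<in> J_lt (k + length b + length f)"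
    using gen_mult_H_lt[OF G(2) _ b(1) A(1), of "[]"] by simp
  then have 1: "E s t * TT b * (G - TT f) \<in> J_lt (k + length b + length f)" using Te_E[OF A(1)] by simp
  have "(F - TT a) * (TT b * E u v * TT []) \<in> J_lt (k + length b + length f)"
    using H_lt_mult_gen[OF F(2) b(1) _ B(1), of "[]"] ka by simp
  then have 2: "(F - TT a) * (TT b * E u v) \<in> J_lt (k + length b + length f)"
    using E_Te[OF B(1)] by (simp add: mult.assoc)
  have "E s t * TT b * G = F * TT b * G + F * (Tg c * TT b) * G"
    unfolding F(1) by (simp add: distrib_left distrib_right mult.assoc)
  also have "\<dots> = F * TT b * E u v"
    unfolding G(1) bc by (simp add: distrib_left distrib_right mult.assoc)
  finally have 3: "E s t * TT b * G = F * TT b * E u v" .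
  have "E s t * TT b * TT f - TT a * TT b * E u v =
      (F - TT a) * (TT b * E u v) - E s t * TT b * (G - TT f)"
    using 3 by (simp add: algebra_simps)
  then show ?thesis using J_lt_diff[OF 2 1] by simp
qed

text \<open>
  The computation in \<open>cross_pair\<close> needs the generator for strength three in explicit form.
\<close>

lemma E_three:
  assumes bond: "bond s t 3"
  shows "E s t = Te + Tg s + Tg t + Tg s * Tg t + Tg t * Tg s + Tg t * Tg s * Tg t"
proof -
  have st: "s \<in> S" "t \<in> S" "s \<noteq> t" "m s t = enat 3" "m t s = enat 3"
    using bond bond_sym[OF bond] by (auto simp: bond_def)
  let ?c = "\<lambda>a b n. word_class (alt a b n)"
  define L where "L = [?c s t 0, ?c s t 1, ?c t s 1, ?c s t 2, ?c t s 2, ?c t s 3]"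
  have red: "reduced (alt s t n)" "reduced (alt t s n)" if "n \<le> 3" for n
    using reduced_alt[of s t 3 n] reduced_alt[of t s 3 n] st that by auto
  have len: "len (?c s t n) = n" "len (?c t s n) = n" if "n \<le> 3" for n
    using red[OF that] by (auto simp: reduced_def)
  have ne: "?c s t n \<noteq> ?c t s n" if "0 < n" "n < 3" for n
  proof
    assume "?c s t n = ?c t s n"
    then have "word_eq (alt s t n) (alt t s n)" using st by (simp add: word_class_eq_iff)
    then show False using bond_le_alt[of s t n] st that by auto
  qed
  have "?c s t 3 = ?c t s 3" using word_eq_alt[of s t 3] st by (simp add: word_class_eq_iff)
  then have c3: "?c a b n \<in> set L" if "a = s \<and> b = t \<or> a = t \<and> b = s" "n \<le> 3" for a b n
  proof -
    have "n = 0 \<or> n = 1 \<or> n = 2 \<or> n = 3" using that(2) by linarith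
    then show ?thesis using that(1) \<open>?c s t 3 = ?c t s 3\<close> by (elim disjE conjE) (simp_all add: L_def)
  qed
  have "parabolic s t = set L"
  proof
    show "parabolic s t \<subseteq> set L"
    proof
      fix w assume w: "w \<in> parabolic s t"
      obtain a b n where "a = s \<and> b = t \<or> a = t \<and> b = s" "n \<le> 3" "w = ?c a b n"
        by (rule parabolic_cases[OF st(1-4) w])
      then show "w \<in> set L" using c3 by simp
    qed
    have "alt a b n \<in> lists {s, t}" if "a = s \<and> b = t \<or> a = t \<and> b = s" for a b n
      using that by (auto intro!: alt_in_lists_general)
    then show "set L \<subseteq> parabolic s t"
      unfolding L_def parabolic_words[OF st(1,2)] by simp
  qed
  moreover have "distinct L"
  proof -
    have *: "distinct [a, b, b', c, c', d]"
      if "len a = 0" "len b = 1" "len b' = 1" "len c = 2" "len c' = 2" "len d = 3" "b \<noteq> b'" "c \<noteq> c'"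
      for a b b' c c' d
      using that by auto
    show ?thesis unfolding L_def by (rule *) (use len ne in \<open>auto simp del: alt.simps\<close>)
  qed
  ultimately have "E s t = sum_list (map \<tau> L)"
    unfolding E_def by (simp add: sum.distinct_set_conv_list)
  also have "map \<tau> L = [TT (alt s t 0), TT (alt s t 1), TT (alt t s 1), TT (alt s t 2), TT (alt t s 2), TT (alt t s 3)]"
    unfolding L_def using TT_reduced[OF red(1)] TT_reduced[OF red(2)] st by simp
  also have "sum_list \<dots> = Te + Tg s + Tg t + Tg s * Tg t + Tg t * Tg s + Tg t * Tg s * Tg t"
    using st by (simp add: numeral_2_eq_2 numeral_3_eq_3 add.assoc mult.assoc)
  finally show ?thesis .
qed

text \<open>
  What remains of the difference in \<open>cross_pair\<close> after the multiples of the two sums are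
  split off; it vanishes by the quadratic relations for \<open>r\<close> and \<open>t\<close> and by \<open>t r = r t\<close>.
\<close>

lemma cross_identity:
  fixes e r s t :: 'r and c :: laurent
  assumes rt: "t * r = r * t" and r2: "r * r = c *s e + (c - 1) *s r" and t2: "t * t = c *s e + (c - 1) *s t"
    and e: "e * r = r" "e * t = t" "r * e = r" "t * e = t"
  shows "r * r + t * (r * r) - t * t - r * (t * t)
    - (e + s + r + s * r + r * s) - (e + s + r + s * r + r * s) * t - t * (e + s + r + s * r + r * s)
    + (e + s + t + s * t + t * s) + (e + s + t + s * t + t * s) * r + r * (e + s + t + s * t + t * s) = 0"
proof -
  have rt': "t * (r * z) = r * (t * z)" for z using rt by (metis mult.assoc)
  show ?thesis
    unfolding r2 t2 by (simp add: algebra_simps rt rt' e scale_mult_left scale_mult_right)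
qed

text \<open>
  The words \<open>tst\<close> and \<open>rsr\<close> share their middle letter: as \<open>r\<close> and \<open>t\<close> commute, \<open>r tst r\<close> and
  \<open>t rsr t\<close> are the same up to commutations. Expanding both sides shows that the difference
  is a sum of the generators \<open>E s t\<close> and \<open>E s r\<close>, multiplied by at most one further letter.
\<close>

lemma cross_pair:
  assumes A: "bond s t 3" and B: "bond s r 3" and rt: "commuting r t"
  shows "Tg r * E s t * Tg r - Tg t * E s r * Tg t \<in> J_lt 5"
proof -
  have S: "s \<in> S" "t \<in> S" "r \<in> S" using A B by (auto simp: bond_def)
  define e r' s' t' where d: "e = Te" "r' = Tg r" "s' = Tg s" "t' = Tg t"
  have c: "t' * r' = r' * t'" unfolding d using commuting_Tg[OF rt] by simp
  have c': "t' * (r' * z) = r' * (t' * z)" for z using c by (metis mult.assoc)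
  have u: "e * r' = r'" "e * t' = t'" "r' * e = r'" "t' * e = t'" using S by (simp_all add: d)
  define L where "L x = e + s' + x + s' * x + x * s'" for x
  have Et: "E s t = L t' + t' * s' * t'" and Er: "E s r = L r' + r' * s' * r'"
    using E_three[OF A] E_three[OF B] by (simp_all add: L_def d)
  have sq: "r' * r' = q *s e + (q - 1) *s r'" "t' * t' = q *s e + (q - 1) *s t'"
    unfolding d using Tg_square S by auto
  have "r' * E s t * r' - t' * E s r * t' =
     (E s r + E s r * t' + t' * E s r - E s t - E s t * r' - r' * E s t) +
     (r' * r' + t' * (r' * r') - t' * t' - r' * (t' * t')
      - L r' - L r' * t' - t' * L r' + L t' + L t' * r' + r' * L t')"
    unfolding Et Er by (simp add: algebra_simps c c' L_def u)
  also have "r' * r' + t' * (r' * r') - t' * t' - r' * (t' * t')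
      - L r' - L r' * t' - t' * L r' + L t' + L t' * r' + r' * L t' = 0"
    unfolding L_def by (rule cross_identity) (use c sq u in auto)
  finally have eq: "Tg r * E s t * Tg r - Tg t * E s r * Tg t =
     E s r + E s r * Tg t + Tg t * E s r - E s t - E s t * Tg r - Tg r * E s t"
    by (simp add: d)
  have g: "E s u \<in> J_lt 5" "E s u * Tg v \<in> J_lt 5" "Tg v * E s u \<in> J_lt 5" if "bond s u 3" "v \<in> S" for u v
    using J_lt_gen[of "[]" "[]" s u 3 5] J_lt_gen[of "[]" "[v]" s u 3 5] J_lt_gen[of "[v]" "[]" s u 3 5]
      that E_Te[OF that(1)] Te_E[OF that(1)]
    by (simp_all add: mult.assoc)
  show ?thesis unfolding eq
    using g[OF A] g[OF B] S by (intro J_lt_diff J_lt_add) auto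
qed

lemma mult_left_commute: "x * y = y * x \<Longrightarrow> x * (y * z) = y * (x * z)" for x y z :: 'r
  by (metis mult.assoc)

lemma set_alt: "2 \<le> k \<Longrightarrow> set (alt s t k) = {s, t}"
proof -
  assume "2 \<le> k"
  then obtain n where "k = Suc (Suc n)" by (metis add_2_eq_Suc le_Suc_ex)
  moreover have "set (alt s t n) \<subseteq> {s, t}"
    using alt_in_lists_general[of s "{s, t}" t n] by (auto simp: in_lists_conv_set)
  ultimately show ?thesis by auto
qed

lemma alt_factor:
  assumes "alt s t k = xs @ ys @ zs" "2 \<le> length ys"
  shows "set ys = {s, t}"
proof -
  have "length xs + length ys + length zs = k" using arg_cong[OF assms(1), of length] by simp
  then have k: "k = length xs + (length ys + length zs)" by simp
  define u v where "u = (if even (length xs) then s else t)" and "v = (if even (length xs) then t else s)"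
  have "alt s t k = alt s t (length xs) @ alt u v (length ys + length zs)"
    unfolding k alt_add u_def v_def by simp
  then have "xs @ ys @ zs = alt s t (length xs) @ alt u v (length ys) @ (if even (length ys) then alt u v (length zs) else alt v u (length zs))"
    unfolding assms(1) alt_add by simp
  then have "ys = alt u v (length ys)" by simp
  then have "set ys = {u, v}" using set_alt[OF assms(2)] by metis
  then show ?thesis by (auto simp: u_def v_def)
qed

lemma alt_around:
  assumes "bond s t k" "alt s t k = xs @ [x] @ ys"
  obtains y where "{x, y} = {s, t}" "bond x y k" "xs = [] \<or> xs = [y] \<or> set xs = {x, y}"
    "ys = [] \<or> ys = [y] \<or> set ys = {x, y}"
proof -
  have "set (alt s t k) = {s, t}" using assms(1) by (intro set_alt) (simp add: bond_def)
  then have "x \<in> {s, t}" using assms(2) by auto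
  then obtain y where y: "{x, y} = {s, t}" "bond x y k" using assms(1) bond_sym by blast
  have "xs = [] \<or> xs = [y] \<or> set xs = {x, y}"
  proof (cases "2 \<le> length xs")
    case True
    then show ?thesis using alt_factor[of s t k "[]" xs "[x] @ ys"] assms(2) y(1) by simp
  next
    case False
    then have "xs = [] \<or> (\<exists>z. xs = [z])" by (cases xs) (auto simp: Suc_le_eq)
    then show ?thesis using alt_consecutive[of s t k "[]" _ x ys] assms y by (auto simp: bond_def doubleton_eq_iff)
  qed
  moreover have "ys = [] \<or> ys = [y] \<or> set ys = {x, y}"
  proof (cases "2 \<le> length ys")
    case True
    then show ?thesis using alt_factor[of s t k "xs @ [x]" ys "[]"] assms(2) y(1) by simp
  next
    case False
    then have "ys = [] \<or> (\<exists>z. ys = [z])" by (cases ys) (auto simp: Suc_le_eq)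
    then show ?thesis using alt_consecutive[of s t k xs x _ "[]"] assms y by (auto simp: bond_def doubleton_eq_iff)
  qed
  ultimately show thesis using that y by blast
qed

lemma bond_alt_lists: "bond s t k \<Longrightarrow> alt s t k \<in> lists S"
  by (simp add: bond_def)

text \<open>
  The words of two occurrences \<open>x1 A x2\<close> and \<open>y1 B y2\<close> in one class modulo commutation form
  a matrix of factors (see \<open>comm_eq_two_factors\<close>): reading rows, \<open>x1 = p c1 d1\<close>,
  \<open>A = a1 e1 e2\<close>, \<open>x2 = b1 f1 f2\<close>; reading columns, \<open>y1 = p a1 b1\<close>, \<open>B = c1 e1 f1\<close>,
  \<open>y2 = d1 e2 f2\<close>. Two factors commute if one of them lies strictly above and strictly to
  the right of the other. The outer factors \<open>p\<close> and \<open>f2\<close> are left out here.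

  The cases are distinguished by the common part \<open>e1\<close> of \<open>A\<close> and \<open>B\<close>. If it is empty, then
  \<open>a1\<close> or \<open>e2\<close> contains both letters of \<open>A\<close>, because \<open>A\<close> has at least three letters; what
  commutes with this factor commutes with \<open>E s t\<close>, and \<open>A\<close> and \<open>B\<close> can be separated. If \<open>e1\<close>
  has two letters or more, then \<open>A\<close> and \<open>B\<close> have the same letters and both elements are the
  same multiple of \<open>E s t * TT b1 * TT d1\<close>. If \<open>e1\<close> is a single letter \<open>x\<close>, it is the end of
  one word and the beginning of the other, or the middle letter of two words of length
  three.
\<close>

lemma overlapping_occurrences:
  assumes A: "bond s t k" "alt s t k = a1 @ e1 @ e2"
    and B: "bond u v l" "alt u v l = c1 @ e1 @ f1"
    and l: "b1 \<in> lists S" "d1 \<in> lists S"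
    and c1: "commuting_words c1 a1" "commuting_words c1 b1"
    and d1: "commuting_words d1 a1" "commuting_words d1 b1" "commuting_words d1 e1" "commuting_words d1 f1"
    and b1: "commuting_words b1 e1" "commuting_words b1 e2"
    and ef: "commuting_words e2 f1"
  shows "TT c1 * TT d1 * E s t * TT b1 * TT f1 - TT a1 * TT b1 * E u v * TT d1 * TT e2
    \<in> J_lt (length c1 + length d1 + k + length b1 + length f1)" (is "?D \<in> J_lt ?N")
proof -
  have lA: "a1 \<in> lists S" "e1 \<in> lists S" "e2 \<in> lists S"
    using bond_alt_lists[OF A(1)] unfolding A(2) by simp_all
  have lB: "c1 \<in> lists S" "f1 \<in> lists S"
    using bond_alt_lists[OF B(1)] unfolding B(2) by simp_all
  have k3: "3 \<le> k" "3 \<le> l" using A(1) B(1) by (auto simp: bond_def)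
  have lenA: "k = length a1 + length e1 + length e2" using arg_cong[OF A(2), of length] by simp
  have lenB: "l = length c1 + length e1 + length f1" using arg_cong[OF B(2), of length] by simp
  have setA: "{s, t} = set a1 \<union> set e1 \<union> set e2" using set_alt[of k s t] k3 A(2) by auto
  have setB: "{u, v} = set c1 \<union> set e1 \<union> set f1" using set_alt[of l u v] k3 B(2) by auto
  have irr: "\<not> commuting x x" for x by (simp add: commuting_def)
  have sym: "commuting_words ys xs" if "commuting_words xs ys" for xs ys
    using that by (auto simp: commuting_words_def intro: commuting_sym)
  have mono: "commuting_words xs' ys'"
    if "commuting_words xs ys" "set xs' \<subseteq> set xs" "set ys' \<subseteq> set ys" for xs ys xs' ys'
    using that by (auto simp: commuting_words_def)
  have nil: "commuting_words [] xs" "commuting_words xs []" for xs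
    by (simp_all add: commuting_words_def)
  note cw0 = c1 d1 b1 ef
  note cw = cw0 cw0[THEN sym] nil
  have cE: "TT xs * E s t = E s t * TT xs"
    if "xs \<in> lists S" "commuting_words xs a1" "commuting_words xs e1" "commuting_words xs e2" for xs
  proof -
    have "commuting_words xs [s, t]" using setA that(2-4) by (auto simp: commuting_words_def)
    then show ?thesis using commuting_TT_E that(1) A(1) by blast
  qed
  have cE': "TT xs * E u v = E u v * TT xs"
    if "xs \<in> lists S" "commuting_words xs c1" "commuting_words xs e1" "commuting_words xs f1" for xs
  proof -
    have "commuting_words xs [u, v]" using setB that(2-4) by (auto simp: commuting_words_def)
    then show ?thesis using commuting_TT_E that(1) B(1) by blast
  qed
  have db: "TT d1 * TT b1 = TT b1 * TT d1" and df: "TT d1 * TT f1 = TT f1 * TT d1"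
    and cb: "TT c1 * TT b1 = TT b1 * TT c1"
    using cw l lB by (auto intro: commuting_TT)
  consider (disjoint_left) "e1 = []" "set a1 = {s, t}" | (disjoint_right) "e1 = []" "set e2 = {s, t}"
    | (long) "2 \<le> length e1" | (short) x where "e1 = [x]"
  proof (cases e1)
    case Nil
    then have "2 \<le> length a1 \<or> 2 \<le> length e2" using lenA k3 by auto
    then show thesis
      using alt_factor[of s t k "[]" a1 e2] alt_factor[of s t k a1 e2 "[]"] Nil A(2) that by auto
  next
    case (Cons x xs)
    then show thesis using that by (cases xs) auto
  qed
  then show ?thesis
  proof cases
    case disjoint_left
    have TB: "TT (alt u v l) = TT c1 * TT f1" using B disjoint_left lB by (simp add: TT_append)
    have TA: "TT (alt s t k) = TT a1 * TT e2" using A disjoint_left lA by (simp add: TT_append)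
    have e2a: "set e2 \<subseteq> set a1" using setA disjoint_left by auto
    have ce: "commuting_words c1 e2" and de: "commuting_words d1 e2"
      using mono[OF c1(1)] mono[OF d1(1)] e2a by auto
    have cEc: "TT c1 * E s t = E s t * TT c1" and cEd: "TT d1 * E s t = E s t * TT d1"
      using lB l disjoint_left by (auto intro!: cE simp: cw ce de)
    have e2b: "TT b1 * TT e2 = TT e2 * TT b1" and e2d: "TT d1 * TT e2 = TT e2 * TT d1"
      and e2E: "TT e2 * E u v = E u v * TT e2"
      using l lA disjoint_left by (auto intro!: commuting_TT cE' simp: cw sym[OF ce] de)
    have "TT c1 * TT d1 * E s t * TT b1 * TT f1 = E s t * (TT c1 * (TT d1 * TT b1) * TT f1)"
      by (simp add: mult.assoc cEd cEc mult_left_commute[OF cEd] mult_left_commute[OF cEc])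
    also have "\<dots> = E s t * (TT c1 * TT b1) * (TT d1 * TT f1)" unfolding db by (simp add: mult.assoc)
    also have "\<dots> = E s t * TT b1 * TT (alt u v l) * TT d1" unfolding cb df TB by (simp add: mult.assoc)
    finally have 1: "TT c1 * TT d1 * E s t * TT b1 * TT f1 = E s t * TT b1 * TT (alt u v l) * TT d1" .
    have "TT a1 * TT b1 * E u v * TT d1 * TT e2 = TT a1 * TT b1 * (E u v * (TT d1 * TT e2))"
      by (simp add: mult.assoc)
    also have "\<dots> = TT a1 * TT b1 * (E u v * TT e2) * TT d1" unfolding e2d by (simp add: mult.assoc)
    also have "\<dots> = TT a1 * (TT b1 * TT e2) * E u v * TT d1" unfolding e2E[symmetric] by (simp add: mult.assoc)
    also have "\<dots> = TT (alt s t k) * TT b1 * E u v * TT d1" unfolding e2b TA by (simp add: mult.assoc)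
    finally have 2: "TT a1 * TT b1 * E u v * TT d1 * TT e2 = TT (alt s t k) * TT b1 * E u v * TT d1" .
    have "?D = (E s t * TT b1 * TT (alt u v l) - TT (alt s t k) * TT b1 * E u v) * TT d1"
      unfolding 1 2 by (simp add: left_diff_distrib)
    also have "\<dots> \<in> J_lt (k + length b1 + l + length d1)"
      using J_lt_TT[OF l(2) disjoint_pair[OF A(1) B(1) l(1)]] .
    finally show ?thesis by (rule J_lt_mono) (simp add: lenB disjoint_left)
  next
    case disjoint_right
    have TB: "TT (alt u v l) = TT c1 * TT f1" using B disjoint_right lB by (simp add: TT_append)
    have TA: "TT (alt s t k) = TT a1 * TT e2" using A disjoint_right lA by (simp add: TT_append)
    have a1e: "set a1 \<subseteq> set e2" using setA disjoint_right by auto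
    have fa: "commuting_words f1 a1" and ba: "commuting_words b1 a1"
      using mono[OF sym[OF ef]] mono[OF b1(2)] a1e by auto
    have fE: "TT f1 * E s t = E s t * TT f1" and bE: "TT b1 * E s t = E s t * TT b1"
      using lB l disjoint_right by (auto intro!: cE simp: cw fa ba)
    have ab: "TT a1 * TT b1 = TT b1 * TT a1" and ad: "TT a1 * TT d1 = TT d1 * TT a1"
      and aE: "TT a1 * E u v = E u v * TT a1"
      using l lA disjoint_right by (auto intro!: commuting_TT cE' simp: cw sym[OF fa] sym[OF ba])
    have "TT c1 * TT d1 * E s t * TT b1 * TT f1 = TT c1 * (TT d1 * TT b1) * TT f1 * E s t"
      by (simp add: mult.assoc fE bE mult_left_commute[OF fE] mult_left_commute[OF bE])
    also have "\<dots> = (TT c1 * TT b1) * (TT d1 * TT f1) * E s t" unfolding db by (simp add: mult.assoc)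
    also have "\<dots> = TT b1 * TT (alt u v l) * TT d1 * E s t" unfolding cb df TB by (simp add: mult.assoc)
    finally have 1: "TT c1 * TT d1 * E s t * TT b1 * TT f1 = TT b1 * TT (alt u v l) * TT d1 * E s t" .
    have "TT a1 * TT b1 * E u v * TT d1 * TT e2 = TT b1 * (TT a1 * E u v) * TT d1 * TT e2"
      unfolding ab by (simp add: mult.assoc)
    also have "\<dots> = TT b1 * E u v * (TT a1 * TT d1) * TT e2" unfolding aE by (simp add: mult.assoc)
    also have "\<dots> = TT b1 * E u v * TT d1 * TT (alt s t k)" unfolding ad TA by (simp add: mult.assoc)
    finally have 2: "TT a1 * TT b1 * E u v * TT d1 * TT e2 = TT b1 * E u v * TT d1 * TT (alt s t k)" .
    have "?D = - (TT b1 * (E u v * TT d1 * TT (alt s t k) - TT (alt u v l) * TT d1 * E s t))"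
      unfolding 1 2 by (simp add: right_diff_distrib mult.assoc)
    also have "\<dots> \<in> J_lt (length b1 + (l + length d1 + k))"
      using J_lt_minus[OF TT_J_lt[OF l(1) disjoint_pair[OF B(1) A(1) l(2)]]] .
    finally show ?thesis by (rule J_lt_mono) (simp add: lenB disjoint_right)
  next
    case long
    then have st: "set e1 = {s, t}" and uv: "set e1 = {u, v}"
      using alt_factor[OF A(2)] alt_factor[OF B(2)] by auto
    then have "u = s \<and> v = t \<or> u = t \<and> v = s" by (metis doubleton_eq_iff)
    then have EE: "E u v = E s t" and kl: "k = l"
      using E_sym A(1) B(1) bond_sym bond_unique by metis+
    have sub: "a1 \<in> lists {s, t}" "e2 \<in> lists {s, t}" "c1 \<in> lists {s, t}" "f1 \<in> lists {s, t}"
      using setA setB st uv by (auto simp: in_lists_conv_set)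
    have sube: "set a1 \<subseteq> set e1" "set e2 \<subseteq> set e1" "set c1 \<subseteq> set e1" "set f1 \<subseteq> set e1"
      using setA setB st uv by auto
    have bx: "commuting_words b1 xs" and dx: "commuting_words d1 xs" if "set xs \<subseteq> set e1" for xs
      using mono[OF b1(1)] mono[OF d1(3)] that by auto
    have bE: "TT b1 * E s t = E s t * TT b1" and dE: "TT d1 * E s t = E s t * TT d1"
      using l by (auto intro!: cE simp: bx dx sube)
    have dc: "TT c1 * TT d1 = TT d1 * TT c1" and be: "TT b1 * TT f1 = TT f1 * TT b1"
      and ab: "TT a1 * TT b1 = TT b1 * TT a1" and de: "TT d1 * TT e2 = TT e2 * TT d1"
      using l lB lA by (auto intro!: commuting_TT simp: bx dx sube sym)
    have "TT c1 * TT d1 * E s t * TT b1 * TT f1 = TT d1 * (TT c1 * E s t) * (TT b1 * TT f1)"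
      unfolding dc by (simp add: mult.assoc)
    also have "\<dots> = q ^ length c1 *s (TT d1 * (E s t * TT f1) * TT b1)"
      unfolding TT_E[OF A(1) sub(3)] be by (simp add: mult.assoc scale_mult_left scale_mult_right)
    also have "\<dots> = (q ^ length c1 * q ^ length f1) *s (TT d1 * E s t * TT b1)"
      unfolding E_TT[OF A(1) sub(4)] by (simp add: mult.assoc scale_mult_left scale_mult_right)
    also have "TT d1 * E s t * TT b1 = E s t * TT b1 * TT d1"
      unfolding dE by (simp add: mult.assoc db)
    finally have 1: "TT c1 * TT d1 * E s t * TT b1 * TT f1 = q ^ (length c1 + length f1) *s (E s t * TT b1 * TT d1)"
      by (simp add: power_add)
    have "TT a1 * TT b1 * E u v * TT d1 * TT e2 = TT b1 * (TT a1 * E s t) * (TT d1 * TT e2)"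
      unfolding ab EE by (simp add: mult.assoc)
    also have "\<dots> = q ^ length a1 *s (TT b1 * (E s t * TT e2) * TT d1)"
      unfolding TT_E[OF A(1) sub(1)] de by (simp add: mult.assoc scale_mult_left scale_mult_right)
    also have "\<dots> = (q ^ length a1 * q ^ length e2) *s (TT b1 * E s t * TT d1)"
      unfolding E_TT[OF A(1) sub(2)] by (simp add: mult.assoc scale_mult_left scale_mult_right)
    finally have 2: "TT a1 * TT b1 * E u v * TT d1 * TT e2 = q ^ (length a1 + length e2) *s (E s t * TT b1 * TT d1)"
      by (simp add: power_add bE)
    have "length a1 + length e2 = length c1 + length f1" using lenA lenB kl by simp
    then have "?D = 0" unfolding 1 2 by simp
    then show ?thesis by simp
  next
    case (short x)
    obtain y where y: "{x, y} = {s, t}" "bond x y k" "a1 = [] \<or> a1 = [y] \<or> set a1 = {x, y}"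
        "e2 = [] \<or> e2 = [y] \<or> set e2 = {x, y}"
      using A(2) unfolding short by (rule alt_around[OF A(1)])
    obtain z where z: "{x, z} = {u, v}" "bond x z l" "c1 = [] \<or> c1 = [z] \<or> set c1 = {x, z}"
        "f1 = [] \<or> f1 = [z] \<or> set f1 = {x, z}"
      using B(2) unfolding short by (rule alt_around[OF B(1)])
    have EA: "E s t = E x y" and EB: "E u v = E x z" using y(1) z(1) E_sym by (metis doubleton_eq_iff)+
    have nc: "\<not> commuting x y" "\<not> commuting y x" "\<not> commuting x z" "\<not> commuting z x"
      using bond_not_commuting[OF y(2)] bond_not_commuting[OF z(2)] commuting_sym by blast+
    have lens: "k = Suc (length a1 + length e2)" "l = Suc (length c1 + length f1)"
      using lenA lenB short by simp_all
    have big: "set e2 = {x, y}" if "a1 = []" using y(4) that lens k3 by auto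
    have big': "set f1 = {x, z}" if "c1 = []" using z(4) that lens k3 by auto
    have mem: "commuting a b" if "commuting_words xs ys" "a \<in> set xs" "b \<in> set ys" for a b xs ys
      using that by (auto simp: commuting_words_def)
    show ?thesis
    proof (cases "a1 = []"; cases "c1 = []")
      \<comment> \<open>\<open>A\<close> and \<open>B\<close> would both begin with \<open>x\<close>, and \<open>x\<close> would commute with itself.\<close>
      assume "a1 = []" "c1 = []"
      then have "commuting x x" using big big' mem[OF ef] by auto
      then show ?thesis using irr by blast
    next
      \<comment> \<open>\<open>A\<close> ends in \<open>x\<close> and \<open>B\<close> begins with \<open>x\<close>.\<close>
      assume a: "a1 \<noteq> []" and c: "c1 = []"
      have f1: "set f1 = {x, z}" using big' c by blast
      then have e2: "e2 = []" using y(4) mem[OF ef] nc by fastforce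
      have dE: "TT d1 * E s t = E s t * TT d1" and dE': "TT d1 * E u v = E u v * TT d1"
        using l by (auto intro!: cE cE' simp: cw e2 c)
      have da: "TT d1 * TT a1 = TT a1 * TT d1" using l lA by (auto intro!: commuting_TT simp: cw)
      have pair: "E s t * TT b1 * TT f1 - TT a1 * TT b1 * E u v \<in> J_lt (k + length b1 + length f1)"
        using A B b1 l by (intro end_pair[of s t k a1 x u v l f1]) (simp_all add: e2 c short)
      have "TT a1 * TT b1 * E u v * TT d1 = TT d1 * TT a1 * TT b1 * E u v"
        by (simp add: mult.assoc dE'[symmetric] mult_left_commute[OF db] mult_left_commute[OF da])
      moreover have "Te * (TT d1 * g) = TT d1 * g" "g * E u v * TT d1 * Te = g * E u v * TT d1" for g
        using l by (simp_all add: mult.assoc[symmetric]) (simp_all add: mult.assoc)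
      ultimately have "?D = TT d1 * (E s t * TT b1 * TT f1 - TT a1 * TT b1 * E u v)"
        by (simp add: e2 c right_diff_distrib) (simp add: mult.assoc E_Te[OF B(1)])
      also have "\<dots> \<in> J_lt (length d1 + (k + length b1 + length f1))" by (rule TT_J_lt[OF l(2) pair])
      finally show ?thesis by (rule J_lt_mono) (simp add: c)
    next
      \<comment> \<open>\<open>B\<close> ends in \<open>x\<close> and \<open>A\<close> begins with \<open>x\<close>.\<close>
      assume a: "a1 = []" and c: "c1 \<noteq> []"
      have e2: "set e2 = {x, y}" using big a by blast
      then have f1: "f1 = []" using z(4) mem[OF ef] nc by fastforce
      have bE: "TT b1 * E s t = E s t * TT b1"
        using l by (auto intro!: cE simp: cw a)
      have pair: "E u v * TT d1 * TT e2 - TT c1 * TT d1 * E s t \<in> J_lt (l + length d1 + length e2)"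
        using A B d1 l by (intro end_pair[of u v l c1 x s t k e2]) (simp_all add: f1 a short)
      have "TT c1 * TT d1 * E s t * TT b1 = TT b1 * TT c1 * TT d1 * E s t"
        by (simp add: mult.assoc bE[symmetric] mult_left_commute[OF db] mult_left_commute[OF cb])
      moreover have "Te * (TT b1 * g) = TT b1 * g" "g * TT b1 * Te = g * TT b1" for g
        using l by (simp_all add: mult.assoc[symmetric]) (simp_all add: mult.assoc)
      ultimately have "?D = - (TT b1 * (E u v * TT d1 * TT e2 - TT c1 * TT d1 * E s t))"
        by (simp add: f1 a right_diff_distrib) (simp add: mult.assoc E_Te[OF A(1)])
      also have "\<dots> \<in> J_lt (length b1 + (l + length d1 + length e2))" by (rule J_lt_minus[OF TT_J_lt[OF l(1) pair]])
      finally show ?thesis by (rule J_lt_mono) (simp add: lens f1 a)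
    next
      \<comment> \<open>The letter \<open>x\<close> cannot occur a second time in \<open>A\<close> or \<open>B\<close>, so \<open>A = y x y\<close> and \<open>B = z x z\<close>.\<close>
      assume a: "a1 \<noteq> []" and c: "c1 \<noteq> []"
      have yz: "y \<in> set a1" "z \<in> set c1" using a c y(3) z(3) by auto
      then have zy: "commuting z y" using mem[OF c1(1)] by blast
      have "x \<notin> set a1" "x \<notin> set c1" using mem[OF c1(1)] yz nc by blast+
      then have a1: "a1 = [y]" and c1': "c1 = [z]" using y(3) z(3) a c by auto
      then have ne: "e2 \<noteq> []" "f1 \<noteq> []" using lens k3 by auto
      then have yz': "y \<in> set e2" "z \<in> set f1" using y(4) z(4) by auto
      then have "x \<notin> set e2" "x \<notin> set f1" using mem[OF ef] nc by blast+
      then have e2: "e2 = [y]" and f1: "f1 = [z]" using y(4) z(4) ne by auto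
      have k: "k = 3" "l = 3" using lens a1 c1' e2 f1 by simp_all
      have pair: "Tg z * E s t * Tg z - Tg y * E u v * Tg y \<in> J_lt 5"
        unfolding EA EB using cross_pair[of x y z] y(2) z(2) zy k by simp
      have zS: "z \<in> S" "y \<in> S" using y(2) z(2) by (auto simp: bond_def)
      have zd: "Tg z * TT d1 = TT d1 * Tg z" and zb: "Tg z * TT b1 = TT b1 * Tg z"
        and yd: "Tg y * TT d1 = TT d1 * Tg y" and yb: "Tg y * TT b1 = TT b1 * Tg y"
        using commuting_TT[of c1 b1] commuting_TT[of f1 d1] commuting_TT[of a1 d1] commuting_TT[of e2 b1]
          zS l cw unfolding a1 c1' e2 f1 by auto
      have bE: "E s t * TT b1 = TT b1 * E s t" and dE: "E u v * TT d1 = TT d1 * E u v"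
        using cE[of b1] cE'[of d1] l cw unfolding a1 c1' e2 f1 by auto
      have "Tg z * TT d1 * E s t * TT b1 * Tg z = TT d1 * TT b1 * (Tg z * E s t * Tg z)"
        by (simp add: mult.assoc zd zb bE mult_left_commute[OF zd] mult_left_commute[OF zb] mult_left_commute[OF bE])
      moreover have "Tg y * TT b1 * E u v * TT d1 * Tg y = TT d1 * TT b1 * (Tg y * E u v * Tg y)"
        by (simp add: mult.assoc yd yb dE mult_left_commute[OF yd] mult_left_commute[OF yb]
            mult_left_commute[OF dE] mult_left_commute[OF db[symmetric]])
      ultimately have "?D = TT d1 * TT b1 * (Tg z * E s t * Tg z - Tg y * E u v * Tg y)"
        using zS by (simp add: a1 c1' e2 f1 right_diff_distrib)
      also have "\<dots> = TT (d1 @ b1) * (Tg z * E s t * Tg z - Tg y * E u v * Tg y)"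
        using l by (simp add: TT_append)
      also have "\<dots> \<in> J_lt (length (d1 @ b1) + 5)" using l by (intro TT_J_lt pair) simp
      finally show ?thesis by (rule J_lt_mono) (simp add: k c1' f1)
    qed
  qed
qed

end

lemma square_split:
  assumes "[c, c] = xs @ ys @ zs"
  shows "xs = [c, c] \<and> ys = [] \<and> zs = [] \<or> xs = [] \<and> ys = [] \<and> zs = [c, c] \<or>
    xs = [c] \<and> ys = [] \<and> zs = [c] \<or> xs = [] \<and> ys = [c] \<and> zs = [c] \<or>
    xs = [c] \<and> ys = [c] \<and> zs = [] \<or> ys = [c, c]"
proof -
  have "length xs + length ys + length zs = 2" using arg_cong[OF assms, of length] by simp
  then have "length xs \<le> 2" "length ys \<le> 2" by auto
  then show ?thesis using assms
    by (auto simp: Cons_eq_append_conv)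
qed

context coxeter_graph
begin

text \<open>
  Levi's lemma is applied four times: to \<open>x1 (A x2) = y1 (B y2)\<close>, to the two resulting
  factorizations of \<open>A x2\<close> and \<open>B y2\<close>, and to their common right part. The factors of \<open>A\<close>
  and \<open>B\<close> are then equal to words and not only equivalent to them, as alternating words
  admit no commutation.
\<close>

lemma comm_eq_two_factors:
  assumes eq: "comm_eq (x1 @ alt s t k @ x2) (y1 @ alt u v l @ y2)"
    and A: "\<not> commuting s t" and B: "\<not> commuting u v"
  obtains p a1 b1 c1 d1 e1 e2 f1 f2 where
    "comm_eq x1 (p @ c1 @ d1)" "alt s t k = a1 @ e1 @ e2" "comm_eq x2 (b1 @ f1 @ f2)"
    "comm_eq y1 (p @ a1 @ b1)" "alt u v l = c1 @ e1 @ f1" "comm_eq y2 (d1 @ e2 @ f2)"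
    "commuting_words c1 a1" "commuting_words c1 b1" "commuting_words d1 a1" "commuting_words d1 b1"
    "commuting_words d1 e1" "commuting_words d1 f1" "commuting_words b1 e1" "commuting_words b1 e2"
    "commuting_words e2 f1"
proof -
  obtain p r s' u' where 1: "comm_eq x1 (p @ r)" "comm_eq (alt s t k @ x2) (s' @ u')"
    "comm_eq y1 (p @ s')" "comm_eq (alt u v l @ y2) (r @ u')" "commuting_words r s'"
    using eq by (rule comm_eq_factor)
  obtain a1 a2 b1 b2 where 2: "comm_eq (alt s t k) (a1 @ a2)" "comm_eq x2 (b1 @ b2)"
    "comm_eq s' (a1 @ b1)" "comm_eq u' (a2 @ b2)" "commuting_words a2 b1"
    using 1(2) by (rule comm_eq_factor)
  obtain c1 c2 d1 d2 where 3: "comm_eq (alt u v l) (c1 @ c2)" "comm_eq y2 (d1 @ d2)"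
    "comm_eq r (c1 @ d1)" "comm_eq u' (c2 @ d2)" "commuting_words c2 d1"
    using 1(4) by (rule comm_eq_factor)
  have "comm_eq (a2 @ b2) (c2 @ d2)" using 2(4) 3(4) by (meson comm_eq_sym rtranclp_trans)
  then obtain e1 e2 f1 f2 where 4: "comm_eq a2 (e1 @ e2)" "comm_eq b2 (f1 @ f2)"
    "comm_eq c2 (e1 @ f1)" "comm_eq d2 (e2 @ f2)" "commuting_words e2 f1"
    by (rule comm_eq_factor)
  have cc: "comm_eq xs (ys @ zs')" if "comm_eq xs (ys @ zs)" "comm_eq zs zs'" for xs ys zs zs'
    using that(1) comm_eq_append[OF rtranclp.rtrancl_refl that(2)] by (rule rtranclp_trans)
  have "alt s t k = a1 @ e1 @ e2" using comm_eq_alt[OF cc[OF 2(1) 4(1)] A] by simp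
  moreover have "alt u v l = c1 @ e1 @ f1" using comm_eq_alt[OF cc[OF 3(1) 4(3)] B] by simp
  moreover have "set r = set c1 \<union> set d1" "set s' = set a1 \<union> set b1"
    "set a2 = set e1 \<union> set e2" "set c2 = set e1 \<union> set f1"
    using comm_eq_set[OF 3(3)] comm_eq_set[OF 2(3)] comm_eq_set[OF 4(1)] comm_eq_set[OF 4(3)] by auto
  moreover note sets = calculation(3-6)
  have "commuting_words c1 a1" "commuting_words c1 b1" "commuting_words d1 a1" "commuting_words d1 b1"
    "commuting_words d1 e1" "commuting_words d1 f1" "commuting_words b1 e1" "commuting_words b1 e2"
    using 1(5) 2(5) 3(5) sets by (auto simp: commuting_words_def intro: commuting_sym)
  ultimately show thesis
    using that[OF cc[OF 1(1) 3(3)] _ cc[OF 2(2) 4(2)] cc[OF 1(3) 2(3)] _ cc[OF 3(2) 4(4)] _ _ _ _ _ _ _ _ 4(5)]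
    by blast
qed

end

context hecke_rep
begin

lemma two_occurrences:
  assumes A: "bond s t k" and B: "bond u v l"
    and eq: "comm_eq (x1 @ alt s t k @ x2) (y1 @ alt u v l @ y2)"
    and l: "x1 \<in> lists S" "x2 \<in> lists S"
  shows "TT x1 * E s t * TT x2 - TT y1 * E u v * TT y2 \<in> J_lt (length x1 + k + length x2)"
proof -
  obtain p a1 b1 c1 d1 e1 e2 f1 f2 where f:
    "comm_eq x1 (p @ c1 @ d1)" "alt s t k = a1 @ e1 @ e2" "comm_eq x2 (b1 @ f1 @ f2)"
    "comm_eq y1 (p @ a1 @ b1)" "alt u v l = c1 @ e1 @ f1" "comm_eq y2 (d1 @ e2 @ f2)"
    and c: "commuting_words c1 a1" "commuting_words c1 b1" "commuting_words d1 a1" "commuting_words d1 b1"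
    "commuting_words d1 e1" "commuting_words d1 f1" "commuting_words b1 e1" "commuting_words b1 e2"
    "commuting_words e2 f1"
    by (rule comm_eq_two_factors[OF eq bond_not_commuting[OF A] bond_not_commuting[OF B]])
  have xl: "p \<in> lists S" "c1 \<in> lists S" "d1 \<in> lists S" "b1 \<in> lists S" "f1 \<in> lists S" "f2 \<in> lists S"
    using comm_eq_lists[OF f(1)] comm_eq_lists[OF f(3)] l by auto
  have al: "a1 \<in> lists S" "e1 \<in> lists S" "e2 \<in> lists S"
    using bond_alt_lists[OF A] unfolding f(2) by simp_all
  have yl: "y1 \<in> lists S" "y2 \<in> lists S"
    using comm_eq_lists[OF f(4)] comm_eq_lists[OF f(6)] xl al by auto
  have T: "TT x1 = TT p * TT c1 * TT d1" "TT x2 = TT b1 * TT f1 * TT f2"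
    "TT y1 = TT p * TT a1 * TT b1" "TT y2 = TT d1 * TT e2 * TT f2"
    using comm_eq_TT[OF f(1)] comm_eq_TT[OF f(3)] comm_eq_TT[OF f(4)] comm_eq_TT[OF f(6)] l yl xl al
    by (simp_all add: TT_append mult.assoc)
  let ?D = "TT c1 * TT d1 * E s t * TT b1 * TT f1 - TT a1 * TT b1 * E u v * TT d1 * TT e2"
  have "?D \<in> J_lt (length c1 + length d1 + k + length b1 + length f1)"
    by (rule overlapping_occurrences[OF A f(2) B f(5) xl(4,3) c])
  then have "TT p * ?D * TT f2 \<in> J_lt (length p + (length c1 + length d1 + k + length b1 + length f1) + length f2)"
    by (intro J_lt_TT TT_J_lt xl)
  moreover have "TT p * ?D * TT f2 = TT x1 * E s t * TT x2 - TT y1 * E u v * TT y2"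
    unfolding T by (simp add: right_diff_distrib left_diff_distrib mult.assoc)
  moreover have "length p + (length c1 + length d1 + k + length b1 + length f1) + length f2 =
    length x1 + k + length x2"
    using comm_eq_length[OF f(1)] comm_eq_length[OF f(3)] by simp
  ultimately show ?thesis by simp
qed

text \<open>
  A square \<open>c c\<close> in the class of the leading word makes the word collapse. If both letters
  lie outside the alternating word, they can be moved together and the quadratic relation
  applies; if one of them belongs to the alternating word, the other is absorbed by
  \<open>T\<^sub>c E = q E\<close>. The cases are the positions of the two letters in the matrix of factors,
  with \<open>c c\<close> in the place of \<open>B\<close>.
\<close>

lemma occurrence_with_square:
  assumes A: "bond s t k"
    and eq: "comm_eq (x1 @ alt s t k @ x2) (y1 @ [c, c] @ y2)"
    and l: "x1 \<in> lists S" "x2 \<in> lists S"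
  shows "TT x1 * E s t * TT x2 \<in> J_lt (length x1 + k + length x2)"
proof -
  have cc: "[c, c] = alt c c 2" by (simp add: numeral_2_eq_2)
  have irr: "\<not> commuting c c" by (simp add: commuting_def)
  obtain p a1 b1 c1 d1 e1 e2 f1 f2 where f:
    "comm_eq x1 (p @ c1 @ d1)" "alt s t k = a1 @ e1 @ e2" "comm_eq x2 (b1 @ f1 @ f2)"
    "comm_eq y1 (p @ a1 @ b1)" "alt c c 2 = c1 @ e1 @ f1" "comm_eq y2 (d1 @ e2 @ f2)"
    and c: "commuting_words c1 a1" "commuting_words c1 b1" "commuting_words d1 a1" "commuting_words d1 b1"
    "commuting_words d1 e1" "commuting_words d1 f1" "commuting_words b1 e1" "commuting_words b1 e2"
    "commuting_words e2 f1"
    by (rule comm_eq_two_factors[OF eq[unfolded cc] bond_not_commuting[OF A] irr])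
  have xl: "p \<in> lists S" "c1 \<in> lists S" "d1 \<in> lists S" "b1 \<in> lists S" "f1 \<in> lists S" "f2 \<in> lists S"
    using comm_eq_lists[OF f(1)] comm_eq_lists[OF f(3)] l by auto
  have al: "a1 \<in> lists S" "e1 \<in> lists S" "e2 \<in> lists S"
    using bond_alt_lists[OF A] unfolding f(2) by simp_all
  have cS: "c \<in> S" if "c \<in> set c1 \<union> set e1 \<union> set f1"
    using that xl al by (auto simp: in_lists_conv_set)
  let ?n = "length p + length c1 + length d1 + k + length b1 + length f1 + length f2"
  have n: "length x1 + k + length x2 = ?n"
    using comm_eq_length[OF f(1)] comm_eq_length[OF f(3)] by simp
  have T: "TT x1 * E s t * TT x2 = TT p * TT c1 * TT d1 * E s t * TT b1 * TT f1 * TT f2"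
    using comm_eq_TT[OF f(1)] comm_eq_TT[OF f(3)] l xl by (simp add: TT_append mult.assoc)
  have G: "TT g * E s t * TT h \<in> J_lt ?n" if "g \<in> lists S" "h \<in> lists S" "length g + k + length h < ?n" for g h
    using that J_lt_gen[OF _ _ A] by blast
  have ccf: "[c, c] = c1 @ e1 @ f1" using f(5) cc by simp
  have sq: "Tg c * (Tg c * g) = q *s (Te * g) + (q - 1) *s (Tg c * g)" if "c \<in> S" for g
    using Tg_square[OF that] by (simp add: scale_mult_left distrib_right flip: mult.assoc)
  consider (0) "c1 = [c, c]" "e1 = []" "f1 = []" | (1) "c1 = []" "e1 = []" "f1 = [c, c]"
    | (2) "c1 = [c]" "e1 = []" "f1 = [c]" | (3) "c1 = []" "e1 = [c]" "f1 = [c]"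
    | (4) "c1 = [c]" "e1 = [c]" "f1 = []" | (5) "e1 = [c, c]"
    using square_split[OF ccf] by metis
  then have "TT p * TT c1 * TT d1 * E s t * TT b1 * TT f1 * TT f2 \<in> J_lt ?n"
  proof cases
    case 0
    have cS: "c \<in> S" using cS 0 by simp
    have "TT p * TT c1 * TT d1 * E s t * TT b1 * TT f1 * TT f2 =
      q *s (TT (p @ d1) * E s t * TT (b1 @ f2)) + (q - 1) *s (TT (p @ [c] @ d1) * E s t * TT (b1 @ f2))"
      using xl cS E_Te[OF A] by (simp add: 0 TT_append mult.assoc sq distrib_left distrib_right scale_mult_right scale_mult_left)
    also have "\<dots> \<in> J_lt ?n" using xl cS by (intro J_lt_add J_lt_scale G) (auto simp: 0)
    finally show ?thesis .
  next
    case 1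
    have cS: "c \<in> S" using cS 1 by simp
    have "TT p * TT c1 * TT d1 * E s t * TT b1 * TT f1 * TT f2 =
      q *s (TT (p @ d1) * E s t * TT (b1 @ f2)) + (q - 1) *s (TT (p @ d1) * E s t * TT (b1 @ [c] @ f2))"
      using xl cS by (simp add: 1 TT_append mult.assoc sq distrib_left scale_mult_right)
    also have "\<dots> \<in> J_lt ?n" using xl cS by (intro J_lt_add J_lt_scale G) (auto simp: 1)
    finally show ?thesis .
  next
    case 2
    have cS: "c \<in> S" using cS 2 by simp
    have "commuting_words [c] [s, t]"
    proof -
      have "{s, t} = set a1 \<union> set e2" using f(2) 2 set_alt[of k s t] A by (simp add: bond_def)
      moreover have "commuting c y" if "y \<in> set a1 \<union> set e2" for y
        using that c(1) c(9) 2 commuting_sym[of y c] by (auto simp: commuting_words_def)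
      ultimately show ?thesis by (simp add: commuting_words_def)
    qed
    then have cE: "Tg c * E s t = E s t * Tg c" using commuting_TT_E[of "[c]"] cS A by simp
    have cb: "Tg c * TT b1 = TT b1 * Tg c" and dc: "TT d1 * Tg c = Tg c * TT d1"
      using commuting_TT[of "[c]" b1] commuting_TT[of d1 "[c]"] c 2 xl cS by auto
    have "TT p * TT c1 * TT d1 * E s t * TT b1 * TT f1 * TT f2 =
      TT p * (Tg c * TT d1) * E s t * (TT b1 * Tg c) * TT f2"
      using xl cS by (simp add: 2 mult.assoc)
    also have "\<dots> = TT p * TT d1 * (Tg c * E s t) * Tg c * TT b1 * TT f2"
      unfolding dc[symmetric] cb[symmetric] by (simp add: mult.assoc)
    also have "\<dots> = TT p * TT d1 * (E s t * (Tg c * (Tg c * (TT b1 * TT f2))))"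
      unfolding cE by (simp add: mult.assoc)
    also have "\<dots> = q *s (TT (p @ d1) * E s t * TT (b1 @ f2)) + (q - 1) *s (TT (p @ d1) * E s t * TT ([c] @ b1 @ f2))"
      using xl cS Te_TT[of "b1 @ f2"]
      by (simp add: TT_append mult.assoc sq distrib_left scale_mult_right)
    also have "\<dots> \<in> J_lt ?n" using xl cS by (intro J_lt_add J_lt_scale G) (auto simp: 2)
    finally show ?thesis .
  next
    case 3
    have cS: "c \<in> S" using cS 3 by simp
    obtain y where y: "{c, y} = {s, t}" "bond c y k" "e2 = [] \<or> e2 = [y] \<or> set e2 = {c, y}"
      using f(2) unfolding 3 by (rule alt_around[OF A])
    have "e2 = []" using y c(9) bond_not_commuting[OF y(2)] 3 by (auto simp: commuting_words_def intro: commuting_sym)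
    have cb: "TT b1 * Tg c = Tg c * TT b1"
      using commuting_TT[of b1 "[c]"] c 3 xl cS by auto
    have Ec: "E s t * Tg c = q *s E s t" using E_Tg[OF A] y(1) by auto
    have "TT p * TT c1 * TT d1 * E s t * TT b1 * TT f1 * TT f2 = TT p * TT d1 * E s t * (TT b1 * Tg c) * TT f2"
      using xl cS by (simp add: 3 mult.assoc)
    also have "\<dots> = TT p * TT d1 * (E s t * Tg c) * TT b1 * TT f2" unfolding cb by (simp add: mult.assoc)
    also have "\<dots> = q *s (TT (p @ d1) * E s t * TT (b1 @ f2))"
      unfolding Ec using xl by (simp add: TT_append mult.assoc scale_mult_left scale_mult_right)
    also have "\<dots> \<in> J_lt ?n" using xl cS by (intro J_lt_scale G) (auto simp: 3)
    finally show ?thesis .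
  next
    case 4
    have cS: "c \<in> S" using cS 4 by simp
    obtain y where y: "{c, y} = {s, t}" "bond c y k"
      using f(2) unfolding 4 by (rule alt_around[OF A])
    have cd: "TT d1 * Tg c = Tg c * TT d1"
      using commuting_TT[of d1 "[c]"] c 4 xl cS by auto
    have cE: "Tg c * E s t = q *s E s t" using Tg_E[OF A] y(1) by auto
    have "TT p * TT c1 * TT d1 * E s t * TT b1 * TT f1 * TT f2 = TT p * (Tg c * TT d1) * E s t * TT b1 * TT f2"
      using xl cS by (simp add: 4 mult.assoc)
    also have "\<dots> = TT p * TT d1 * (Tg c * E s t) * TT b1 * TT f2" unfolding cd[symmetric] by (simp add: mult.assoc)
    also have "\<dots> = q *s (TT (p @ d1) * E s t * TT (b1 @ f2))"
      unfolding cE using xl by (simp add: TT_append mult.assoc scale_mult_left scale_mult_right)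
    also have "\<dots> \<in> J_lt ?n" using xl cS by (intro J_lt_scale G) (auto simp: 4)
    finally show ?thesis .
  next
    case 5
    then have "c = s \<and> c = t \<or> c = t \<and> c = s" using alt_consecutive[of s t k a1 c c e2] f(2) by simp
    then show ?thesis using A by (auto simp: bond_def)
  qed
  then show ?thesis unfolding T n .
qed

section \<open>Independence modulo the ideal\<close>

text \<open>
  The generator \<open>z\<close> has a leading word that is equivalent to \<open>u\<close> modulo commutation.
\<close>

definition occurs :: "'s list \<Rightarrow> 'r \<Rightarrow> bool"
  where "occurs u z \<longleftrightarrow> u \<in> lists S \<and> (\<exists>x1 x2 s t k. bond s t k \<and> comm_eq u (x1 @ alt s t k @ x2) \<and>
    z = TT x1 * E s t * TT x2)"

lemma occurs_gen:
  "a \<in> lists S \<Longrightarrow> b \<in> lists S \<Longrightarrow> bond s t k \<Longrightarrow> occurs (a @ alt s t k @ b) (TT a * E s t * TT b)"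
  unfolding occurs_def using bond_alt_lists[of s t k]
  by (intro conjI exI[of _ a] exI[of _ b] exI[of _ s] exI[of _ t] exI[of _ k]) auto

lemma occurs_same_class:
  assumes "occurs u z" "occurs u z'"
  shows "z - z' \<in> J_lt (length u)"
proof -
  obtain x1 x2 s t k where 1: "bond s t k" "comm_eq u (x1 @ alt s t k @ x2)" "z = TT x1 * E s t * TT x2"
    using assms(1) by (auto simp: occurs_def)
  obtain y1 y2 s' t' k' where 2: "bond s' t' k'" "comm_eq u (y1 @ alt s' t' k' @ y2)" "z' = TT y1 * E s' t' * TT y2"
    using assms(2) by (auto simp: occurs_def)
  have "comm_eq (x1 @ alt s t k @ x2) (y1 @ alt s' t' k' @ y2)"
    using 1(2) 2(2) by (meson comm_eq_sym rtranclp_trans)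
  moreover have "x1 \<in> lists S" "x2 \<in> lists S"
    using comm_eq_lists[OF 1(2)] assms(1) by (auto simp: occurs_def)
  moreover have "length u = length x1 + k + length x2" using comm_eq_length[OF 1(2)] by simp
  ultimately show ?thesis using two_occurrences[OF 1(1) 2(1)] 1(3) 2(3) by simp
qed

lemma occurs_comm_eq: "comm_eq u u' \<Longrightarrow> occurs u z \<Longrightarrow> occurs u' z"
  unfolding occurs_def using comm_eq_lists[of u u'] rtranclp_trans[OF comm_eq_sym[of u u']] by blast

text \<open>
  A long braid move exchanges \<open>alt s t k\<close> and \<open>alt t s k\<close>. Both words are leading words of
  the same generator, as \<open>E s t = E t s\<close>, and replacing \<open>z\<close> by this generator costs an
  element of \<open>J_lt\<close>.
\<close>

lemma occurs_braid_eq: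
  assumes "braid_eq u u'" "occurs u z"
  shows "\<exists>z'. occurs u' z' \<and> z - z' \<in> J_lt (length u)"
  using assms
proof (induction rule: rtranclp_induct)
  case base
  then show ?case by (intro exI[of _ z]) simp
next
  case (step u1 u2)
  then obtain z1 where z1: "occurs u1 z1" "z - z1 \<in> J_lt (length u)" by blast
  from step.hyps(2) show ?case
  proof cases
    case comm
    then show ?thesis using z1 occurs_comm_eq[of u1 u2 z1] by blast
  next
    case (long s t k us vs)
    have u1: "u1 \<in> lists S" using z1 by (simp add: occurs_def)
    then have "us \<in> lists S" "vs \<in> lists S" using long by auto
    then have o: "occurs u1 (TT us * E s t * TT vs)" "occurs u2 (TT us * E s t * TT vs)"
      using occurs_gen[of us vs s t k] occurs_gen[of us vs t s k] long bond_sym E_sym[of s t] by auto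
    have "z1 - TT us * E s t * TT vs \<in> J_lt (length u)"
      using occurs_same_class[OF z1(1) o(1)] braid_eq_length[OF step.hyps(1)] by simp
    then have "(z - z1) + (z1 - TT us * E s t * TT vs) \<in> J_lt (length u)" using z1(2) by (intro J_lt_add)
    then show ?thesis using o(2) by auto
  qed
qed

lemma occurs_braid_class:
  assumes "braid_eq u u'" "occurs u z" "occurs u' z'"
  shows "z - z' \<in> J_lt (length u)"
proof -
  obtain z1 where z1: "occurs u' z1" "z - z1 \<in> J_lt (length u)"
    using occurs_braid_eq assms by blast
  have "z1 - z' \<in> J_lt (length u)"
    using occurs_same_class[OF z1(1) assms(3)] braid_eq_length[OF assms(1)] by simp
  then have "(z - z1) + (z1 - z') \<in> J_lt (length u)" using z1(2) by (intro J_lt_add)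
  then show ?thesis by simp
qed

text \<open>
  Braid moves lead to a word with a square, where \<open>occurrence_with_square\<close> applies.
\<close>

lemma occurs_not_reduced:
  assumes "occurs u z" "\<not> reduced u"
  shows "z \<in> J_lt (length u)"
proof -
  obtain us c vs where c: "braid_eq u (us @ [c, c] @ vs)"
    using not_reduced_braid_square[of u] assms by (auto simp: occurs_def)
  obtain z' where z': "occurs (us @ [c, c] @ vs) z'" "z - z' \<in> J_lt (length u)"
    using occurs_braid_eq[OF c assms(1)] by blast
  then obtain x1 x2 s t k where x: "bond s t k" "comm_eq (us @ [c, c] @ vs) (x1 @ alt s t k @ x2)"
    "z' = TT x1 * E s t * TT x2" "us @ [c, c] @ vs \<in> lists S"
    by (auto simp: occurs_def)
  have "z' \<in> J_lt (length x1 + k + length x2)"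
    unfolding x(3) using comm_eq_lists[OF x(2)] x(4) by (intro occurrence_with_square[OF x(1) comm_eq_sym[OF x(2)]]) auto
  moreover have "length x1 + k + length x2 = length u"
    using comm_eq_length[OF x(2)] braid_eq_length[OF c] by simp
  ultimately have "(z - z') + z' \<in> J_lt (length u)" using z' by (intro J_lt_add) simp_all
  then show ?thesis by simp
qed

lemma longest_bond:
  assumes "bond s t k"
  shows "longest s t = word_class (alt s t k)"
proof -
  have P: "word_class (alt s t k) \<in> parabolic s t"
    using assms by (auto simp: bond_def parabolic_words intro!: imageI alt_in_lists_general)
  have len: "len (word_class (alt s t k)) = k"
    using reduced_alt[of s t k k] assms by (simp add: bond_def reduced_def)
  have "is_arg_max len (\<lambda>x. x \<in> parabolic s t) (word_class (alt s t k))"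
    using P len parabolic_len(1)[OF assms] by (auto simp: is_arg_max_def not_less)
  then have "is_arg_max len (\<lambda>x. x \<in> parabolic s t) (longest s t)"
    unfolding longest_def arg_max_on_def arg_max_def by (rule someI)
  then have l: "longest s t \<in> parabolic s t" "\<not> len (longest s t) < k"
    using P len by (auto simp: is_arg_max_def)
  then show ?thesis using parabolic_len[OF assms l(1)] by simp
qed

lemma complex_iff:
  assumes "w \<in> carrier W"
  shows "complex w \<longleftrightarrow> (\<exists>a b s t k. bond s t k \<and> reduced (a @ alt s t k @ b) \<and> w = word_class (a @ alt s t k @ b))"
proof
  assume "complex w"
  then obtain s t x1 x2 where st: "adjacent s t" "finite (parabolic s t)"
    and x: "x1 \<in> carrier W" "x2 \<in> carrier W" "w = x1 \<otimes>\<^bsub>W\<^esub> longest s t \<otimes>\<^bsub>W\<^esub> x2"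
      "len w = len x1 + len (longest s t) + len x2"
    by (auto simp: complex_def)
  obtain k where "m s t = enat k"
    using st infinite_parabolic[of s t] by (cases "m s t") (auto simp: adjacent_def)
  then have k: "bond s t k" using st by (auto simp: adjacent_def bond_def numeral_eq_enat)
  obtain a where a: "reduced a" "word_class a = x1" using x(1) by (rule reduced_exists)
  obtain b where b: "reduced b" "word_class b = x2" using x(2) by (rule reduced_exists)
  have l: "a \<in> lists S" "b \<in> lists S" "alt s t k \<in> lists S"
    using a b reduced_lists bond_alt_lists[OF k] by auto
  then have w: "w = word_class (a @ alt s t k @ b)"
    using x(3) a b longest_bond[OF k] by (auto simp: mult_word_class)
  have "len (longest s t) = k"
    using longest_bond[OF k] reduced_alt[of s t k k] k by (simp add: bond_def reduced_def)
  then have "reduced (a @ alt s t k @ b)" using x(4) a b l w by (auto simp: reduced_def)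
  then show "\<exists>a b s t k. bond s t k \<and> reduced (a @ alt s t k @ b) \<and> w = word_class (a @ alt s t k @ b)"
    using w k by blast
next
  assume "\<exists>a b s t k. bond s t k \<and> reduced (a @ alt s t k @ b) \<and> w = word_class (a @ alt s t k @ b)"
  then obtain a b s t k where k: "bond s t k" and r: "reduced (a @ alt s t k @ b)"
    and w: "w = word_class (a @ alt s t k @ b)" by blast
  have l: "a \<in> lists S" "b \<in> lists S" "alt s t k \<in> lists S" using reduced_lists[OF r] by auto
  have "reduced a" "reduced (alt s t k)" "reduced b"
    using reduced_append[OF r] reduced_append[of "alt s t k" b] by auto
  then have "w = word_class a \<otimes>\<^bsub>W\<^esub> longest s t \<otimes>\<^bsub>W\<^esub> word_class b"
    "len w = len (word_class a) + len (longest s t) + len (word_class b)"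
    using w r l longest_bond[OF k] by (auto simp: mult_word_class reduced_def)
  moreover have "adjacent s t" "finite (parabolic s t)"
    using k bond_finite_parabolic[OF k] by (auto simp: adjacent_def bond_def numeral_eq_enat)
  ultimately show "complex w" unfolding complex_def
    by (intro exI[of _ s] exI[of _ t] conjI bexI[of _ "word_class a"] bexI[of _ "word_class b"])
      (use l in simp_all)
qed

text \<open>
  A generator of the ideal with the leading term \<open>\<tau> w\<close>, for complex \<open>w\<close>. Any two choices
  differ by an element of \<open>J_lt (len w)\<close>.
\<close>

definition complex_lift :: "'s list set \<Rightarrow> 'r"
  where "complex_lift w = (SOME z. \<exists>a b s t k. bond s t k \<and> reduced (a @ alt s t k @ b) \<and>
    w = word_class (a @ alt s t k @ b) \<and> z = TT a * E s t * TT b)"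

lemma complex_lift_props:
  assumes "w \<in> carrier W" "complex w"
  obtains a b s t k where "bond s t k" "reduced (a @ alt s t k @ b)" "w = word_class (a @ alt s t k @ b)"
    "complex_lift w = TT a * E s t * TT b"
proof -
  have "\<exists>z a b s t k. bond s t k \<and> reduced (a @ alt s t k @ b) \<and>
    w = word_class (a @ alt s t k @ b) \<and> z = TT a * E s t * TT b"
    using assms complex_iff by blast
  then have "\<exists>a b s t k. bond s t k \<and> reduced (a @ alt s t k @ b) \<and>
    w = word_class (a @ alt s t k @ b) \<and> complex_lift w = TT a * E s t * TT b"
    unfolding complex_lift_def by (rule someI_ex)
  then show thesis using that by blast
qed

lemma gen_minus_complex_lift:
  assumes "bond s t k" "reduced (a @ alt s t k @ b)" "w = word_class (a @ alt s t k @ b)"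
  shows "TT a * E s t * TT b - complex_lift w \<in> J_lt (len w)"
proof -
  have wW: "w \<in> carrier W" using reduced_lists[OF assms(2)] assms(3) by (simp only: word_class_carrier)
  then have "complex w" using complex_iff assms by blast
  then obtain a' b' s' t' k' where Z: "bond s' t' k'" "reduced (a' @ alt s' t' k' @ b')"
    "w = word_class (a' @ alt s' t' k' @ b')" "complex_lift w = TT a' * E s' t' * TT b'"
    using wW by (metis complex_lift_props)
  have l: "a @ alt s t k @ b \<in> lists S" "a' @ alt s' t' k' @ b' \<in> lists S"
    using assms Z reduced_lists by blast+
  have eq: "word_eq (a @ alt s t k @ b) (a' @ alt s' t' k' @ b')"
    unfolding word_class_eq_iff[OF l(1), symmetric] using assms(3) Z(3) by (rule subst)
  have len: "length (a @ alt s t k @ b) = len w" "length (a' @ alt s' t' k' @ b') = len w"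
    using assms(2,3) Z(2,3) by (simp_all add: reduced_def)
  have "occurs (a @ alt s t k @ b) (TT a * E s t * TT b)"
    "occurs (a' @ alt s' t' k' @ b') (complex_lift w)"
    unfolding Z(4) using l by (auto intro: occurs_gen assms Z)
  moreover have "braid_eq (a @ alt s t k @ b) (a' @ alt s' t' k' @ b')"
    using matsumoto[OF assms(2) eq] len by simp
  ultimately show ?thesis using occurs_braid_class len(1) by metis
qed

lemma TT_H_lt: "a \<in> lists S \<Longrightarrow> x \<in> H_lt n \<Longrightarrow> TT a * x \<in> H_lt (length a + n)"
  by (induction a) (auto simp: H_lt_Te mult.assoc Tg_H_lt)

lemma H_lt_TT:
  assumes "b \<in> lists S" "x \<in> H_lt n"
  shows "x * TT b \<in> H_lt (n + length b)"
  using assms(2) unfolding H_lt_def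
proof (rule span_mult_right)
  fix y assume "y \<in> {\<tau> w | w. w \<in> carrier W \<and> len w < n}"
  then obtain w where "w \<in> carrier W" "len w < n" "y = \<tau> w" by blast
  then obtain xs where xs: "xs \<in> lists S" "length xs < n" "y = TT xs" by (metis \<tau>_word)
  then have "y * TT b \<in> H_lt (n + length b)"
    using TT_in_H_lt[of "xs @ b"] assms(1) by (simp add: TT_append)
  then show "y * TT b \<in> span {\<tau> w | w. w \<in> carrier W \<and> len w < n + length b}" by (simp add: H_lt_def)
qed

lemma J_lt_subset_H_lt:
  assumes "x \<in> J_lt n"
  shows "x \<in> H_lt n"
proof -
  have "J_lt n \<subseteq> H_lt n"
    unfolding J_lt_def
  proof (rule span_minimal)
    show "subspace (H_lt n)" by (simp add: H_lt_def)
    show "J_lt_gens n \<subseteq> H_lt n"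
      unfolding J_lt_gens_def
    proof clarify
      fix a b s t k assume *: "a \<in> lists S" "b \<in> lists S" "bond s t k" "length a + k + length b < n"
      then have "TT a * E s t * TT b \<in> H_lt ((length a + Suc k) + length b)"
        by (intro H_lt_TT TT_H_lt E_in_H_lt)
      then show "TT a * E s t * TT b \<in> H_lt n" by (rule H_lt_mono) (use * in simp)
    qed
  qed
  then show ?thesis using assms by blast
qed

lemma complex_lift_minus_\<tau>:
  assumes "w \<in> carrier W" "complex w"
  shows "complex_lift w - \<tau> w \<in> H_lt (len w)" and "complex_lift w \<in> J_lt (Suc (len w))"
proof -
  obtain a b s t k where Z: "bond s t k" "reduced (a @ alt s t k @ b)"
    "w = word_class (a @ alt s t k @ b)" "complex_lift w = TT a * E s t * TT b"
    using assms by (rule complex_lift_props)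
  have l: "a \<in> lists S" "b \<in> lists S" "alt s t k \<in> lists S" using reduced_lists[OF Z(2)] by auto
  have len: "len w = length a + k + length b" using Z by (simp add: reduced_def)
  have "complex_lift w - \<tau> w = TT a * (E s t - TT (alt s t k)) * TT b"
    using TT_reduced[OF Z(2)] Z l by (simp add: TT_append right_diff_distrib left_diff_distrib mult.assoc)
  then show "complex_lift w - \<tau> w \<in> H_lt (len w)"
    using H_lt_TT[OF l(2) TT_H_lt[OF l(1) E_top[OF Z(1)]]] len by simp
  show "complex_lift w \<in> J_lt (Suc (len w))" using J_lt_gen[OF l(1,2) Z(1)] Z(4) len by simp
qed

lemma co_zero [simp]: "co 0 = 0"
  using co_add[of 0 0] by simp

lemma co_diff: "co (x - y) = co x - co y"
  using co_add[of "x - y" y] by simp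

lemma co_sum: "co (\<Sum>i\<in>I. f i) = (\<Sum>i\<in>I. co (f i))"
  by (induction I rule: infinite_finite_induct) (auto simp: co_add)

lemma co_H_lt:
  assumes "x \<in> H_lt n" "n \<le> len w"
  shows "lookup (co x) w = 0"
  using assms(1) unfolding H_lt_def
proof (induction rule: span_induct_alt)
  case (step a y z)
  then obtain v where v: "v \<in> carrier W" "len v < n" "y = \<tau> v" by blast
  then have "v \<noteq> w" using assms(2) by auto
  then show ?case using step.IH v
    by (simp add: co_add lookup_add co_scale co_\<tau> lookup_single when_def)
qed simp

text \<open>
  A generator with a leading word \<open>u\<close> of length \<open>n\<close> is congruent to \<open>complex_lift\<close> of the
  element represented by \<open>u\<close> if \<open>u\<close> is reduced, and to zero otherwise.
\<close>

lemma J_lt_Suc_decompose: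
  assumes "x \<in> J_lt (Suc n)"
  shows "\<exists>y\<in>span {complex_lift w | w. w \<in> carrier W \<and> complex w \<and> len w = n}. x - y \<in> J_lt n"
  using assms unfolding J_lt_def[of "Suc n"]
proof (induction rule: span_induct_alt)
  case base
  then show ?case by (intro bexI[of _ 0]) (auto simp: span_zero)
next
  case (step c g x)
  let ?Y = "{complex_lift w | w. w \<in> carrier W \<and> complex w \<and> len w = n}"
  obtain y where y: "y \<in> span ?Y" "x - y \<in> J_lt n" using step by blast
  obtain a b s t k where g: "g = TT a * E s t * TT b" "a \<in> lists S" "b \<in> lists S" "bond s t k"
    "length a + k + length b < Suc n" using step.hyps unfolding J_lt_gens_def by blast
  let ?u = "a @ alt s t k @ b"
  have ul: "?u \<in> lists S" using g bond_alt_lists by simp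
  have "\<exists>y'\<in>span ?Y. g - y' \<in> J_lt n"
  proof (cases "length ?u < n \<or> \<not> reduced ?u")
    case True
    then have "g \<in> J_lt n"
    proof
      assume "length ?u < n"
      then show ?thesis unfolding g(1) using J_lt_gen[OF g(2-4)] by simp
    next
      assume "\<not> reduced ?u"
      then have "g \<in> J_lt (length ?u)" unfolding g(1) by (intro occurs_not_reduced occurs_gen g)
      then show ?thesis by (rule J_lt_mono) (use g(5) in simp)
    qed
    then show ?thesis by (intro bexI[of _ 0]) (auto simp: span_zero)
  next
    case False
    define w where "w = word_class ?u"
    have w: "w \<in> carrier W" "len w = n" using ul False g(5) by (auto simp: w_def reduced_def)
    have "complex w" using complex_iff[OF w(1)] False g(4) w_def by blast
    then have "complex_lift w \<in> span ?Y" using w by (intro span_base) blast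
    moreover have "g - complex_lift w \<in> J_lt n" using gen_minus_complex_lift[OF g(4) _ w_def] False w g(1) by simp
    ultimately show ?thesis by blast
  qed
  then obtain y' where y': "y' \<in> span ?Y" "g - y' \<in> J_lt n" by blast
  have "c *s g + x - (c *s y' + y) = c *s (g - y') + (x - y)" by (simp add: algebra_simps)
  also have "\<dots> \<in> J_lt n" using y y' by (intro J_lt_add J_lt_scale)
  finally show ?case using y y' by (intro bexI[of _ "c *s y' + y"]) (auto intro: span_add span_scale)
qed

text \<open>
  No nonzero element of the ideal is supported on \<open>W\<^sub>c\<close>. The part of \<open>x\<close> made of lifts of
  complex elements of length \<open>n\<close> is determined by the coefficients of \<open>x\<close> at these elements,
  to which shorter generators do not contribute; so this part vanishes, and \<open>n\<close> can be
  lowered.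
\<close>

lemma J_lt_independent:
  assumes "x \<in> J_lt n" "\<And>w. w \<in> carrier W \<Longrightarrow> complex w \<Longrightarrow> lookup (co x) w = 0"
  shows "x = 0"
  using assms
proof (induction n arbitrary: x)
  case 0
  then have "x \<in> H_lt 0" using J_lt_subset_H_lt by blast
  then show ?case by (simp add: H_lt_def)
next
  case (Suc n)
  let ?C = "{w. w \<in> carrier W \<and> complex w \<and> len w = n}"
  obtain y where y: "y \<in> span {complex_lift w | w. w \<in> carrier W \<and> complex w \<and> len w = n}" "x - y \<in> J_lt n"
    using J_lt_Suc_decompose Suc.prems by blast
  have ycoef: "lookup (co y) w = 0" if "w \<in> ?C" for w
  proof -
    have "lookup (co (x - y)) w = 0"
      using co_H_lt[OF J_lt_subset_H_lt[OF y(2)]] that by simp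
    then show ?thesis using Suc.prems(2) that by (simp add: co_diff lookup_minus)
  qed
  have Zcoef: "lookup (co (complex_lift w)) v = (if v = w then 1 else 0)" if "w \<in> ?C" "v \<in> ?C" for v w
  proof -
    have "lookup (co (complex_lift w - \<tau> w)) v = 0"
      using co_H_lt[OF complex_lift_minus_\<tau>(1)] that by simp
    then show ?thesis using that by (simp add: co_diff lookup_minus co_\<tau> lookup_single when_def)
  qed
  obtain F r where F: "finite F" "F \<subseteq> complex_lift ` ?C" "y = (\<Sum>z\<in>F. r z *s z)"
    using y(1) unfolding span_explicit by (auto simp: image_def) blast
  have "r z = 0" if z: "z \<in> F" for z
  proof -
    obtain w where w: "w \<in> ?C" "z = complex_lift w" using z F(2) by blast
    have "lookup (co y) w = (\<Sum>z\<in>F. r z * lookup (co z) w)"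
      unfolding F(3) by (simp add: co_sum lookup_sum co_scale)
    also have "\<dots> = (\<Sum>z'\<in>F. if z' = z then r z else 0)"
    proof (rule sum.cong)
      fix z' assume "z' \<in> F"
      then obtain w' where w': "w' \<in> ?C" "z' = complex_lift w'" using F(2) by blast
      show "r z' * lookup (co z') w = (if z' = z then r z else 0)"
        using Zcoef[OF w'(1) w(1)] Zcoef[OF w(1) w(1)] w(2) w'(2)
          by (cases "w' = w"; cases "complex_lift w' = complex_lift w") simp_all
    qed simp
    also have "\<dots> = r z" using F(1) z by simp
    finally show ?thesis using ycoef[OF w(1)] by simp
  qed
  then have "y = 0" unfolding F(3) by simp
  then show ?case using Suc.IH[of x] y(2) Suc.prems(2) by simp
qed

text \<open>
  The elements of \<open>W\<^sub>c\<close> span the quotient: for complex \<open>w\<close>, \<open>\<tau> w\<close> is congruent to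
  \<open>\<tau> w - complex_lift w\<close>, which consists of shorter terms.
\<close>

lemma H_lt_reduce:
  assumes "x \<in> H_lt n"
  shows "\<exists>y\<in>span {\<tau> w | w. w \<in> W\<^sub>c \<and> len w < n}. x - y \<in> J_lt n"
  using assms
proof (induction n arbitrary: x)
  case 0
  then show ?case by (intro bexI[of _ 0]) (auto simp: span_zero H_lt_def)
next
  case (Suc n)
  let ?Y = "\<lambda>n. {\<tau> w | w. w \<in> W\<^sub>c \<and> len w < n}"
  have mono: "y \<in> span (?Y (Suc n))" if "y \<in> span (?Y n)" for y
    using that by (rule subsetD[OF span_mono, rotated]) auto
  from Suc.prems show ?case unfolding H_lt_def
  proof (induction rule: span_induct_alt)
    case base
    then show ?case by (intro bexI[of _ 0]) (auto simp: span_zero)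
  next
    case (step c g x)
    obtain y where y: "y \<in> span (?Y (Suc n))" "x - y \<in> J_lt (Suc n)" using step by blast
    obtain w where w: "w \<in> carrier W" "len w < Suc n" "g = \<tau> w" using step.hyps by blast
    have "\<exists>y'\<in>span (?Y (Suc n)). g - y' \<in> J_lt (Suc n)"
    proof (cases "complex w")
      case False
      then have "g \<in> ?Y (Suc n)" using w by (auto simp: W\<^sub>c_def)
      then show ?thesis by (intro bexI[of _ g] span_base) auto
    next
      case True
      have "\<tau> w - complex_lift w \<in> H_lt (len w)"
        using span_neg[OF complex_lift_minus_\<tau>(1)[OF w(1) True, unfolded H_lt_def]] by (simp add: H_lt_def)
      then have "\<tau> w - complex_lift w \<in> H_lt n" by (rule H_lt_mono) (use w in simp)
      then obtain y' where y': "y' \<in> span (?Y n)" "\<tau> w - complex_lift w - y' \<in> J_lt n" using Suc.IH by blast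
      have "complex_lift w \<in> J_lt (Suc n)" using complex_lift_minus_\<tau>(2)[OF w(1) True] by (rule J_lt_mono) (use w in simp)
      moreover have "\<tau> w - complex_lift w - y' \<in> J_lt (Suc n)" using y'(2) by (rule J_lt_mono) simp
      ultimately have "(\<tau> w - complex_lift w - y') + complex_lift w \<in> J_lt (Suc n)" by (rule J_lt_add[rotated])
      then show ?thesis using mono[OF y'(1)] w(3) by (intro bexI[of _ y']) (simp_all add: algebra_simps)
    qed
    then obtain y' where y': "y' \<in> span (?Y (Suc n))" "g - y' \<in> J_lt (Suc n)" by blast
    have "c *s g + x - (c *s y' + y) = c *s (g - y') + (x - y)" by (simp add: algebra_simps)
    also have "\<dots> \<in> J_lt (Suc n)" using y y' by (intro J_lt_add J_lt_scale)
    finally show ?case using y y' by (intro bexI[of _ "c *s y' + y"]) (auto intro: span_add span_scale)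
  qed
qed

end

section \<open>The bar involution of the Laurent polynomials\<close>

definition lbar :: "laurent \<Rightarrow> laurent"
  where "lbar = Poly_Mapping.map_key uminus"

lemma lookup_lbar: "lookup (lbar a) k = lookup a (- k)"
  by (simp add: lbar_def map_key.rep_eq)

lemma lbar_zero [simp]: "lbar 0 = 0"
  and lbar_add: "lbar (a + b) = lbar a + lbar b"
  and lbar_diff: "lbar (a - b) = lbar a - lbar b"
  and lbar_lbar [simp]: "lbar (lbar a) = a"
  by (rule poly_mapping_eqI; simp add: lookup_lbar lookup_add lookup_minus)+

lemma lbar_v_pow [simp]: "lbar (v_pow k) = v_pow (- k)"
  by (rule poly_mapping_eqI) (auto simp: lookup_lbar v_pow_def lookup_single when_def)

lemma v_pow_zero [simp]: "v_pow 0 = 1"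
  by (simp add: v_pow_def)

lemma v_pow_mult: "v_pow i * v_pow j = v_pow (i + j)"
  by (simp add: v_pow_def mult_single)

lemma lbar_one [simp]: "lbar 1 = 1"
  using lbar_v_pow[of 0] by (simp del: lbar_v_pow)

lemma lbar_mult: "lbar (a * b) = lbar a * lbar b"
proof -
  have *: "lbar (v_pow i * b) = lbar (v_pow i) * lbar b" for i
  proof (rule frag_induction[of b UNIV])
    fix j show "lbar (v_pow i * frag_of j) = lbar (v_pow i) * lbar (frag_of j)"
      using lbar_v_pow[of j] by (simp add: v_pow_mult flip: v_pow_def)
  qed (auto simp: right_diff_distrib lbar_diff)
  show ?thesis
  proof (rule frag_induction[of a UNIV])
    fix i show "lbar (frag_of i * b) = lbar (frag_of i) * lbar b" using *[of i] by (simp add: v_pow_def)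
  qed (auto simp: left_diff_distrib lbar_diff)
qed

definition neg_part :: "laurent \<Rightarrow> laurent"
  where "neg_part = Poly_Mapping.mapp (\<lambda>k c. if k < 0 then c else 0)"

lemma lookup_neg_part: "lookup (neg_part a) k = (if k < 0 then lookup a k else 0)"
  by (simp add: neg_part_def lookup_mapp when_def in_keys_iff)

lemma keys_neg_part: "keys (neg_part a) \<subseteq> {..<0}"
  by (auto simp: in_keys_iff lookup_neg_part split: if_splits)

text \<open>The constant coefficient of an antisymmetric Laurent polynomial vanishes.\<close>

lemma antisymmetric_split:
  assumes "lbar a = - a"
  shows "a = neg_part a - lbar (neg_part a)"
proof (rule poly_mapping_eqI)
  fix k
  have anti: "lookup a (- j) = - lookup a j" for j
    using arg_cong[OF assms, of "\<lambda>p. lookup p j"] by (simp add: lookup_lbar)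
  show "lookup a k = lookup (neg_part a - lbar (neg_part a)) k"
    using anti[of k] anti[of 0] by (auto simp: lookup_minus lookup_lbar lookup_neg_part)
qed

lemma symmetric_negative_zero:
  assumes "lbar a = a" "keys a \<subseteq> {..<0}"
  shows "a = 0"
proof (rule poly_mapping_eqI)
  fix k
  have "lookup a j = 0" if "0 \<le> j" for j
    using assms(2) that by (force simp: in_keys_iff)
  moreover have "lookup a (- k) = lookup a k"
    using arg_cong[OF assms(1), of "\<lambda>p. lookup p k"] by (simp add: lookup_lbar)
  ultimately show "lookup a k = lookup 0 k"
    by (cases "0 \<le> k") (auto dest: spec[of _ "- k"])
qed

section \<open>Linear combinations\<close>

definition scal :: "'a::comm_ring_1 \<Rightarrow> ('i \<Rightarrow>\<^sub>0 'a) \<Rightarrow> ('i \<Rightarrow>\<^sub>0 'a)"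
  where "scal a = Poly_Mapping.map ((*) a)"

lemma lookup_scal [simp]: "lookup (scal a p) k = a * lookup p k"
  by (simp add: scal_def map.rep_eq when_def)

lemma keys_scal: "keys (scal a p) \<subseteq> keys p"
  by (auto simp: in_keys_iff)

text \<open>
  Linear combinations whose coefficients form a finitely supported function. They are used
  for the Hecke algebra inside the representation and for the free module of coordinates.
\<close>

locale coefficient_module = Modules.module scale
  for scale :: "'a::comm_ring_1 \<Rightarrow> 'b::ab_group_add \<Rightarrow> 'b"
begin

definition lincomb :: "('i \<Rightarrow> 'b) \<Rightarrow> ('i \<Rightarrow>\<^sub>0 'a) \<Rightarrow> 'b"
  where "lincomb f p = (\<Sum>i\<in>keys p. scale (lookup p i) (f i))"

lemma lincomb_superset:
  "finite A \<Longrightarrow> keys p \<subseteq> A \<Longrightarrow> lincomb f p = (\<Sum>i\<in>A. scale (lookup p i) (f i))"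
  for p :: "'i \<Rightarrow>\<^sub>0 'a"
  unfolding lincomb_def by (rule sum.mono_neutral_left) (auto simp: in_keys_iff)

lemma lincomb_zero [simp]: "lincomb f 0 = 0"
  by (simp add: lincomb_def)

lemma lincomb_add: "lincomb f (p + r) = lincomb f p + lincomb f r"
proof -
  let ?A = "keys p \<union> keys r"
  have "keys (p + r) \<subseteq> ?A" by (rule keys_add)
  then show ?thesis
    using lincomb_superset[of ?A p f] lincomb_superset[of ?A r f] lincomb_superset[of ?A "p + r" f]
    by (simp add: lookup_add scale_left_distrib sum.distrib)
qed

lemma lincomb_scal: "lincomb f (scal a p) = scale a (lincomb f p)"
  using lincomb_superset[of "keys p" "scal a p" f] keys_scal[of a p]
  by (simp add: lincomb_def scale_sum_right)

lemma lincomb_diff: "lincomb f (p - r) = lincomb f p - lincomb f r"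
  using lincomb_add[of f "p - r" r] by simp

lemma lincomb_single [simp]: "lincomb f (single i a) = scale a (f i)"
  by (simp add: lincomb_def)

lemma lincomb_cong: "(\<And>i. i \<in> keys p \<Longrightarrow> f i = g i) \<Longrightarrow> lincomb f p = lincomb g p"
  for p :: "'i \<Rightarrow>\<^sub>0 'a"
  by (simp add: lincomb_def)

lemma lincomb_in_span: "(\<And>i. i \<in> keys p \<Longrightarrow> f i \<in> span B) \<Longrightarrow> lincomb f p \<in> span B"
  for p :: "'i \<Rightarrow>\<^sub>0 'a"
  unfolding lincomb_def by (intro span_sum span_scale)

lemma span_lincomb:
  assumes "x \<in> span (f ` I)"
  obtains p :: "'i \<Rightarrow>\<^sub>0 'a" where "keys p \<subseteq> I" "x = lincomb f p"
proof -
  have "\<exists>p :: 'i \<Rightarrow>\<^sub>0 'a. keys p \<subseteq> I \<and> x = lincomb f p"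
    using assms
  proof (induction rule: span_induct_alt)
    case base
    then show ?case by (intro exI[of _ 0]) simp
  next
    case (step c y x)
    then obtain i and p :: "'i \<Rightarrow>\<^sub>0 'a" where "i \<in> I" "y = f i" "keys p \<subseteq> I" "x = lincomb f p" by auto
    moreover have "keys (single i c + p) \<subseteq> insert i (keys p)"
      using keys_add[of "single i c" p] by (auto split: if_splits)
    ultimately show ?case
      by (intro exI[of _ "single i c + p"]) (auto simp: lincomb_add)
  qed
  then show thesis using that by blast
qed

end

interpretation pm: coefficient_module scal
  by standard (auto intro!: poly_mapping_eqI simp: lookup_add algebra_simps)

lemma lookup_lincomb:
  "lookup (pm.lincomb f p) k = (\<Sum>i\<in>keys p. lookup p i * lookup (f i) k)"
  by (simp add: pm.lincomb_def lookup_sum)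

lemma lincomb_single_id: "pm.lincomb (\<lambda>i. single i 1) p = p"
proof (rule poly_mapping_eqI)
  fix k
  have "(\<Sum>i\<in>keys p. lookup p i * lookup (single i 1) k)
    = (\<Sum>i\<in>keys p. if i = k then lookup p k else 0)"
    by (rule sum.cong) (auto simp: lookup_single when_def)
  then show "lookup (pm.lincomb (\<lambda>i. single i 1) p) k = lookup p k"
    by (simp add: lookup_lincomb in_keys_iff)
qed

section \<open>Bar-invariant bases of a free module\<close>

text \<open>
  In coordinates with respect to a basis indexed by \<open>I\<close>, the lattice has coefficients in
  \<open>\<int>[v\<^sup>-\<^sup>1]\<close>, and the sublattice has coefficients in \<open>v\<^sup>-\<^sup>1\<int>[v\<^sup>-\<^sup>1]\<close>.
\<close>

definition lattice_of :: "'i set \<Rightarrow> ('i \<Rightarrow>\<^sub>0 laurent) set"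
  where "lattice_of I = {p. keys p \<subseteq> I \<and> (\<forall>i. keys (lookup p i) \<subseteq> {..0})}"

definition sublattice_of :: "'i set \<Rightarrow> ('i \<Rightarrow>\<^sub>0 laurent) set"
  where "sublattice_of I = {p. keys p \<subseteq> I \<and> (\<forall>i. keys (lookup p i) \<subseteq> {..<0})}"

lemma keys_mult_le:
  fixes a b :: laurent
  assumes "keys a \<subseteq> {..0}" "keys b \<subseteq> {..0}"
  shows "keys (a * b) \<subseteq> {..0}"
proof
  fix k assume "k \<in> keys (a * b)"
  then obtain i j where "i \<in> keys a" "j \<in> keys b" "k = i + j"
    using keys_mult[of a b] by blast
  then have "i \<le> 0" "j \<le> 0" "k = i + j" using assms by auto
  then show "k \<in> {..0}" by simp
qed

lemma keys_add_subset: "keys p \<subseteq> A \<Longrightarrow> keys r \<subseteq> A \<Longrightarrow> keys (p + r) \<subseteq> A"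
  using keys_add[of p r] by blast

lemma keys_diff_subset:
  fixes p r :: "'i \<Rightarrow>\<^sub>0 'a::ab_group_add"
  shows "keys p \<subseteq> A \<Longrightarrow> keys r \<subseteq> A \<Longrightarrow> keys (p - r) \<subseteq> A"
  by (simp add: in_keys_iff lookup_minus subset_iff) metis

lemma lattice_zero: "0 \<in> lattice_of I"
  and lattice_add: "p \<in> lattice_of I \<Longrightarrow> r \<in> lattice_of I \<Longrightarrow> p + r \<in> lattice_of I"
  and lattice_diff: "p \<in> lattice_of I \<Longrightarrow> r \<in> lattice_of I \<Longrightarrow> p - r \<in> lattice_of I"
  and sublattice_add: "p \<in> sublattice_of I \<Longrightarrow> r \<in> sublattice_of I \<Longrightarrow> p + r \<in> sublattice_of I"
  and sublattice_diff: "p \<in> sublattice_of I \<Longrightarrow> r \<in> sublattice_of I \<Longrightarrow> p - r \<in> sublattice_of I"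
  by (simp_all add: lattice_of_def sublattice_of_def lookup_add lookup_minus keys_add_subset keys_diff_subset)

lemma sublattice_lattice: "sublattice_of I \<subseteq> lattice_of I"
  by (fastforce simp: lattice_of_def sublattice_of_def)

lemma lattice_scal:
  assumes "keys a \<subseteq> {..0}" "p \<in> lattice_of I"
  shows "scal a p \<in> lattice_of I"
proof -
  have "keys (a * lookup p i) \<subseteq> {..0}" for i
    using assms by (intro keys_mult_le) (simp_all add: lattice_of_def)
  moreover have "keys (scal a p) \<subseteq> I"
    using keys_scal[of a p] assms(2) by (auto simp: lattice_of_def)
  ultimately show ?thesis by (simp add: lattice_of_def)
qed

lemma lattice_lincomb:
  assumes "p \<in> lattice_of I" "\<And>i. i \<in> I \<Longrightarrow> f i \<in> lattice_of K"
  shows "pm.lincomb f p \<in> lattice_of K"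
proof -
  have "(\<Sum>i\<in>A. scal (lookup p i) (f i)) \<in> lattice_of K" if "finite A" "A \<subseteq> I" for A
    using that
  proof (induction A rule: finite_induct)
    case (insert i A)
    then have "scal (lookup p i) (f i) \<in> lattice_of K"
      using assms by (intro lattice_scal) (auto simp: lattice_of_def)
    then show ?case using insert by (simp add: lattice_add)
  qed (simp add: lattice_zero)
  then show ?thesis using assms(1) by (simp add: pm.lincomb_def lattice_of_def)
qed

lemma sublattice_eq_shift: "p \<in> sublattice_of I \<longleftrightarrow> (\<exists>r\<in>lattice_of I. p = scal (v_pow (- 1)) r)"
proof
  have lk: "lookup (v_pow i * a) k = lookup a (k - i)" for i k and a :: laurent
  proof (rule frag_induction[of a UNIV])
    fix j show "lookup (v_pow i * frag_of j) k = lookup (frag_of j) (k - i)"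
      by (auto simp: v_pow_def mult_single lookup_single when_def)
  qed (auto simp: right_diff_distrib lookup_minus)
  have keysv: "keys (v_pow i * a) \<subseteq> {..<i + j}" if "keys a \<subseteq> {..<j}" for i j and a :: laurent
    using that by (force simp: in_keys_iff lk)
  have eq: "{..0::int} = {..<1}" by auto
  {
    assume p: "p \<in> sublattice_of I"
    have "keys (v_pow 1 * lookup p i) \<subseteq> {..0}" for i
      using keysv[of "lookup p i" 0 1] p by (simp add: sublattice_of_def eq)
    moreover have "keys (scal (v_pow 1) p) \<subseteq> I"
      using keys_scal[of "v_pow 1" p] p by (auto simp: sublattice_of_def)
    ultimately have "scal (v_pow 1) p \<in> lattice_of I" by (simp add: lattice_of_def)
    moreover have "p = scal (v_pow (- 1)) (scal (v_pow 1) p)" by (simp add: v_pow_mult)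
    ultimately show "\<exists>r\<in>lattice_of I. p = scal (v_pow (- 1)) r" by blast
  next
    assume "\<exists>r\<in>lattice_of I. p = scal (v_pow (- 1)) r"
    then obtain r where r: "r \<in> lattice_of I" "p = scal (v_pow (- 1)) r" by blast
    have "keys (v_pow (- 1) * lookup r i) \<subseteq> {..<0}" for i
      using keysv[of "lookup r i" 1 "-1"] r(1) by (simp add: lattice_of_def eq)
    moreover have "keys p \<subseteq> I"
      using keys_scal[of "v_pow (- 1)" r] r by (auto simp: lattice_of_def)
    ultimately show "p \<in> sublattice_of I" using r(2) by (simp add: sublattice_of_def)
  }
qed

text \<open>
  The setting of the lemma of Kazhdan and Lusztig, for the free module of functions
  supported on \<open>I\<close>. A height function suffices in the place of the Bruhat order.
\<close>

locale bar_module =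
  fixes I :: "'i set" and ht :: "'i \<Rightarrow> nat" and \<beta> :: "('i \<Rightarrow>\<^sub>0 laurent) \<Rightarrow> ('i \<Rightarrow>\<^sub>0 laurent)"
  assumes \<beta>_add: "\<lbrakk>keys p \<subseteq> I; keys r \<subseteq> I\<rbrakk> \<Longrightarrow> \<beta> (p + r) = \<beta> p + \<beta> r"
    and \<beta>_scal: "keys p \<subseteq> I \<Longrightarrow> \<beta> (scal a p) = scal (lbar a) (\<beta> p)"
    and \<beta>_\<beta>: "keys p \<subseteq> I \<Longrightarrow> \<beta> (\<beta> p) = p"
    and \<beta>_triangular: "i \<in> I \<Longrightarrow>
      keys (\<beta> (single i 1) - single i 1) \<subseteq> {j \<in> I. ht j < ht i}"
begin

lemma \<beta>_zero [simp]: "\<beta> 0 = 0"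
  using \<beta>_add[of 0 0] by simp

lemma \<beta>_basis_keys: "i \<in> I \<Longrightarrow> keys (\<beta> (single i 1)) \<subseteq> {j \<in> I. ht j \<le> ht i}"
  using keys_add_subset[of "\<beta> (single i 1) - single i 1" "{j \<in> I. ht j \<le> ht i}" "single i 1"]
    \<beta>_triangular[of i] by fastforce

lemma \<beta>_sum:
  "finite A \<Longrightarrow> (\<And>i. i \<in> A \<Longrightarrow> keys (f i) \<subseteq> I) \<Longrightarrow> \<beta> (\<Sum>i\<in>A. f i) = (\<Sum>i\<in>A. \<beta> (f i))"
proof (induction A rule: finite_induct)
  case (insert i A)
  have "keys (\<Sum>i\<in>A. f i) \<subseteq> I"
    using keys_sum[of f A] insert by blast
  then show ?case using insert \<beta>_add by simp
qed simp

lemma \<beta>_expand: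
  assumes "keys p \<subseteq> I"
  shows "\<beta> p = (\<Sum>i\<in>keys p. scal (lbar (lookup p i)) (\<beta> (single i 1)))"
proof -
  have "\<beta> (\<Sum>i\<in>keys p. scal (lookup p i) (single i 1)) =
    (\<Sum>i\<in>keys p. \<beta> (scal (lookup p i) (single i 1)))"
    using assms keys_scal by (intro \<beta>_sum) fastforce+
  also have "\<dots> = (\<Sum>i\<in>keys p. scal (lbar (lookup p i)) (\<beta> (single i 1)))"
    using assms by (intro sum.cong refl \<beta>_scal) auto
  finally show ?thesis using lincomb_single_id[of p] by (simp add: pm.lincomb_def)
qed

lemma \<beta>_keys:
  assumes "keys p \<subseteq> {i \<in> I. ht i < n}"
  shows "keys (\<beta> p) \<subseteq> {i \<in> I. ht i < n}"
proof -
  have "keys (scal (lbar (lookup p i)) (\<beta> (single i 1))) \<subseteq> {i \<in> I. ht i < n}"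
    if "i \<in> keys p" for i
    using keys_scal \<beta>_basis_keys[of i] that assms by fastforce
  moreover have I: "keys p \<subseteq> I" using assms by auto
  moreover note keys_sum[of "\<lambda>i. scal (lbar (lookup p i)) (\<beta> (single i 1))" "keys p"]
  ultimately show ?thesis unfolding \<beta>_expand[OF I] by blast
qed

text \<open>
  At a basis element of maximal height, only the coefficient itself is conjugated.
\<close>

lemma \<beta>_top_coeff:
  assumes "keys p \<subseteq> {i \<in> I. ht i \<le> ht k}"
  shows "lookup (\<beta> p) k = lbar (lookup p k)"
proof -
  have "lookup (\<beta> p) k = (\<Sum>i\<in>keys p.
      lbar (lookup p i) * lookup (\<beta> (single i 1)) k)"
    using assms by (subst \<beta>_expand) (auto simp: lookup_sum)
  also have "\<dots> = (\<Sum>i\<in>keys p. if i = k then lbar (lookup p k) else 0)"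
  proof (rule sum.cong)
    fix i assume i: "i \<in> keys p"
    then have "k \<notin> keys (\<beta> (single i 1) - single i 1)"
      using assms \<beta>_triangular[of i] by fastforce
    then have "lookup (\<beta> (single i 1)) k = lookup (single i 1) k"
      by (simp add: in_keys_iff lookup_minus)
    then show "lbar (lookup p i) * lookup (\<beta> (single i 1)) k =
      (if i = k then lbar (lookup p k) else 0)"
      by (simp add: lookup_single when_def)
  qed simp
  also have "\<dots> = lbar (lookup p k)" by (simp add: in_keys_iff)
  finally show ?thesis .
qed

lemma top_key:
  assumes "p \<noteq> 0" "keys p \<subseteq> I"
  obtains k where "k \<in> keys p" "keys p \<subseteq> {i \<in> I. ht i \<le> ht k}"
proof -
  have ne: "keys p \<noteq> {}"
    using assms(1) by (auto simp: in_keys_iff poly_mapping_eq_iff fun_eq_iff)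
  then obtain k where "k \<in> keys p" "ht k = Max (ht ` keys p)"
    by (metis (no_types, lifting) Max_in finite_imageI finite_keys image_iff image_is_empty)
  then show thesis using that[of k] assms(2) by fastforce
qed

text \<open>A coefficient of maximal height is symmetric and has only negative exponents.\<close>

lemma invariant_sublattice_zero:
  assumes "p \<in> sublattice_of I" "\<beta> p = p"
  shows "p = 0"
proof (rule ccontr)
  assume "p \<noteq> 0"
  then obtain k where k: "k \<in> keys p" "keys p \<subseteq> {i \<in> I. ht i \<le> ht k}"
    using assms(1) top_key by (auto simp: sublattice_of_def)
  then have "lookup p k = 0"
    using \<beta>_top_coeff[OF k(2)] assms by (intro symmetric_negative_zero) (auto simp: sublattice_of_def)
  then show False using k(1) by (simp add: in_keys_iff)
qed

text \<open>
  The coefficients \<open>a\<close> of \<open>d\<close> of maximal height are antisymmetric, so that \<open>a\<close> is the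
  difference of its negative part and the conjugate of that. Let \<open>g\<close> have the negative parts
  as its coefficients; then \<open>d - (g - \<beta> g)\<close> is antiinvariant with smaller heights.
\<close>

lemma antiinvariant_split:
  assumes "keys d \<subseteq> {i \<in> I. ht i < n}" "\<beta> d = - d"
  shows "\<exists>g\<in>sublattice_of {i \<in> I. ht i < n}. g - \<beta> g = d"
  using assms
proof (induction n arbitrary: d)
  case 0
  then have "d = 0" by simp
  then show ?case by (intro bexI[of _ 0]) (auto simp: sublattice_of_def)
next
  case (Suc n)
  define g where "g = Poly_Mapping.mapp (\<lambda>i a. if ht i = n then neg_part a else 0) d"
  have lg: "lookup g i = (if ht i = n then neg_part (lookup d i) else 0)" for i
    by (auto simp: g_def lookup_mapp when_def in_keys_iff poly_mapping_eq_iff fun_eq_iff lookup_neg_part)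
  have gk: "keys g \<subseteq> keys d"
    unfolding g_def by (rule keys_mapp_subset)
  have gs: "g \<in> sublattice_of {i \<in> I. ht i < Suc n}"
    using gk Suc.prems(1) keys_neg_part by (auto simp: sublattice_of_def lg split: if_splits dest: subsetD[OF keys_neg_part])
  have gI: "keys g \<subseteq> {i \<in> I. ht i < Suc n}" "keys g \<subseteq> I" "keys d \<subseteq> I"
    using gk Suc.prems(1) by auto
  have \<beta>gI: "keys (\<beta> g) \<subseteq> {i \<in> I. ht i < Suc n}" using \<beta>_keys[OF gI(1)] .
  have minus: "\<beta> (p - r) = \<beta> p - \<beta> r" if "keys p \<subseteq> I" "keys r \<subseteq> I" for p r
    using \<beta>_add[of "p - r" r] that keys_diff_subset[OF that] by simp
  define d' where "d' = d - (g - \<beta> g)"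
  have d'I: "keys d' \<subseteq> {i \<in> I. ht i < Suc n}"
    unfolding d'_def using Suc.prems(1) gI \<beta>gI by (intro keys_diff_subset) auto
  have "lookup d' k = 0" if "ht k = n" for k
  proof -
    have le: "keys d \<subseteq> {i \<in> I. ht i \<le> ht k}" "keys g \<subseteq> {i \<in> I. ht i \<le> ht k}"
      using Suc.prems(1) gI(1) that by auto
    have "lbar (lookup d k) = - lookup d k"
      using \<beta>_top_coeff[OF le(1)] Suc.prems(2) by simp
    from antisymmetric_split[OF this] show ?thesis
      using \<beta>_top_coeff[OF le(2)] that by (simp add: d'_def lookup_minus lg)
  qed
  then have "keys d' \<subseteq> {i \<in> I. ht i < n}"
    using d'I by (force simp: in_keys_iff less_Suc_eq)
  moreover have "\<beta> d' = - d'"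
  proof -
    have "\<beta> d' = \<beta> d - (\<beta> g - \<beta> (\<beta> g))"
      unfolding d'_def using minus[OF gI(3)] minus[OF gI(2)] keys_diff_subset[OF gI(2)] \<beta>gI
      by (metis (no_types, lifting) mem_Collect_eq subset_iff)
    then show ?thesis using Suc.prems(2) \<beta>_\<beta>[OF gI(2)] by (simp add: d'_def)
  qed
  ultimately obtain g' where g': "g' \<in> sublattice_of {i \<in> I. ht i < n}" "g' - \<beta> g' = d'"
    using Suc.IH by blast
  have g's: "g' \<in> sublattice_of {i \<in> I. ht i < Suc n}" using g'(1) by (fastforce simp: sublattice_of_def)
  have "keys g' \<subseteq> I" using g'(1) by (auto simp: sublattice_of_def)
  then have "(g + g') - \<beta> (g + g') = (g - \<beta> g) + (g' - \<beta> g')"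
    using \<beta>_add[OF gI(2)] by simp
  also have "\<dots> = d" unfolding g'(2) d'_def by simp
  finally have "(g + g') - \<beta> (g + g') = d" .
  then show ?case using sublattice_add[OF gs g's] by blast
qed

text \<open>
  With \<open>d = \<beta> e\<^sub>i - e\<^sub>i = g - \<beta> g\<close>, the element \<open>e\<^sub>i + g\<close> is invariant.
\<close>

lemma invariant_exists:
  assumes "i \<in> I"
  shows "\<exists>c. \<beta> c = c \<and> c - single i 1 \<in> sublattice_of {j \<in> I. ht j < ht i}"
proof -
  let ?e = "single i 1 :: 'i \<Rightarrow>\<^sub>0 laurent"
  define d where "d = \<beta> ?e - ?e"
  have e: "keys ?e \<subseteq> I" using assms by simp
  have d: "keys d \<subseteq> {j \<in> I. ht j < ht i}" unfolding d_def using assms by (rule \<beta>_triangular)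
  then have dI: "keys d \<subseteq> I" by auto
  have "\<beta> (d + ?e) = \<beta> d + \<beta> ?e" using dI e by (rule \<beta>_add)
  then have "\<beta> d = - d" using \<beta>_\<beta>[OF e] by (simp add: d_def algebra_simps)
  then obtain g where g: "g \<in> sublattice_of {j \<in> I. ht j < ht i}" "g - \<beta> g = d"
    using antiinvariant_split[OF d] by blast
  have "keys g \<subseteq> I" using g(1) by (auto simp: sublattice_of_def)
  then have "\<beta> (?e + g) = \<beta> ?e + \<beta> g" using e by (intro \<beta>_add)
  also have "\<dots> = ?e + g" using g(2) by (simp add: d_def algebra_simps)
  finally show ?thesis using g(1) by (intro exI[of _ "?e + g"]) simp
qed

lemma unitriangular_top_coeff:
  assumes c: "\<And>i. i \<in> I \<Longrightarrow> c i - single i 1 \<in> sublattice_of {j \<in> I. ht j < ht i}"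
    and p: "keys p \<subseteq> {i \<in> I. ht i \<le> ht k}"
  shows "lookup (pm.lincomb c p) k = lookup p k"
proof -
  have "lookup (pm.lincomb c p) k = (\<Sum>i\<in>keys p. if i = k then lookup p k else 0)"
    unfolding lookup_lincomb
  proof (rule sum.cong)
    fix i assume i: "i \<in> keys p"
    then have "k \<notin> keys (c i - single i 1)"
      using p c[of i] by (fastforce simp: sublattice_of_def)
    then have "lookup (c i) k = lookup (single i 1) k"
      by (simp add: in_keys_iff lookup_minus)
    then show "lookup p i * lookup (c i) k = (if i = k then lookup p k else 0)"
      by (simp add: lookup_single when_def)
  qed simp
  then show ?thesis by (simp add: in_keys_iff)
qed

text \<open>
  Coefficients with respect to \<open>c\<close> are read off at the maximal height, where \<open>c i\<close> and the
  \<open>i\<close>-th basis element agree, and then removed.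
\<close>

lemma unitriangular_basis:
  assumes c: "\<And>i. i \<in> I \<Longrightarrow> c i - single i 1 \<in> sublattice_of {j \<in> I. ht j < ht i}"
  shows "bij_betw (pm.lincomb c) (lattice_of I) (lattice_of I)"
proof -
  have sl: "single i 1 \<in> lattice_of I" if "i \<in> I" for i
    using that by (auto simp: lattice_of_def lookup_single when_def)
  have cl: "c i \<in> lattice_of {j \<in> I. ht j \<le> ht i}" if "i \<in> I" for i
  proof -
    have "c i - single i 1 \<in> lattice_of {j \<in> I. ht j \<le> ht i}"
      using c[OF that] sublattice_lattice by (fastforce simp: lattice_of_def sublattice_of_def)
    moreover have "single i 1 \<in> lattice_of {j \<in> I. ht j \<le> ht i}"
      using that by (auto simp: lattice_of_def lookup_single when_def)
    ultimately have "(c i - single i 1) + single i 1 \<in> lattice_of {j \<in> I. ht j \<le> ht i}"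
      by (rule lattice_add)
    then show ?thesis by simp
  qed
  have clI: "c i \<in> lattice_of I" if "i \<in> I" for i
    using cl[OF that] by (auto simp: lattice_of_def)
  have inj: "p = 0" if p: "keys p \<subseteq> I" "pm.lincomb c p = 0" for p
  proof (rule ccontr)
    assume "p \<noteq> 0"
    then obtain k where k: "k \<in> keys p" "keys p \<subseteq> {i \<in> I. ht i \<le> ht k}"
      using p(1) top_key by blast
    then show False using unitriangular_top_coeff[OF c k(2)] p(2) by (simp add: in_keys_iff)
  qed
  have restrict: "x \<in> lattice_of {i \<in> I. ht i < n}"
    if xl: "x \<in> lattice_of {i \<in> I. ht i \<le> n}" and x0: "\<And>k. ht k = n \<Longrightarrow> lookup x k = 0" for x n
  proof -
    have "i \<in> I \<and> ht i < n" if i: "i \<in> keys x" for i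
    proof -
      have "i \<in> I" "ht i \<le> n" "ht i \<noteq> n"
        using i xl x0[of i] by (auto simp: lattice_of_def in_keys_iff)
      then show ?thesis by simp
    qed
    then show ?thesis using xl by (auto simp: lattice_of_def)
  qed
  have surj: "\<exists>p\<in>lattice_of I. pm.lincomb c p = r" if "r \<in> lattice_of {i \<in> I. ht i < n}" for r n
    using that
  proof (induction n arbitrary: r)
    case 0
    then have "r = 0" by (simp add: lattice_of_def)
    then show ?case by (intro bexI[of _ 0]) (auto simp: lattice_zero)
  next
    case (Suc n)
    define p where "p = Poly_Mapping.mapp (\<lambda>i a. if ht i = n then a else 0) r"
    have lp: "lookup p i = (if ht i = n then lookup r i else 0)" for i
      by (auto simp: p_def lookup_mapp when_def in_keys_iff)
    have pk: "keys p \<subseteq> keys r" unfolding p_def by (rule keys_mapp_subset)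
    have pl: "p \<in> lattice_of {i \<in> I. ht i \<le> n}" "p \<in> lattice_of I"
      using Suc.prems pk by (auto simp: lattice_of_def lp)
    have "pm.lincomb c p \<in> lattice_of {i \<in> I. ht i \<le> n}"
      by (rule lattice_lincomb[OF pl(1)]) (use cl in \<open>fastforce simp: lattice_of_def\<close>)
    moreover have "r \<in> lattice_of {i \<in> I. ht i \<le> n}" using Suc.prems by (auto simp: lattice_of_def less_Suc_eq_le)
    ultimately have "r - pm.lincomb c p \<in> lattice_of {i \<in> I. ht i \<le> n}" by (rule lattice_diff[rotated])
    moreover have "lookup (r - pm.lincomb c p) k = 0" if "ht k = n" for k
      using unitriangular_top_coeff[OF c, of p k] pl(1) that by (simp add: lookup_minus lp lattice_of_def)
    ultimately have "r - pm.lincomb c p \<in> lattice_of {i \<in> I. ht i < n}"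
      using restrict by blast
    then obtain p' where p': "p' \<in> lattice_of I" "pm.lincomb c p' = r - pm.lincomb c p" using Suc.IH by blast
    then have "pm.lincomb c (p + p') = r" by (simp add: pm.lincomb_add)
    then show ?case using lattice_add[OF pl(2) p'(1)] by blast
  qed
  show ?thesis
  proof (rule bij_betw_imageI)
    show "inj_on (pm.lincomb c) (lattice_of I)"
    proof (rule inj_onI)
      fix p r assume "p \<in> lattice_of I" "r \<in> lattice_of I" "pm.lincomb c p = pm.lincomb c r"
      then have "p - r = 0"
        using keys_diff_subset[of p I r] by - (rule inj, simp_all add: lattice_of_def pm.lincomb_diff)
      then show "p = r" by simp
    qed
    show "pm.lincomb c ` lattice_of I = lattice_of I"
    proof
      show "pm.lincomb c ` lattice_of I \<subseteq> lattice_of I" using lattice_lincomb[of _ I c I] clI by auto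
      show "lattice_of I \<subseteq> pm.lincomb c ` lattice_of I"
      proof (rule subsetI)
        fix r assume r: "r \<in> lattice_of I"
        define n where "n = Suc (Max (insert 0 (ht ` keys r)))"
        have "ht i < n" if "i \<in> keys r" for i
          unfolding n_def less_Suc_eq_le using that by (intro Max_ge) auto
        then have "r \<in> lattice_of {i \<in> I. ht i < n}" using r by (auto simp: lattice_of_def)
        from surj[OF this] show "r \<in> pm.lincomb c ` lattice_of I" by auto
      qed
    qed
  qed
qed

end

section \<open>The Hecke algebra inside the representation\<close>

definition pbar :: "('i \<Rightarrow>\<^sub>0 laurent) \<Rightarrow> ('i \<Rightarrow>\<^sub>0 laurent)"
  where "pbar = Poly_Mapping.map lbar"

lemma lookup_pbar [simp]: "lookup (pbar p) k = lbar (lookup p k)"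
  by (simp add: pbar_def map.rep_eq when_def)

lemma pbar_zero [simp]: "pbar 0 = 0"
  by (rule poly_mapping_eqI) simp

lemma pbar_add: "pbar (p + r) = pbar p + pbar r"
  by (rule poly_mapping_eqI) (simp add: lookup_add lbar_add)

lemma pbar_scal: "pbar (scal a p) = scal (lbar a) (pbar p)"
  by (rule poly_mapping_eqI) (simp add: lbar_mult)

lemma pbar_single: "pbar (single w a) = single w (lbar a)"
  by (rule poly_mapping_eqI) (simp add: lookup_single when_def)

sublocale hecke_rep \<subseteq> coefficient_module scale
  by unfold_locales

context hecke_rep
begin

text \<open>The Hecke algebra itself, within a ring that may be larger.\<close>

definition H_all :: "'r set"
  where "H_all = span (\<tau> ` carrier W)"

lemma \<tau>_in_H_all: "w \<in> carrier W \<Longrightarrow> \<tau> w \<in> H_all"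
  unfolding H_all_def by (rule span_base) simp

lemma H_all_closed: "0 \<in> H_all" "x \<in> H_all \<Longrightarrow> y \<in> H_all \<Longrightarrow> x + y \<in> H_all"
  "x \<in> H_all \<Longrightarrow> y \<in> H_all \<Longrightarrow> x - y \<in> H_all" "x \<in> H_all \<Longrightarrow> a *s x \<in> H_all"
  unfolding H_all_def by (simp_all add: span_zero span_add span_diff span_scale)

lemma H_lt_H_all: "x \<in> H_lt n \<Longrightarrow> x \<in> H_all"
  unfolding H_all_def H_lt_def by (erule subsetD[OF span_mono, rotated]) auto

lemma H_all_H_lt:
  assumes "x \<in> H_all"
  obtains n where "x \<in> H_lt n"
proof -
  obtain p where p: "keys p \<subseteq> carrier W" "x = lincomb \<tau> p"
    using assms unfolding H_all_def by (rule span_lincomb)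
  define n where "n = Suc (Max (insert 0 (len ` keys p)))"
  have "len w < n" if "w \<in> keys p" for w
    unfolding n_def less_Suc_eq_le using that by (intro Max_ge) auto
  then have "lincomb \<tau> p \<in> H_lt n" unfolding H_lt_def
    using p(1) by (intro lincomb_in_span span_base) blast
  then show thesis using that p(2) by blast
qed

lemma TT_H_all: "xs \<in> lists S \<Longrightarrow> TT xs \<in> H_all"
  using TT_in_H_lt[of xs "Suc (length xs)"] H_lt_H_all by blast

lemma H_all_mult:
  assumes "x \<in> H_all" "y \<in> H_all"
  shows "x * y \<in> H_all"
  using assms(1) unfolding H_all_def
proof (rule span_mult_right)
  fix u assume "u \<in> \<tau> ` carrier W"
  then obtain w where "w \<in> carrier W" "u = \<tau> w" by blast
  then obtain xs where xs: "xs \<in> lists S" "u = TT xs" using \<tau>_word[of w] by metis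
  obtain n where "y \<in> H_lt n" using assms(2) by (rule H_all_H_lt)
  then have "u * y \<in> H_all" using TT_H_lt[OF xs(1)] xs(2) H_lt_H_all by blast
  then show "u * y \<in> span (\<tau> ` carrier W)" by (simp add: H_all_def)
qed

lemma H_all_Te: "x \<in> H_all \<Longrightarrow> Te * x = x" "x \<in> H_all \<Longrightarrow> x * Te = x"
  using H_all_H_lt H_lt_Te by metis+

lemma co_lincomb:
  "lookup (co (lincomb f p)) w =
    (\<Sum>i\<in>keys p. lookup p i * lookup (co (f i)) w)"
  by (simp add: lincomb_def co_sum lookup_sum co_scale)

lemma co_lincomb_\<tau>:
  assumes "keys p \<subseteq> carrier W"
  shows "co (lincomb \<tau> p) = p"
proof (rule poly_mapping_eqI)
  fix w
  have "lookup (co (lincomb \<tau> p)) w = (\<Sum>i\<in>keys p. if i = w then lookup p w else 0)"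
    unfolding co_lincomb using assms by (intro sum.cong) (auto simp: co_\<tau> lookup_single when_def subset_iff)
  then show "lookup (co (lincomb \<tau> p)) w = lookup p w"
    by (simp add: in_keys_iff)
qed

lemma H_all_induct [consumes 1, case_names zero step]:
  assumes "x \<in> H_all" "P 0"
    "\<And>a w y. w \<in> carrier W \<Longrightarrow> y \<in> H_all \<Longrightarrow> P y \<Longrightarrow> P (a *s \<tau> w + y)"
  shows "P x"
proof -
  have "x \<in> H_all \<and> P x"
    using assms(1) unfolding H_all_def
  proof (induction rule: span_induct_alt)
    case base
    then show ?case using assms(2) by (simp add: span_zero)
  next
    case (step a u y)
    then obtain w where "w \<in> carrier W" "u = \<tau> w" by blast
    then show ?case using assms(3)[of w y a] step \<tau>_in_H_all[of w] H_all_closed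
      by (simp add: H_all_def)
  qed
  then show ?thesis by blast
qed

definition J_all :: "'r set"
  where "J_all = (\<Union>n. J_lt n)"

lemma J_all_closed: "0 \<in> J_all" "x \<in> J_all \<Longrightarrow> y \<in> J_all \<Longrightarrow> x + y \<in> J_all" "x \<in> J_all \<Longrightarrow> y \<in> J_all \<Longrightarrow> x - y \<in> J_all"
  "x \<in> J_all \<Longrightarrow> - x \<in> J_all" "x \<in> J_all \<Longrightarrow> a *s x \<in> J_all"
proof -
  show "x + y \<in> J_all" if xy: "x \<in> J_all" "y \<in> J_all" for x y
  proof -
    obtain i j where "x \<in> J_lt i" "y \<in> J_lt j" using xy by (auto simp: J_all_def)
    then have "x \<in> J_lt (max i j)" "y \<in> J_lt (max i j)" by (auto elim: J_lt_mono)
    then show ?thesis using J_lt_add unfolding J_all_def by blast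
  qed
  note add = this
  show neg: "- x \<in> J_all" if "x \<in> J_all" for x using that J_lt_minus by (auto simp: J_all_def)
  show "x - y \<in> J_all" if "x \<in> J_all" "y \<in> J_all" for x y using add[OF that(1) neg[OF that(2)]] by simp
qed (auto simp: J_all_def intro: J_lt_scale)

lemma TT_J_all: "xs \<in> lists S \<Longrightarrow> x \<in> J_all \<Longrightarrow> TT xs * x \<in> J_all"
  and J_all_TT: "xs \<in> lists S \<Longrightarrow> x \<in> J_all \<Longrightarrow> x * TT xs \<in> J_all"
  by (auto simp: J_all_def dest: TT_J_lt J_lt_TT)

lemma H_all_J_all:
  assumes "h \<in> H_all" "x \<in> J_all"
  shows "h * x \<in> J_all"
  using assms(1)
proof (induction rule: H_all_induct)
  case (step a w y)
  obtain xs where "xs \<in> lists S" "\<tau> w = TT xs" using step.hyps(1) \<tau>_word by metis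
  then have "\<tau> w * x \<in> J_all" using TT_J_all assms(2) by simp
  then show ?case using step by (simp add: distrib_right scale_mult_left J_all_closed)
qed (simp add: J_all_closed)

lemma J_all_H_all_mult:
  assumes "h \<in> H_all" "x \<in> J_all"
  shows "x * h \<in> J_all"
  using assms(1)
proof (induction rule: H_all_induct)
  case (step a w y)
  obtain xs where "xs \<in> lists S" "\<tau> w = TT xs" using step.hyps(1) \<tau>_word by metis
  then have "x * \<tau> w \<in> J_all" using J_all_TT assms(2) by simp
  then show ?case using step by (simp add: distrib_left scale_mult_right J_all_closed)
qed (simp add: J_all_closed)

lemma E_J_all: "bond s t k \<Longrightarrow> E s t \<in> J_all"
  using J_lt_gen[of "[]" "[]" s t k "Suc k"] E_Te[of s t k] Te_E[of s t k] unfolding J_all_def by (auto simp: mult.assoc)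

section \<open>The bar involution of the Hecke algebra\<close>

text \<open>
  The inverse of \<open>Tg s\<close>, which is also its image under the bar involution.
\<close>

definition Tg_bar :: "'s \<Rightarrow> 'r"
  where "Tg_bar s = v_pow (- 2) *s Tg s + (v_pow (- 2) - 1) *s Te"

fun TT_bar :: "'s list \<Rightarrow> 'r" where
  "TT_bar [] = Te"
| "TT_bar (s # xs) = Tg_bar s * TT_bar xs"

lemma q_inv: "v_pow (- 2) * q = 1" "q * v_pow (- 2) = 1"
  by (simp_all add: v_pow_mult)

lemma Tg_bar_Tg: "s \<in> S \<Longrightarrow> Tg_bar s * Tg s = Te" and Tg_Tg_bar: "s \<in> S \<Longrightarrow> Tg s * Tg_bar s = Te"
  by (simp_all add: Tg_bar_def distrib_left distrib_right scale_mult_left scale_mult_right Tg_square)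
    (simp_all add: scale_right_distrib scale_right_diff_distrib right_diff_distrib q_inv scale_left_diff_distrib)

lemma Te_Tg_bar: "s \<in> S \<Longrightarrow> Te * Tg_bar s = Tg_bar s" and Tg_bar_Te: "s \<in> S \<Longrightarrow> Tg_bar s * Te = Tg_bar s"
  by (simp_all add: Tg_bar_def distrib_left distrib_right scale_mult_left scale_mult_right)

lemma Tg_eq: "s \<in> S \<Longrightarrow> Tg s = q *s Tg_bar s + (q - 1) *s Te"
  by (simp add: Tg_bar_def scale_right_distrib scale_right_diff_distrib q_inv right_diff_distrib scale_left_diff_distrib)

lemma Tg_bar_square: "s \<in> S \<Longrightarrow> Tg_bar s * Tg_bar s = v_pow (- 2) *s Te + (v_pow (- 2) - 1) *s Tg_bar s"
proof -
  assume s: "s \<in> S"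
  have "Tg_bar s * Tg_bar s = Tg_bar s * (v_pow (- 2) *s Tg s + (v_pow (- 2) - 1) *s Te)" by (simp add: Tg_bar_def)
  also have "\<dots> = v_pow (- 2) *s Te + (v_pow (- 2) - 1) *s Tg_bar s"
    using s by (simp add: distrib_left scale_mult_right Tg_bar_Tg Tg_bar_Te)
  finally show ?thesis .
qed

lemma Te_TT_bar: "xs \<in> lists S \<Longrightarrow> Te * TT_bar xs = TT_bar xs"
  by (cases xs) (auto simp: Te_Tg_bar simp flip: mult.assoc)

lemma TT_bar_append: "ys \<in> lists S \<Longrightarrow> TT_bar (xs @ ys) = TT_bar xs * TT_bar ys"
  by (induction xs) (auto simp: mult.assoc Te_TT_bar)

lemma TT_bar_TT_rev: "xs \<in> lists S \<Longrightarrow> TT_bar xs * TT (rev xs) = Te"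
proof (induction xs)
  case (Cons s xs)
  have "TT_bar (s # xs) * TT (rev (s # xs)) = Tg_bar s * (TT_bar xs * TT (rev xs)) * Tg s"
    using Cons.prems by (simp add: TT_append mult.assoc)
  then show ?case using Cons by (simp add: Tg_bar_Te Tg_bar_Tg)
qed simp

lemma TT_TT_bar_rev: "xs \<in> lists S \<Longrightarrow> TT xs * TT_bar (rev xs) = Te"
proof (induction xs)
  case (Cons s xs)
  have "TT (s # xs) * TT_bar (rev (s # xs)) = Tg s * (TT xs * TT_bar (rev xs)) * Tg_bar s"
    using Cons.prems Tg_bar_Te by (simp add: TT_bar_append mult.assoc)
  then show ?case using Cons by (simp add: Tg_Tg_bar)
qed simp

lemma Tg_bar_H_lt: "s \<in> S \<Longrightarrow> x \<in> H_lt n \<Longrightarrow> Tg_bar s * x \<in> H_lt (Suc n)"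
  using Tg_H_lt[of s x n] H_lt_mono[of x n "Suc n"]
  by (simp add: Tg_bar_def distrib_right scale_mult_left H_lt_Te) (simp add: H_lt_def span_add span_scale)

lemma TT_bar_in_H_lt: "xs \<in> lists S \<Longrightarrow> TT_bar xs \<in> H_lt (Suc (length xs))"
  by (induction xs) (auto simp: \<tau>_in_H_lt Tg_bar_H_lt)

lemma TT_bar_H_all: "xs \<in> lists S \<Longrightarrow> TT_bar xs \<in> H_all"
  using TT_bar_in_H_lt H_lt_H_all by blast

lemma TT_bar_Te: "xs \<in> lists S \<Longrightarrow> TT_bar xs * Te = TT_bar xs"
  using TT_bar_H_all H_all_Te by blast

definition \<tau>bar :: "'s list set \<Rightarrow> 'r"
  where "\<tau>bar w = TT_bar (SOME xs. reduced xs \<and> word_class xs = w)"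

text \<open>
  The product along \<open>xs\<close> of inverse generators is the inverse of \<open>\<tau> (w\<^sup>-\<^sup>1)\<close>, and so depends
  only on the element \<open>w\<close> represented by \<open>xs\<close>.
\<close>

lemma \<tau>bar_reduced:
  assumes "reduced xs"
  shows "\<tau>bar (word_class xs) = TT_bar xs"
proof -
  define ys where "ys = (SOME ys. reduced ys \<and> word_class ys = word_class xs)"
  have "reduced ys \<and> word_class ys = word_class xs"
    unfolding ys_def using assms by (intro someI) auto
  then have ys: "reduced ys" "word_eq ys xs" "ys \<in> lists S" "xs \<in> lists S"
    using assms reduced_lists word_class_eq_iff by blast+
  have "word_class (rev ys) = word_class (rev xs)"
    using word_eq_rev[OF ys(2)] ys by (simp add: word_class_eq_iff)
  then have "TT (rev ys) = TT (rev xs)"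
    using TT_reduced assms ys(1) by (simp add: reduced_rev)
  then have "TT_bar ys * TT (rev xs) = Te" using TT_bar_TT_rev[OF ys(3)] by simp
  then have "TT_bar ys * (TT (rev xs) * TT_bar xs) = Te * TT_bar xs" by (simp flip: mult.assoc)
  then have "TT_bar ys = TT_bar xs"
    using TT_TT_bar_rev[of "rev xs"] ys TT_bar_Te[OF ys(3)] Te_TT_bar[OF ys(4)] by simp
  then show ?thesis by (simp add: \<tau>bar_def ys_def)
qed

definition hbar :: "'r \<Rightarrow> 'r"
  where "hbar x = lincomb \<tau>bar (pbar (co x))"

lemma co_scal: "co (a *s x) = scal a (co x)"
  by (rule poly_mapping_eqI) (simp add: co_scale)

lemma hbar_add: "hbar (x + y) = hbar x + hbar y"
  by (simp add: hbar_def co_add pbar_add lincomb_add)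

lemma hbar_scale: "hbar (a *s x) = lbar a *s hbar x"
  by (simp add: hbar_def co_scal pbar_scal lincomb_scal)

lemma hbar_\<tau>: "w \<in> carrier W \<Longrightarrow> hbar (\<tau> w) = \<tau>bar w"
  by (simp add: hbar_def co_\<tau> pbar_single)

lemma hbar_zero [simp]: "hbar 0 = 0"
  by (simp add: hbar_def)

lemma hbar_diff: "hbar (x - y) = hbar x - hbar y"
  using hbar_add[of "x - y" y] by simp

lemma hbar_TT_reduced: "reduced xs \<Longrightarrow> hbar (TT xs) = TT_bar xs"
  using hbar_\<tau>[of "word_class xs"] reduced_lists[of xs] by (simp add: TT_reduced \<tau>bar_reduced)

lemma hbar_Te [simp]: "hbar Te = Te"
  using hbar_TT_reduced[of "[]"] by simp

lemma hbar_H_all: "x \<in> H_all \<Longrightarrow> hbar x \<in> H_all"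
proof (induction rule: H_all_induct)
  case (step a w y)
  obtain xs where "reduced xs" "word_class xs = w" using step.hyps(1) by (rule reduced_exists)
  then have "hbar (\<tau> w) \<in> H_all"
    using hbar_\<tau>[OF step.hyps(1)] \<tau>bar_reduced TT_bar_H_all reduced_lists by metis
  then show ?case using step by (simp add: hbar_add hbar_scale H_all_closed)
qed (simp add: H_all_closed)

text \<open>
  The inverse of \<open>T\<^sub>s\<close> satisfies the quadratic relation with \<open>q\<^sup>-\<^sup>1\<close> in the place of \<open>q\<close>.
\<close>

lemma hbar_Tg_mult:
  assumes "s \<in> S" "x \<in> H_all"
  shows "hbar (Tg s * x) = Tg_bar s * hbar x"
  using assms(2)
proof (induction rule: H_all_induct)
  case (step a w y)
  obtain xs where xs: "reduced xs" "word_class xs = w" using step.hyps(1) by (rule reduced_exists)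
  have xl: "xs \<in> lists S" using xs reduced_lists by blast
  have "hbar (Tg s * \<tau> w) = Tg_bar s * \<tau>bar w"
  proof (cases "reduced (s # xs)")
    case True
    then have "Tg s * \<tau> w = \<tau> (word_class (s # xs))"
      using \<tau>_up[OF assms(1) xl] xs by (auto simp: reduced_def)
    then show ?thesis using xs True \<tau>bar_reduced[OF xs(1)] \<tau>bar_reduced[OF True]
      hbar_\<tau>[of "word_class (s # xs)"] assms(1) xl by simp
  next
    case False
    obtain ys where ys: "reduced ys" "word_class ys = word_class (s # xs)"
      using reduced_exists[of "word_class (s # xs)"] assms(1) xl by auto
    have yl: "ys \<in> lists S" using ys reduced_lists by blast
    have down: "len w = len (word_class (s # xs)) + 1"
      using len_Cons[OF assms(1) xl] False xs assms(1) xl by (auto simp: reduced_def)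
    have "word_eq (s # ys) (s # s # xs)"
    proof -
      have "word_eq ys (s # xs)" using ys yl by (simp add: word_class_eq_iff)
      then show ?thesis using word_eq_append_context[of ys "s # xs" "[s]" "[]"] assms(1) by simp
    qed
    then have "word_eq (s # ys) xs"
      using word_eq_cancel_square[of s "[]" xs] assms(1) xl word_eq.trans by fastforce
    then have syw: "word_class (s # ys) = w"
      using xs(2) assms(1) yl word_class_eq_iff[of "s # ys" xs] by simp
    have sy: "reduced (s # ys)"
      using syw down ys assms(1) yl by (simp add: reduced_def)
    have bw: "\<tau>bar w = Tg_bar s * TT_bar ys" using \<tau>bar_reduced[OF sy] syw by simp
    have "Tg s * \<tau> w = q *s \<tau> (word_class ys) + (q - 1) *s \<tau> w"
      using \<tau>_down[OF assms(1) xl] down xs ys by simp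
    then have "hbar (Tg s * \<tau> w) = v_pow (- 2) *s TT_bar ys + (v_pow (- 2) - 1) *s (Tg_bar s * TT_bar ys)"
      using hbar_\<tau>[OF step.hyps(1)] hbar_\<tau>[of "word_class ys"] yl \<tau>bar_reduced[OF ys(1)] bw
      by (simp add: hbar_add hbar_scale lbar_diff)
    also have "\<dots> = (Tg_bar s * Tg_bar s) * TT_bar ys"
      using Tg_bar_square[OF assms(1)] Te_TT_bar[OF yl] by (simp add: distrib_right scale_mult_left)
    finally show ?thesis using bw by (simp add: mult.assoc)
  qed
  then have "hbar (Tg s * \<tau> w) = Tg_bar s * hbar (\<tau> w)" using hbar_\<tau>[OF step.hyps(1)] by simp
  then show ?case using step by (simp add: distrib_left scale_mult_right hbar_add hbar_scale)
qed simp

lemma hbar_TT_mult: "xs \<in> lists S \<Longrightarrow> x \<in> H_all \<Longrightarrow> hbar (TT xs * x) = TT_bar xs * hbar x"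
proof (induction xs)
  case Nil
  then show ?case using H_all_Te(1) hbar_H_all by simp
next
  case (Cons s xs)
  then have "TT xs * x \<in> H_all" using H_all_mult TT_H_all by simp
  then show ?case using Cons hbar_Tg_mult by (simp add: mult.assoc)
qed

lemma hbar_TT: "xs \<in> lists S \<Longrightarrow> hbar (TT xs) = TT_bar xs"
  using hbar_TT_mult[of xs Te] \<tau>_in_H_all[of "word_class []"] TT_bar_Te by simp

lemma hbar_mult:
  assumes "x \<in> H_all" "y \<in> H_all"
  shows "hbar (x * y) = hbar x * hbar y"
  using assms(1)
proof (induction rule: H_all_induct)
  case (step a w z)
  obtain xs where xs: "xs \<in> lists S" "\<tau> w = TT xs" using step.hyps(1) \<tau>_word by metis
  then have "hbar (\<tau> w * y) = hbar (\<tau> w) * hbar y"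
    using hbar_TT_mult assms(2) hbar_TT by simp
  then show ?case using step by (simp add: distrib_right scale_mult_left hbar_add hbar_scale)
qed simp

lemma hbar_Tg_bar: "s \<in> S \<Longrightarrow> hbar (Tg_bar s) = Tg s"
proof -
  assume s: "s \<in> S"
  have "hbar (Tg s) = Tg_bar s" using hbar_TT[of "[s]"] s Tg_bar_Te by simp
  then have "hbar (Tg_bar s) = q *s Tg_bar s + (q - 1) *s Te"
    by (subst Tg_bar_def) (simp add: hbar_add hbar_scale lbar_diff)
  then show ?thesis using Tg_eq[OF s] by simp
qed

lemma hbar_TT_bar: "xs \<in> lists S \<Longrightarrow> hbar (TT_bar xs) = TT xs"
proof (induction xs)
  case (Cons s xs)
  have "Tg_bar s \<in> H_all" using TT_bar_H_all[of "[s]"] Cons Tg_bar_Te by simp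
  then show ?case using Cons hbar_mult TT_bar_H_all hbar_Tg_bar by simp
qed simp

lemma hbar_hbar: "x \<in> H_all \<Longrightarrow> hbar (hbar x) = x"
proof (induction rule: H_all_induct)
  case (step a w y)
  obtain xs where xs: "xs \<in> lists S" "\<tau> w = TT xs" using step.hyps(1) \<tau>_word by metis
  then show ?case using step by (simp add: hbar_add hbar_scale hbar_TT hbar_TT_bar)
qed simp

lemma hbar_\<tau>_inverse:
  assumes "w \<in> carrier W"
  shows "hbar (\<tau> w) * \<tau> (inv\<^bsub>W\<^esub> w) = Te" "\<tau> (inv\<^bsub>W\<^esub> w) * hbar (\<tau> w) = Te"
proof -
  obtain xs where xs: "reduced xs" "word_class xs = w" using assms by (rule reduced_exists)
  then have xl: "xs \<in> lists S" using reduced_lists by blast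
  have "\<tau> (inv\<^bsub>W\<^esub> w) = TT (rev xs)"
    using xs xl TT_reduced[of "rev xs"] by (auto simp: inv_word_class reduced_rev)
  moreover have "hbar (\<tau> w) = TT_bar xs" using hbar_TT[OF xl] TT_reduced[OF xs(1)] xs(2) by simp
  ultimately show "hbar (\<tau> w) * \<tau> (inv\<^bsub>W\<^esub> w) = Te" "\<tau> (inv\<^bsub>W\<^esub> w) * hbar (\<tau> w) = Te"
    using TT_bar_TT_rev[OF xl] TT_TT_bar_rev[of "rev xs"] xl by simp_all
qed

lemma TT_bar_top:
  "xs \<in> lists S \<Longrightarrow> TT_bar xs - v_pow (- 2 * int (length xs)) *s TT xs \<in> H_lt (length xs)"
proof (induction xs)
  case (Cons s xs)
  define h where "h = TT_bar xs - v_pow (- 2 * int (length xs)) *s TT xs"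
  have h: "h \<in> H_lt (length xs)" "TT_bar xs = v_pow (- 2 * int (length xs)) *s TT xs + h"
    using Cons by (simp_all add: h_def)
  have vp: "v_pow (- 2) * v_pow (- 2 * int (length xs)) = v_pow (- 2 * int (length (s # xs)))"
    by (simp add: v_pow_mult algebra_simps)
  have "TT_bar (s # xs) = v_pow (- 2) *s (Tg s * TT_bar xs) + (v_pow (- 2) - 1) *s TT_bar xs"
    using Cons Te_TT_bar by (simp add: Tg_bar_def distrib_right scale_mult_left)
  also have "v_pow (- 2) *s (Tg s * TT_bar xs) =
      v_pow (- 2 * int (length (s # xs))) *s TT (s # xs) + v_pow (- 2) *s (Tg s * h)"
    unfolding h(2) by (simp only: distrib_left scale_mult_right scale_right_distrib scale_scale vp TT.simps)
  finally have "TT_bar (s # xs) - v_pow (- 2 * int (length (s # xs))) *s TT (s # xs) =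
    v_pow (- 2) *s (Tg s * h) + (v_pow (- 2) - 1) *s TT_bar xs" by simp
  moreover have "Tg s * h \<in> H_lt (length (s # xs))" using Tg_H_lt[OF _ h(1)] Cons by simp
  moreover have "TT_bar xs \<in> H_lt (length (s # xs))" using TT_bar_in_H_lt Cons by simp
  ultimately show ?case by (simp add: H_lt_def span_add span_scale)
qed (simp add: H_lt_def span_zero)

section \<open>The bar involution preserves the ideal\<close>

text \<open>
  For \<open>sw > w\<close>, the basis element \<open>T\<^bsub>sw\<^esub>\<close> arises from \<open>T\<^sub>s T\<^sub>w\<close> and from \<open>T\<^sub>s T\<^bsub>sw\<^esub>\<close> only.
\<close>

lemma co_Tg_mult_up:
  assumes s: "s \<in> S" and xs: "xs \<in> lists S" and up: "len (word_class xs) < len (word_class (s # xs))"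
    and x: "x \<in> H_all"
  shows "lookup (co (Tg s * x)) (word_class (s # xs)) =
    lookup (co x) (word_class xs) + (q - 1) * lookup (co x) (word_class (s # xs))"
  using x
proof (induction rule: H_all_induct)
  case (step a w y)
  obtain ys where ys: "ys \<in> lists S" "word_class ys = w" using step.hyps(1) by (auto simp: carrier_W)
  have swap: "word_class (s # us) = word_class vs \<longleftrightarrow> word_class us = word_class (s # vs)"
    if l: "us \<in> lists S" "vs \<in> lists S" for us vs
  proof -
    have *: "word_class us = word_class (s # vs)"
      if "word_class (s # us) = word_class vs" "us \<in> lists S" "vs \<in> lists S" for us vs
    proof -
      have "word_eq (s # us) vs" using that s by (simp add: word_class_eq_iff)
      then have "word_eq (s # s # us) (s # vs)"
        using s word_eq_append_context[of "s # us" vs "[s]" "[]"] by simp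
      then have "word_class (s # s # us) = word_class (s # vs)" using that s by (simp add: word_class_eq_iff)
      moreover have "word_class (s # s # us) = word_class us"
        using word_eq_cancel_square[of s "[]" us] that s by (simp add: word_class_eq_iff)
      ultimately show ?thesis by simp
    qed
    show ?thesis using *[of us vs] *[of vs us] l by auto
  qed
  have ne: "word_class (s # xs) \<noteq> word_class xs" using up by auto
  have sxs: "word_class (s # s # xs) = word_class xs"
    using swap[of "s # xs" xs] s xs by simp
  have "lookup (co (Tg s * \<tau> w)) (word_class (s # xs)) =
    lookup (co (\<tau> w)) (word_class xs) + (q - 1) * lookup (co (\<tau> w)) (word_class (s # xs))"
  proof (cases "len w < len (word_class (s # ys))")
    case True
    then have T: "Tg s * \<tau> w = \<tau> (word_class (s # ys))" using \<tau>_up[OF s ys(1)] ys(2) by simp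
    have "w \<noteq> word_class (s # xs)" using True up ys sxs swap[of ys xs] s xs by auto
    moreover have "word_class (s # ys) = word_class (s # xs) \<longleftrightarrow> w = word_class xs"
      using swap[of ys "s # xs"] s xs ys sxs by simp
    ultimately show ?thesis using T step.hyps(1) s ys(1) by (simp add: co_\<tau> lookup_single when_def)
  next
    case False
    then have l: "len (word_class (s # ys)) < len w" using len_Cons[OF s ys(1)] ys(2) by auto
    then have T: "Tg s * \<tau> w = q *s \<tau> (word_class (s # ys)) + (q - 1) *s \<tau> w"
      using \<tau>_down[OF s ys(1)] ys(2) by simp
    have "w \<noteq> word_class xs"
    proof
      assume "w = word_class xs"
      then have "word_class (s # ys) = word_class (s # xs)" using swap[of ys "s # xs"] s xs ys sxs by simp
      then show False using l up \<open>w = word_class xs\<close> by simp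
    qed
    moreover have "word_class (s # ys) \<noteq> word_class (s # xs)"
      using calculation swap[of ys "s # xs"] s xs ys sxs by simp
    ultimately show ?thesis using T step.hyps(1) s ys(1)
      by (simp add: co_add lookup_add co_scale co_\<tau> lookup_single when_def)
  qed
  then show ?case using step
    by (simp add: distrib_left scale_mult_right co_add lookup_add co_scale)
qed simp

lemma eigen_coeff:
  assumes "s \<in> S" "xs \<in> lists S" "y \<in> H_all" "Tg s * y = q *s y"
  shows "lookup (co y) (word_class (s # xs)) = lookup (co y) (word_class xs)"
proof -
  have *: "lookup (co y) (word_class (s # xs)) = lookup (co y) (word_class xs)"
    if "len (word_class xs) < len (word_class (s # xs))" "xs \<in> lists S" for xs
    using co_Tg_mult_up[OF assms(1) that(2,1) assms(3)] assms(4) by (simp add: co_scale algebra_simps)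
  show ?thesis
    using len_Cons[OF assms(1,2)]
  proof
    assume "len (word_class xs) = len (word_class (s # xs)) + 1"
    moreover have "word_class (s # s # xs) = word_class xs"
      using word_eq_cancel_square[of s "[]" xs] assms by (simp add: word_class_eq_iff)
    ultimately show ?thesis using *[of "s # xs"] assms by simp
  qed (use * assms in simp)
qed

text \<open>
  Conjugating \<open>T\<^sub>c E = q E\<close> shows that the image \<open>y\<close> of \<open>E\<close> satisfies \<open>T\<^sub>c y = q y\<close> as well,
  for both generators \<open>c\<close>. It lies in the span \<open>Q\<close> of the basis elements of the parabolic
  subgroup, and by \<open>eigen_coeff\<close> all its coefficients there are equal.
\<close>

lemma hbar_E:
  assumes bond: "bond s t k"
  shows "\<exists>a. hbar (E s t) = a *s E s t"
proof -
  let ?P = "parabolic s t"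
  define y where "y = hbar (E s t)"
  have st: "s \<in> S" "t \<in> S" using bond by (auto simp: bond_def)
  have EH: "E s t \<in> H_all" using E_in_H_lt[OF bond] H_lt_H_all by blast
  have yH: "y \<in> H_all" unfolding y_def using EH hbar_H_all by blast
  have eigen: "Tg c * y = q *s y" if c: "c = s \<or> c = t" for c
  proof -
    have cS: "c \<in> S" using c st by blast
    have "Tg_bar c * y = hbar (Tg c * E s t)" unfolding y_def using hbar_Tg_mult[OF cS EH] by simp
    also have "\<dots> = v_pow (- 2) *s y" using Tg_E[OF bond c] by (simp add: hbar_scale y_def)
    finally have "Tg c * (Tg_bar c * y) = v_pow (- 2) *s (Tg c * y)" by (simp add: scale_mult_right)
    then have "y = v_pow (- 2) *s (Tg c * y)"
      using Tg_Tg_bar[OF cS] H_all_Te(1)[OF yH] by (simp flip: mult.assoc)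
    then have "q *s y = (q * v_pow (- 2)) *s (Tg c * y)" by (metis scale_scale)
    then show ?thesis by (simp add: q_inv)
  qed
  define Q where "Q = span (\<tau> ` ?P)"
  have TgQ: "Tg c * x \<in> Q" if c: "c = s \<or> c = t" and x: "x \<in> Q" for c x
    using x unfolding Q_def
  proof (rule span_mult_left)
    fix u assume "u \<in> \<tau> ` ?P"
    then obtain xs where xs: "xs \<in> lists {s, t}" "u = \<tau> (word_class xs)"
      using parabolic_words[OF st] by auto
    have xl: "xs \<in> lists S" using xs st by (auto simp: in_lists_conv_set)
    have cS: "c \<in> S" using c st by blast
    have *: "\<tau> (word_class (c # xs)) \<in> span (\<tau> ` ?P)" "u \<in> span (\<tau> ` ?P)"
      using xs c parabolic_words[OF st] by (auto intro!: span_base imageI)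
    show "Tg c * u \<in> span (\<tau> ` ?P)"
      using len_Cons[OF cS xl] \<tau>_up[OF cS xl] \<tau>_down[OF cS xl] * xs(2)
      by (auto simp: span_add span_scale)
  qed
  have TT_barQ: "TT_bar xs \<in> Q" if "xs \<in> lists {s, t}" for xs
    using that
  proof (induction xs)
    case Nil
    show ?case unfolding Q_def
      using parabolic_words[OF st] by (auto intro!: span_base imageI)
  next
    case (Cons c xs)
    have "xs \<in> lists S" using Cons st by (auto simp: in_lists_conv_set)
    then have "TT_bar (c # xs) = v_pow (- 2) *s (Tg c * TT_bar xs) + (v_pow (- 2) - 1) *s TT_bar xs"
      using Te_TT_bar by (simp add: Tg_bar_def distrib_right scale_mult_left)
    moreover have "Tg c * TT_bar xs \<in> Q" using TgQ Cons by auto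
    ultimately show ?case using Cons unfolding Q_def by (simp add: span_add span_scale)
  qed
  have "hbar (\<tau> w) \<in> Q" if w: "w \<in> ?P" for w
  proof -
    obtain xs where xs: "xs \<in> lists {s, t}" "reduced xs" "w = word_class xs"
      by (rule bond_parabolic_word[OF bond w])
    then show ?thesis using hbar_TT_reduced[OF xs(2)] TT_reduced[OF xs(2)] TT_barQ[OF xs(1)] by simp
  qed
  moreover have "hbar (\<Sum>w\<in>A. \<tau> w) = (\<Sum>w\<in>A. hbar (\<tau> w))" for A
    by (induction A rule: infinite_finite_induct) (simp_all add: hbar_add)
  ultimately have "y \<in> Q" unfolding y_def E_def Q_def by (simp add: span_sum)
  then obtain p where p: "keys p \<subseteq> ?P" "y = lincomb \<tau> p"
    unfolding Q_def by (rule span_lincomb)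
  have "keys p \<subseteq> carrier W" using p(1) bond_parabolic_carrier[OF bond] by blast
  then have cop: "co y = p" using p(2) co_lincomb_\<tau> by simp
  have coeff: "lookup (co y) (word_class xs) = lookup (co y) (word_class [])"
    if "xs \<in> lists {s, t}" for xs
    using that
  proof (induction xs)
    case (Cons c xs)
    moreover have "xs \<in> lists S" using Cons st by (auto simp: in_lists_conv_set)
    ultimately show ?case using eigen_coeff[of c xs y] eigen[of c] st yH by auto
  qed simp
  have "y = (\<Sum>w\<in>?P. lookup p w *s \<tau> w)"
    using lincomb_superset[OF bond_finite_parabolic[OF bond] p(1), of \<tau>] p(2) by simp
  also have "\<dots> = (\<Sum>w\<in>?P. lookup p (word_class []) *s \<tau> w)"
  proof (rule sum.cong)
    fix w assume "w \<in> ?P"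
    then obtain xs where "xs \<in> lists {s, t}" "w = word_class xs" using parabolic_words[OF st] by auto
    then show "lookup p w *s \<tau> w = lookup p (word_class []) *s \<tau> w"
      using coeff[of xs] unfolding cop by simp
  qed simp
  also have "\<dots> = lookup p (word_class []) *s E s t"
    by (simp add: E_def scale_sum_right)
  finally show ?thesis unfolding y_def by blast
qed

lemma hbar_J_all:
  assumes "x \<in> J_all"
  shows "hbar x \<in> J_all"
proof -
  obtain n where "x \<in> J_lt n" using assms by (auto simp: J_all_def)
  then show ?thesis unfolding J_lt_def
  proof (induction rule: span_induct_alt)
    case base
    then show ?case by (simp add: J_all_closed)
  next
    case (step c g x)
    then obtain a b s t k where g: "g = TT a * E s t * TT b" "a \<in> lists S" "b \<in> lists S" "bond s t k"
      unfolding J_lt_gens_def by blast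
    have EH: "E s t \<in> H_all" using E_in_H_lt[OF g(4)] H_lt_H_all by blast
    obtain d where d: "hbar (E s t) = d *s E s t" using hbar_E[OF g(4)] by blast
    have "hbar g = TT_bar a * (d *s E s t) * TT_bar b"
      using hbar_mult[OF H_all_mult[OF TT_H_all[OF g(2)] EH] TT_H_all[OF g(3)]] hbar_mult[OF TT_H_all[OF g(2)] EH]
        hbar_TT[OF g(2)] hbar_TT[OF g(3)] d g(1) by simp
    moreover have "d *s E s t \<in> J_all" using E_J_all[OF g(4)] by (rule J_all_closed)
    ultimately have "hbar g \<in> J_all"
      using J_all_H_all_mult[OF TT_bar_H_all[OF g(3)] H_all_J_all[OF TT_bar_H_all[OF g(2)]]] by simp
    then show ?case using step by (simp add: hbar_add hbar_scale J_all_closed)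
  qed
qed

section \<open>Normal forms in the quotient\<close>

definition \<nu> :: "'s list set \<Rightarrow> 'r"
  where "\<nu> w = v_pow (- int (len w)) *s \<tau> w"

lemma Wc_carrier: "w \<in> W\<^sub>c \<Longrightarrow> w \<in> carrier W"
  by (simp add: W\<^sub>c_def)

lemma \<tau>_\<nu>: "\<tau> w = v_pow (int (len w)) *s \<nu> w"
  by (simp add: \<nu>_def v_pow_mult)

lemma \<nu>_H_all: "w \<in> carrier W \<Longrightarrow> \<nu> w \<in> H_all"
  by (simp add: \<nu>_def \<tau>_in_H_all H_all_closed)

lemma lincomb_\<nu>_H_all: "keys p \<subseteq> W\<^sub>c \<Longrightarrow> lincomb \<nu> p \<in> H_all"
  using \<nu>_H_all Wc_carrier unfolding H_all_def by (blast intro: lincomb_in_span)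

lemma reduce_to_Wc:
  assumes "x \<in> H_lt n"
  obtains p where "keys p \<subseteq> {w \<in> W\<^sub>c. len w < n}" "x - lincomb \<nu> p \<in> J_all"
proof -
  obtain y where y: "y \<in> span {\<tau> w | w. w \<in> W\<^sub>c \<and> len w < n}" "x - y \<in> J_lt n"
    using H_lt_reduce[OF assms] by blast
  have "span {\<tau> w | w. w \<in> W\<^sub>c \<and> len w < n} \<subseteq> span (\<nu> ` {w \<in> W\<^sub>c. len w < n})"
  proof (rule span_minimal)
    show "{\<tau> w | w. w \<in> W\<^sub>c \<and> len w < n} \<subseteq> span (\<nu> ` {w \<in> W\<^sub>c. len w < n})"
    proof clarify
      fix w assume "w \<in> W\<^sub>c" "len w < n"
      then show "\<tau> w \<in> span (\<nu> ` {w \<in> W\<^sub>c. len w < n})"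
        by (subst \<tau>_\<nu>) (intro span_scale span_base imageI CollectI conjI)
    qed
  qed simp
  then have "y \<in> span (\<nu> ` {w \<in> W\<^sub>c. len w < n})" using y by blast
  then obtain p where "keys p \<subseteq> {w \<in> W\<^sub>c. len w < n}" "y = lincomb \<nu> p"
    by (rule span_lincomb)
  then show thesis using that y(2) unfolding J_all_def by blast
qed

lemma lincomb_\<nu>_J_all:
  assumes "keys p \<subseteq> W\<^sub>c" "lincomb \<nu> p \<in> J_all"
  shows "p = 0"
proof -
  have c: "lookup (co (lincomb \<nu> p)) w = v_pow (- int (len w)) * lookup p w" for w
  proof -
    have "lookup (co (lincomb \<nu> p)) w =
      (\<Sum>i\<in>keys p. if i = w then v_pow (- int (len w)) * lookup p w else 0)"
      unfolding co_lincomb using assms(1) Wc_carrier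
      by (intro sum.cong) (auto simp: \<nu>_def co_scale co_\<tau> lookup_single when_def subset_iff)
    then show ?thesis by (simp add: in_keys_iff)
  qed
  obtain n where "lincomb \<nu> p \<in> J_lt n" using assms(2) by (auto simp: J_all_def)
  then have "lincomb \<nu> p = 0"
  proof (rule J_lt_independent)
    fix w assume "w \<in> carrier W" "complex w"
    then have "w \<notin> keys p" using assms(1) by (auto simp: W\<^sub>c_def)
    then show "lookup (co (lincomb \<nu> p)) w = 0" by (simp add: c in_keys_iff)
  qed
  then have "v_pow (- int (len w)) * lookup p w = 0" for w using c[of w] by simp
  then have "v_pow (int (len w)) * (v_pow (- int (len w)) * lookup p w) = 0" for w by simp
  then have "lookup p w = 0" for w by (simp add: v_pow_mult flip: mult.assoc)
  then show ?thesis by (simp add: poly_mapping_eqI)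
qed

text \<open>
  The coordinates of \<open>x\<close> modulo the ideal with respect to the \<open>\<nu> w\<close>, \<open>w \<in> W\<^sub>c\<close>.
\<close>

definition normal_form :: "'r \<Rightarrow> ('s list set \<Rightarrow>\<^sub>0 laurent)"
  where "normal_form x = (THE p. keys p \<subseteq> W\<^sub>c \<and> x - lincomb \<nu> p \<in> J_all)"

lemma normal_form_eqI:
  assumes "keys p \<subseteq> W\<^sub>c" "x - lincomb \<nu> p \<in> J_all"
  shows "normal_form x = p"
  unfolding normal_form_def
proof (rule the_equality)
  fix r assume r: "keys r \<subseteq> W\<^sub>c \<and> x - lincomb \<nu> r \<in> J_all"
  then have "(x - lincomb \<nu> p) - (x - lincomb \<nu> r) \<in> J_all" using assms by (blast intro: J_all_closed(3))
  then have "lincomb \<nu> (r - p) \<in> J_all" by (simp add: lincomb_diff)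
  moreover have "keys (r - p) \<subseteq> W\<^sub>c" using r assms(1) by (intro keys_diff_subset) auto
  ultimately have "r - p = 0" by (intro lincomb_\<nu>_J_all)
  then show "r = p" by simp
qed (use assms in simp)

lemma normal_form_props:
  assumes "x \<in> H_all"
  shows "keys (normal_form x) \<subseteq> W\<^sub>c" and "x - lincomb \<nu> (normal_form x) \<in> J_all"
proof -
  obtain n where n: "x \<in> H_lt n" using assms by (rule H_all_H_lt)
  obtain p where p: "keys p \<subseteq> {w \<in> W\<^sub>c. len w < n}" "x - lincomb \<nu> p \<in> J_all"
    using n by (rule reduce_to_Wc)
  then have "normal_form x = p" by (intro normal_form_eqI) auto
  then show "keys (normal_form x) \<subseteq> W\<^sub>c" "x - lincomb \<nu> (normal_form x) \<in> J_all" using p by auto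
qed

lemma normal_form_H_lt_keys:
  assumes "x \<in> H_lt n"
  shows "keys (normal_form x) \<subseteq> {w \<in> W\<^sub>c. len w < n}"
proof -
  obtain p where p: "keys p \<subseteq> {w \<in> W\<^sub>c. len w < n}" "x - lincomb \<nu> p \<in> J_all"
    using assms by (rule reduce_to_Wc)
  then have "normal_form x = p" by (intro normal_form_eqI) auto
  then show ?thesis using p by simp
qed

lemma normal_form_lincomb: "keys p \<subseteq> W\<^sub>c \<Longrightarrow> normal_form (lincomb \<nu> p) = p"
  by (rule normal_form_eqI) (simp_all add: J_all_closed)

lemma normal_form_add: "x \<in> H_all \<Longrightarrow> y \<in> H_all \<Longrightarrow> normal_form (x + y) = normal_form x + normal_form y"
  using normal_form_props[of x] normal_form_props[of y] J_all_closed(2)[of "x - lincomb \<nu> (normal_form x)" "y - lincomb \<nu> (normal_form y)"]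
  by (intro normal_form_eqI keys_add_subset) (simp_all add: lincomb_add algebra_simps)

lemma normal_form_scale: "x \<in> H_all \<Longrightarrow> normal_form (a *s x) = scal a (normal_form x)"
  using normal_form_props[of x] J_all_closed(5)[of "x - lincomb \<nu> (normal_form x)" a] keys_scal[of a "normal_form x"]
  by (intro normal_form_eqI) (auto simp: lincomb_scal scale_right_diff_distrib)

lemma normal_form_eq_iff:
  assumes "x \<in> H_all" "y \<in> H_all"
  shows "normal_form x = normal_form y \<longleftrightarrow> x - y \<in> J_all"
proof
  assume "normal_form x = normal_form y"
  then have "(x - lincomb \<nu> (normal_form x)) - (y - lincomb \<nu> (normal_form y)) \<in> J_all" 
    by (intro J_all_closed(3) normal_form_props assms)
  then show "x - y \<in> J_all" using \<open>normal_form x = normal_form y\<close> by simp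
next
  assume "x - y \<in> J_all"
  then have "(x - y) + (y - lincomb \<nu> (normal_form y)) \<in> J_all" 
    by (intro J_all_closed(2) normal_form_props assms)
  then show "normal_form x = normal_form y" using normal_form_props[OF assms(2)] by (intro normal_form_eqI) auto
qed

text \<open>The bar involution of the quotient, in these coordinates.\<close>

definition \<beta> :: "('s list set \<Rightarrow>\<^sub>0 laurent) \<Rightarrow> ('s list set \<Rightarrow>\<^sub>0 laurent)"
  where "\<beta> p = normal_form (hbar (lincomb \<nu> p))"

lemma \<beta>_normal_form:
  assumes "x \<in> H_all"
  shows "\<beta> (normal_form x) = normal_form (hbar x)"
proof -
  have 1: "lincomb \<nu> (normal_form x) \<in> H_all" using normal_form_props(1)[OF assms] by (rule lincomb_\<nu>_H_all)
  have "hbar (lincomb \<nu> (normal_form x)) - hbar x = hbar (- (x - lincomb \<nu> (normal_form x)))"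
    by (simp flip: hbar_diff)
  also have "\<dots> \<in> J_all" by (intro hbar_J_all J_all_closed(4) normal_form_props assms)
  finally show ?thesis unfolding \<beta>_def using normal_form_eq_iff hbar_H_all 1 assms by simp
qed

text \<open>
  Triangularity is inherited from the Hecke algebra, where the image of \<open>\<nu> w\<close> differs from
  \<open>\<nu> w\<close> by shorter terms, because passing to the normal form does not increase lengths.
\<close>

lemma bar_module_\<beta>: "bar_module W\<^sub>c len \<beta>"
proof
  fix p r :: "'s list set \<Rightarrow>\<^sub>0 laurent" and a
  assume p: "keys p \<subseteq> W\<^sub>c"
  note pH = lincomb_\<nu>_H_all[OF p]
  show "\<beta> (p + r) = \<beta> p + \<beta> r" if "keys r \<subseteq> W\<^sub>c"
    unfolding \<beta>_def using normal_form_add hbar_H_all pH lincomb_\<nu>_H_all[OF that] by (simp add: lincomb_add hbar_add)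
  show "\<beta> (scal a p) = scal (lbar a) (\<beta> p)"
    unfolding \<beta>_def using normal_form_scale hbar_H_all pH by (simp add: lincomb_scal hbar_scale)
  show "\<beta> (\<beta> p) = p"
    using \<beta>_normal_form[OF hbar_H_all[OF pH]] hbar_hbar[OF pH] normal_form_lincomb[OF p] by (simp add: \<beta>_def)
next
  fix w assume w: "w \<in> W\<^sub>c"
  then have wW: "w \<in> carrier W" by (rule Wc_carrier)
  obtain xs where xs: "reduced xs" "word_class xs = w" using wW by (rule reduced_exists)
  have xl: "xs \<in> lists S" "length xs = len w" using xs by (auto simp: reduced_def)
  have "hbar (\<nu> w) - \<nu> w = v_pow (int (len w)) *s (TT_bar xs - v_pow (- 2 * int (length xs)) *s TT xs)"
    using hbar_TT[OF xl(1)] TT_reduced[OF xs(1)] xs(2) xl(2)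
    by (simp add: \<nu>_def hbar_scale scale_right_diff_distrib v_pow_mult)
  also have "\<dots> \<in> H_lt (len w)" using TT_bar_top[OF xl(1)] xl(2) by (simp add: H_lt_def span_scale)
  finally have low: "hbar (\<nu> w) - \<nu> w \<in> H_lt (len w)" .
  have nH: "\<nu> w \<in> H_all" "hbar (\<nu> w) - \<nu> w \<in> H_all" using \<nu>_H_all[OF wW] low H_lt_H_all by auto
  have "normal_form (\<nu> w) = single w 1" using normal_form_lincomb[of "single w 1"] w by simp
  moreover have "normal_form (hbar (\<nu> w)) = normal_form (hbar (\<nu> w) - \<nu> w) + normal_form (\<nu> w)"
    using normal_form_add[OF nH(2,1)] by simp
  ultimately have "\<beta> (single w 1) - single w 1 = normal_form (hbar (\<nu> w) - \<nu> w)"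
    by (simp add: \<beta>_def)
  then show "keys (\<beta> (single w 1) - single w 1)
    \<subseteq> {v \<in> W\<^sub>c. len v < len w}" using normal_form_H_lt_keys[OF low] by simp
qed

end

section \<open>Linear endomorphisms of a free module\<close>

text \<open>
  Linear endomorphisms form a type-class ring. The regular representation embeds a Hecke
  algebra given by a carrier set into it, so that the results about \<open>hecke_rep\<close> apply.
\<close>

typedef 'w endo = "{f :: ('w \<Rightarrow>\<^sub>0 laurent) \<Rightarrow> ('w \<Rightarrow>\<^sub>0 laurent).
    (\<forall>p r. f (p + r) = f p + f r) \<and> (\<forall>a p. f (scal a p) = scal a (f p))}"
  morphisms app Endo
  by (rule exI[of _ "\<lambda>p. p"]) simp

lemma app_add [simp]: "app f (p + r) = app f p + app f r"
  and app_scal [simp]: "app f (scal a p) = scal a (app f p)"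
  using app[of f] by auto

lemma app_Endo:
  "\<lbrakk>\<And>p r. f (p + r) = f p + f r; \<And>a p. f (scal a p) = scal a (f p)\<rbrakk> \<Longrightarrow> app (Endo f) = f"
  by (rule Endo_inverse) auto

lemma endo_eqI: "(\<And>p. app f p = app g p) \<Longrightarrow> f = g"
  by (simp add: app_inject[symmetric] fun_eq_iff)

lemma scal_zero [simp]: "scal 0 p = 0" and scal_zero_right [simp]: "scal a 0 = 0"
  and scal_one [simp]: "scal 1 p = p"
  and scal_scal [simp]: "scal a (scal b p) = scal (a * b) p"
  and scal_add: "scal a (p + r) = scal a p + scal a r"
  and scal_add_left: "scal (a + b) p = scal a p + scal b p"
  and scal_uminus: "scal a (- p) = - scal a p"
  and scal_diff: "scal a (p - r) = scal a p - scal a r"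
  by (rule poly_mapping_eqI; simp add: lookup_add lookup_minus algebra_simps)+

instantiation endo :: (type) ring
begin

definition "0 = Endo (\<lambda>p. 0)"
definition "f + g = Endo (\<lambda>p. app f p + app g p)"
definition "- f = Endo (\<lambda>p. - app f p)"
definition "f - g = Endo (\<lambda>p. app f p - app g p)"
definition "f * g = Endo (\<lambda>p. app f (app g p))"

lemma app_zero [simp]: "app 0 p = 0"
  and app_plus [simp]: "app (f + g) p = app f p + app g p"
  and app_uminus [simp]: "app (- f) p = - app f p"
  and app_minus [simp]: "app (f - g) p = app f p - app g p"
  and app_times [simp]: "app (f * g) p = app f (app g p)"
  unfolding zero_endo_def plus_endo_def uminus_endo_def minus_endo_def times_endo_def
  by (subst app_Endo; simp add: scal_add scal_uminus scal_diff)+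

instance
  by standard (auto intro!: endo_eqI simp: algebra_simps)

end

definition escale :: "laurent \<Rightarrow> 'w endo \<Rightarrow> 'w endo"
  where "escale a f = Endo (\<lambda>p. scal a (app f p))"

lemma app_escale [simp]: "app (escale a f) p = scal a (app f p)"
  unfolding escale_def by (subst app_Endo) (simp_all add: scal_add mult.commute)

section \<open>Coordinates of a Hecke algebra\<close>

lemma coefficients_bij:
  fixes R :: "(laurent, 'r) ring_scheme"
  assumes R: "\<zero>\<^bsub>R\<^esub> = 0" "0 \<in> carrier R"
  shows "bij_betw (\<lambda>p. restrict (lookup p) I)
    {p. keys p \<subseteq> I \<and> (\<forall>i. lookup p i \<in> carrier R)} (coefficients R I)"
    (is "bij_betw ?r ?P _")
proof (rule bij_betw_imageI)
  show "inj_on ?r ?P"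
  proof (rule inj_onI)
    fix p p' assume p: "p \<in> ?P" "p' \<in> ?P" "?r p = ?r p'"
    have "lookup p i = lookup p' i" for i
    proof (cases "i \<in> I")
      case True
      then show ?thesis using fun_cong[OF p(3), of i] by simp
    next
      case False
      then have "i \<notin> keys p" "i \<notin> keys p'" using p(1,2) by auto
      then show ?thesis by (simp add: in_keys_iff)
    qed
    then show "p = p'" by (simp add: poly_mapping_eqI)
  qed
  show "?r ` ?P = coefficients R I"
  proof (intro equalityI subsetI)
    fix a assume "a \<in> ?r ` ?P"
    then obtain p where p: "p \<in> ?P" "a = ?r p" by blast
    have "{i \<in> I. a i \<noteq> 0} \<subseteq> keys p" using p(2) by (auto simp: in_keys_iff)
    then have "finite {i \<in> I. a i \<noteq> 0}" by (rule finite_subset) simp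
    then show "a \<in> coefficients R I" using p R(1) by (auto simp: coefficients_def)
  next
    fix a assume a: "a \<in> coefficients R I"
    define p where "p = Abs_poly_mapping (\<lambda>i. if i \<in> I then a i else 0)"
    have "finite {i. (if i \<in> I then a i else 0) \<noteq> 0}"
      by (rule finite_subset[of _ "{i \<in> I. a i \<noteq> 0}"]) (use a R(1) in \<open>auto simp: coefficients_def split: if_splits\<close>)
    then have l: "lookup p i = (if i \<in> I then a i else 0)" for i
      by (simp add: p_def)
    have "a i \<in> carrier R" if "i \<in> I" for i using a that by (auto simp: coefficients_def)
    then have "p \<in> ?P" using R(2) by (simp add: l in_keys_iff subset_iff)
    moreover have "?r p = a"
    proof
      fix i
      show "?r p i = a i" using a by (cases "i \<in> I") (auto simp: l coefficients_def dest: PiE_arb)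
    qed
    ultimately show "a \<in> ?r ` ?P" by blast
  qed
qed

lemma hom_finsum:
  fixes \<phi> :: "'a \<Rightarrow> 'b::comm_monoid_add"
  assumes "abelian_monoid G" "\<phi> \<zero>\<^bsub>G\<^esub> = 0"
    "\<And>x y. \<lbrakk>x \<in> carrier G; y \<in> carrier G\<rbrakk> \<Longrightarrow> \<phi> (x \<oplus>\<^bsub>G\<^esub> y) = \<phi> x + \<phi> y"
    "finite A" "\<And>i. i \<in> A \<Longrightarrow> f i \<in> carrier G"
  shows "\<phi> (finsum G f A) = (\<Sum>i\<in>A. \<phi> (f i))"
proof -
  interpret abelian_monoid G by fact
  show ?thesis
    using assms(4,5)
  proof (induction A rule: finite_induct)
    case (insert i A)
    then have "finsum G f (insert i A) = f i \<oplus>\<^bsub>G\<^esub> finsum G f A" by (intro finsum_insert) auto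
    then show ?case using insert assms(3)[of "f i" "finsum G f A"] finsum_closed[of f A] by (simp add: Pi_iff)
  qed (simp add: assms(2))
qed

context hecke_algebra
begin

lemma laurent_simps [simp]: "carrier \<A> = UNIV" "a \<otimes>\<^bsub>\<A>\<^esub> b = a * b" "\<one>\<^bsub>\<A>\<^esub> = 1" "\<zero>\<^bsub>\<A>\<^esub> = 0" "a \<oplus>\<^bsub>\<A>\<^esub> b = a + b"
  by (simp_all add: laurent_ring_def)

lemma T_closed [simp]: "w \<in> carrier W \<Longrightarrow> T w \<in> carrier H"
  using T_basis by (auto simp: is_basis_def)

text \<open>
  Values outside of \<open>carrier W\<close> are ignored, which makes \<open>toH\<close> linear on the free module
  over the whole type.
\<close>

definition toH :: "('s list set \<Rightarrow>\<^sub>0 laurent) \<Rightarrow> 'h"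
  where "toH p = (\<Oplus>w\<in>keys p \<inter> carrier W. lookup p w \<odot> T w)"

lemma toH_superset:
  assumes "finite A" "keys p \<inter> carrier W \<subseteq> A" "A \<subseteq> carrier W"
  shows "toH p = (\<Oplus>w\<in>A. lookup p w \<odot> T w)"
  unfolding toH_def
proof (rule add.finprod_mono_neutral_cong_left)
  fix w assume "w \<in> A - keys p \<inter> carrier W"
  then have "lookup p w = 0" "w \<in> carrier W" using assms by (auto simp: in_keys_iff)
  then show "lookup p w \<odot> T w = \<zero>" using smult_l_null[of "T w"] by simp
qed (use assms in auto)

lemma toH_closed [simp]: "toH p \<in> carrier H"
  unfolding toH_def by (rule finsum_closed) auto

lemma toH_add: "toH (p + r) = toH p \<oplus> toH r"
proof -
  let ?A = "(keys p \<union> keys r) \<inter> carrier W"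
  have fin: "finite ?A" by simp
  have "toH (p + r) = (\<Oplus>w\<in>?A. lookup (p + r) w \<odot> T w)"
    using keys_add[of p r] by (intro toH_superset) auto
  also have "\<dots> = (\<Oplus>w\<in>?A. lookup p w \<odot> T w \<oplus> lookup r w \<odot> T w)"
    using smult_l_distr by (intro finsum_cong') (auto simp: lookup_add)
  also have "\<dots> = (\<Oplus>w\<in>?A. lookup p w \<odot> T w) \<oplus> (\<Oplus>w\<in>?A. lookup r w \<odot> T w)"
    by (rule finsum_addf) auto
  also have "\<dots> = toH p \<oplus> toH r" by (subst (1 2) toH_superset[of ?A]) auto
  finally show ?thesis .
qed

lemma smult_finsum:
  "finite A \<Longrightarrow> f \<in> A \<rightarrow> carrier H \<Longrightarrow> a \<odot> (\<Oplus>i\<in>A. f i) = (\<Oplus>i\<in>A. a \<odot> f i)"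
  using finsum_smult_ldistr[of A a f] by simp

lemma toH_scal: "toH (scal a p) = a \<odot> toH p"
proof -
  let ?A = "keys p \<inter> carrier W"
  have "toH (scal a p) = (\<Oplus>w\<in>?A. lookup (scal a p) w \<odot> T w)"
    using keys_scal[of a p] by (intro toH_superset) auto
  also have "\<dots> = (\<Oplus>w\<in>?A. a \<odot> (lookup p w \<odot> T w))"
    using smult_assoc1 by (intro finsum_cong') auto
  also have "\<dots> = a \<odot> toH p" unfolding toH_def by (subst smult_finsum) auto
  finally show ?thesis .
qed

lemma toH_single: "w \<in> carrier W \<Longrightarrow> toH (single w 1) = T w"
  using smult_one[of "T w"] by (subst toH_superset[of "{w}"]) auto

lemma toH_bij: "bij_betw toH {p. keys p \<subseteq> carrier W} (carrier H)"
proof -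
  have "bij_betw (lin_comb \<A> H (carrier W) T \<circ> (\<lambda>p. restrict (lookup p) (carrier W)))
    {p. keys p \<subseteq> carrier W \<and> (\<forall>i. lookup p i \<in> carrier \<A>)} (carrier H)"
    using coefficients_bij[of \<A> "carrier W"] T_basis
    by (intro bij_betw_trans) (auto simp: is_basis_def)
  then have b: "bij_betw (\<lambda>p. lin_comb \<A> H (carrier W) T (restrict (lookup p) (carrier W)))
    {p. keys p \<subseteq> carrier W} (carrier H)" by (simp add: comp_def)
  have eq: "lin_comb \<A> H (carrier W) T (restrict (lookup p) (carrier W)) = toH p"
    if p: "p \<in> {p. keys p \<subseteq> carrier W}" for p
  proof -
    have "{i \<in> carrier W. restrict (lookup p) (carrier W) i \<noteq> \<zero>\<^bsub>\<A>\<^esub>} = keys p \<inter> carrier W"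
      by (auto simp: in_keys_iff)
    then show ?thesis unfolding lin_comb_def toH_def by (intro finsum_cong') auto
  qed
  show ?thesis by (rule iffD1[OF bij_betw_cong[OF eq] b])
qed

definition ofH :: "'h \<Rightarrow> ('s list set \<Rightarrow>\<^sub>0 laurent)"
  where "ofH = inv_into {p. keys p \<subseteq> carrier W} toH"

lemma ofH_keys: "x \<in> carrier H \<Longrightarrow> keys (ofH x) \<subseteq> carrier W"
  and toH_ofH [simp]: "x \<in> carrier H \<Longrightarrow> toH (ofH x) = x"
  and ofH_toH: "keys p \<subseteq> carrier W \<Longrightarrow> ofH (toH p) = p"
  using toH_bij inv_into_into[of x toH "{p. keys p \<subseteq> carrier W}"]
  unfolding ofH_def by (auto simp: bij_betw_def f_inv_into_f inv_into_f_f)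

lemma ofH_add: "x \<in> carrier H \<Longrightarrow> y \<in> carrier H \<Longrightarrow> ofH (x \<oplus> y) = ofH x + ofH y"
  using ofH_toH[of "ofH x + ofH y"] ofH_keys keys_add_subset[of "ofH x" "carrier W" "ofH y"]
  by (simp add: toH_add)

lemma ofH_smult: "x \<in> carrier H \<Longrightarrow> ofH (a \<odot> x) = scal a (ofH x)"
  using ofH_toH[of "scal a (ofH x)"] ofH_keys[of x] keys_scal[of a "ofH x"] by (simp add: toH_scal)

lemma ofH_T: "w \<in> carrier W \<Longrightarrow> ofH (T w) = single w 1"
  using ofH_toH[of "single w 1"] by (simp add: toH_single)

lemma ofH_inj: "x \<in> carrier H \<Longrightarrow> y \<in> carrier H \<Longrightarrow> ofH x = ofH y \<Longrightarrow> x = y"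
  by (metis toH_ofH)

section \<open>The regular representation\<close>

text \<open>
  Left multiplication in coordinates. As \<open>toH\<close> forgets the values outside of \<open>carrier W\<close>,
  the unit of the Hecke algebra becomes a projection and not the identity.
\<close>

definition reg :: "'h \<Rightarrow> 's list set endo"
  where "reg x = Endo (\<lambda>p. ofH (x \<otimes> toH p))"

lemma app_reg [simp]: "x \<in> carrier H \<Longrightarrow> app (reg x) p = ofH (x \<otimes> toH p)"
  unfolding reg_def
  by (subst app_Endo) (simp_all add: toH_add toH_scal r_distr ofH_add ofH_smult smult_mult_right)

lemma reg_add: "x \<in> carrier H \<Longrightarrow> y \<in> carrier H \<Longrightarrow> reg (x \<oplus> y) = reg x + reg y"
  by (rule endo_eqI) (simp add: l_distr ofH_add)

lemma reg_mult: "x \<in> carrier H \<Longrightarrow> y \<in> carrier H \<Longrightarrow> reg (x \<otimes> y) = reg x * reg y"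
  by (rule endo_eqI) (simp add: m_assoc)

lemma reg_smult: "x \<in> carrier H \<Longrightarrow> reg (a \<odot> x) = escale a (reg x)"
  by (rule endo_eqI) (simp add: smult_mult_left ofH_smult)

lemma reg_zero: "reg \<zero> = 0"
  using reg_add[of \<zero> \<zero>] by simp

text \<open>
  The image of the unit element, from which an element of the Hecke algebra can be
  recovered.
\<close>

definition unit_value :: "'s list set endo \<Rightarrow> ('s list set \<Rightarrow>\<^sub>0 laurent)"
  where "unit_value f = app f (single (word_class []) 1)"

lemma unit_value_reg: "x \<in> carrier H \<Longrightarrow> unit_value (reg x) = ofH x"
  using toH_single[of "word_class []"] T_one by (simp add: unit_value_def one_W)

lemma reg_inj: "x \<in> carrier H \<Longrightarrow> y \<in> carrier H \<Longrightarrow> reg x = reg y \<Longrightarrow> x = y"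
  using unit_value_reg ofH_inj by metis

sublocale rep: hecke_rep S m escale "\<lambda>w. reg (T w)" unit_value
proof
  fix a b :: laurent and f g :: "'s list set endo"
  show "escale a (f + g) = escale a f + escale a g" "escale (a + b) f = escale a f + escale b f"
    "escale a (escale b f) = escale (a * b) f" "escale 1 f = f"
    "escale a f * g = escale a (f * g)" "f * escale a g = escale a (f * g)"
    by (rule endo_eqI; simp add: scal_add scal_add_left)+
  show "unit_value (f + g) = unit_value f + unit_value g" by (simp add: unit_value_def)
  show "lookup (unit_value (escale a f)) w = a * lookup (unit_value f) w" for w
    by (simp add: unit_value_def)
next
  fix w assume w: "w \<in> carrier W"
  have one: "T (word_class []) = \<one>" using T_one by (simp add: one_W)
  show "reg (T (word_class [])) * reg (T w) = reg (T w)" "reg (T w) * reg (T (word_class [])) = reg (T w)"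
    using w by (simp_all add: one flip: reg_mult)
  show "unit_value (reg (T w)) = single w 1" using w by (simp add: unit_value_reg ofH_T)
  fix s assume s: "s \<in> S"
  have sW: "gen s \<in> carrier W" using s by (simp add: gen_def)
  interpret W: group W by (rule group_W)
  have swW: "gen s \<otimes>\<^bsub>W\<^esub> w \<in> carrier W" using w sW by simp
  show "reg (T (gen s)) * reg (T w) = reg (T (gen s \<otimes>\<^bsub>W\<^esub> w))" if "len w < len (gen s \<otimes>\<^bsub>W\<^esub> w)"
    using T_mult_up[OF s w that] w sW by (simp flip: reg_mult)
  show "reg (T (gen s)) * reg (T w) = escale q (reg (T (gen s \<otimes>\<^bsub>W\<^esub> w))) + escale (q - 1) (reg (T w))"
    if "len (gen s \<otimes>\<^bsub>W\<^esub> w) < len w"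
    using T_mult_down[OF s w that] w sW swW by (simp add: reg_add reg_smult flip: reg_mult)
qed

lemma reg_toH:
  assumes "keys p \<subseteq> carrier W"
  shows "reg (toH p) = rep.lincomb (\<lambda>w. reg (T w)) p"
proof -
  have "abelian_monoid H" by unfold_locales
  then have "reg (toH p) = (\<Sum>w\<in>keys p \<inter> carrier W. reg (lookup p w \<odot> T w))"
    unfolding toH_def by (rule hom_finsum) (auto simp: reg_zero reg_add)
  also have "\<dots> = (\<Sum>w\<in>keys p \<inter> carrier W. escale (lookup p w) (reg (T w)))"
    by (rule sum.cong) (auto simp: reg_smult)
  finally show ?thesis using assms by (simp add: rep.lincomb_def Int_absorb2)
qed

lemma reg_H_all: "x \<in> carrier H \<Longrightarrow> reg x \<in> rep.H_all"
proof -
  assume x: "x \<in> carrier H"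
  have "reg x = rep.lincomb (\<lambda>w. reg (T w)) (ofH x)" using reg_toH[OF ofH_keys[OF x]] x by simp
  also have "\<dots> \<in> rep.H_all"
    unfolding rep.H_all_def using ofH_keys[OF x] by (intro rep.lincomb_in_span rep.span_base) auto
  finally show ?thesis .
qed

lemma H_all_reg:
  assumes "f \<in> rep.H_all"
  obtains x where "x \<in> carrier H" "reg x = f"
proof -
  obtain p where "keys p \<subseteq> carrier W" "f = rep.lincomb (\<lambda>w. reg (T w)) p"
    using assms unfolding rep.H_all_def by (rule rep.span_lincomb)
  then show thesis using that[of "toH p"] reg_toH by simp
qed

section \<open>The Temperley--Lieb ideal\<close>

lemma bond_iff: "(\<exists>k. bond s t k) \<longleftrightarrow> adjacent s t \<and> m s t \<noteq> \<infinity>"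
  by (cases "m s t") (auto simp: bond_def adjacent_def numeral_eq_enat)

lemma reg_parabolic_sum:
  assumes "bond s t k"
  shows "(\<Oplus>w\<in>parabolic s t. T w) \<in> carrier H" "reg (\<Oplus>w\<in>parabolic s t. T w) = rep.E s t"
proof -
  have P: "parabolic s t \<subseteq> carrier W" "finite (parabolic s t)"
    using rep.bond_parabolic_carrier[OF assms] rep.bond_finite_parabolic[OF assms] by auto
  then show "(\<Oplus>w\<in>parabolic s t. T w) \<in> carrier H" by (intro finsum_closed) auto
  have "abelian_monoid H" by unfold_locales
  then show "reg (\<Oplus>w\<in>parabolic s t. T w) = rep.E s t"
    unfolding rep.E_def using P by (intro hom_finsum) (auto simp: reg_zero reg_add)
qed

definition J_gens :: "'h set"
  where "J_gens = {\<Oplus>w\<in>parabolic s t. T w | s t. adjacent s t \<and> m s t \<noteq> \<infinity>}"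

lemma J_gens_carrier: "J_gens \<subseteq> carrier H"
  using reg_parabolic_sum bond_iff unfolding J_gens_def by blast

lemma J_ideal: "ideal J H"
  unfolding J_def using genideal_ideal J_gens_carrier unfolding J_gens_def by blast

lemma J_smult: "x \<in> J \<Longrightarrow> a \<odot> x \<in> J"
proof -
  assume x: "x \<in> J"
  interpret J: ideal J H by (rule J_ideal)
  have "a \<odot> x = (a \<odot> \<one>) \<otimes> x" using x smult_mult_left[of \<one> x a] by simp
  then show "a \<odot> x \<in> J" using x by (simp add: J.I_l_closed)
qed

text \<open>
  The elements whose image lies in \<open>rep.J_all\<close> form an ideal that contains the generators of
  \<open>J\<close>. Conversely, the spanning elements of \<open>rep.J_lt n\<close> are images of products with a
  generator of \<open>J\<close>.
\<close>

lemma J_iff: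
  assumes "x \<in> carrier H"
  shows "x \<in> J \<longleftrightarrow> reg x \<in> rep.J_all"
proof
  interpret J: ideal J H by (rule J_ideal)
  have minus: "reg (\<ominus> x) = - reg x" if "x \<in> carrier H" for x
    using reg_add[of "\<ominus> x" x] that by (simp add: l_neg reg_zero eq_neg_iff_add_eq_0)
  have "ideal {x \<in> carrier H. reg x \<in> rep.J_all} H"
  proof (rule idealI)
    show "ring H" by (rule ring_axioms)
    show "subgroup {x \<in> carrier H. reg x \<in> rep.J_all} (add_monoid H)"
      by (rule add.subgroupI) (auto simp: reg_add minus rep.J_all_closed intro!: exI[of _ \<zero>] simp: reg_zero simp flip: a_inv_def)
  next
    fix a x assume a: "a \<in> {x \<in> carrier H. reg x \<in> rep.J_all}" and x: "x \<in> carrier H"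
    then show "x \<otimes> a \<in> {x \<in> carrier H. reg x \<in> rep.J_all}" "a \<otimes> x \<in> {x \<in> carrier H. reg x \<in> rep.J_all}"
      using rep.H_all_J_all[OF reg_H_all[OF x]] rep.J_all_H_all_mult[OF reg_H_all[OF x]] by (auto simp: reg_mult)
  qed
  moreover have "J_gens \<subseteq> {x \<in> carrier H. reg x \<in> rep.J_all}"
    using reg_parabolic_sum bond_iff rep.E_J_all unfolding J_gens_def by fastforce
  ultimately have "J \<subseteq> {x \<in> carrier H. reg x \<in> rep.J_all}"
    unfolding J_def J_gens_def[symmetric] by (rule genideal_minimal)
  then show "reg x \<in> rep.J_all" if "x \<in> J" using that by blast
  assume "reg x \<in> rep.J_all"
  then obtain n where "reg x \<in> rep.J_lt n" by (auto simp: rep.J_all_def)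
  then have "\<exists>y\<in>J. reg y = reg x"
    unfolding rep.J_lt_def
  proof (induction rule: rep.span_induct_alt)
    case base
    then show ?case using reg_zero by (intro bexI[of _ \<zero>]) auto
  next
    case (step c g f)
    then obtain a b s t k where g: "g = rep.TT a * rep.E s t * rep.TT b" "a \<in> lists S" "b \<in> lists S" "bond s t k"
      unfolding rep.J_lt_gens_def by blast
    obtain x where x: "x \<in> carrier H" "reg x = rep.TT a" using rep.TT_H_all[OF g(2)] by (rule H_all_reg)
    obtain z where z: "z \<in> carrier H" "reg z = rep.TT b" using rep.TT_H_all[OF g(3)] by (rule H_all_reg)
    define e where "e = (\<Oplus>w\<in>parabolic s t. T w)"
    have e: "e \<in> carrier H" "reg e = rep.E s t" using reg_parabolic_sum[OF g(4)] by (simp_all add: e_def)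
    have "e \<in> J_gens" using g(4) bond_iff[of s t] unfolding J_gens_def e_def by blast
    then have eJ: "e \<in> J" unfolding J_def J_gens_def[symmetric] using genideal_self[OF J_gens_carrier] by blast
    obtain y where y: "y \<in> J" "reg y = f" using step by blast
    have "c \<odot> (x \<otimes> e \<otimes> z) \<oplus> y \<in> J"
      using eJ x z y by (intro J.a_closed J_smult J.I_r_closed J.I_l_closed) auto
    moreover have "reg (c \<odot> (x \<otimes> e \<otimes> z) \<oplus> y) = escale c g + f"
      using x z e y J.Icarr[OF y(1)] g(1) by (simp add: reg_add reg_smult reg_mult)
    ultimately show ?case by blast
  qed
  then obtain y where y: "y \<in> J" "reg y = reg x" by blast
  then have "y = x" using J.Icarr assms by (intro reg_inj) auto
  then show "x \<in> J" using y by simp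
qed

section \<open>The Temperley--Lieb algebra as a quotient\<close>

lemma TL_simps: "carrier TL = a_rcosets J" "x \<otimes>\<^bsub>TL\<^esub> y = rcoset_mult H J x y" "\<one>\<^bsub>TL\<^esub> = J +> \<one>"
  "\<zero>\<^bsub>TL\<^esub> = J" "x \<oplus>\<^bsub>TL\<^esub> y = x <+> y" "a \<odot>\<^bsub>TL\<^esub> C = (\<Union>x\<in>C. J +> (a \<odot> x))"
  by (simp_all add: TL_def FactRing_def ring.defs module.defs)

lemma carrier_TL: "carrier TL = (\<lambda>x. J +> x) ` carrier H"
  unfolding TL_simps A_RCOSETS_def' by auto

lemma proj_closed [simp]: "x \<in> carrier H \<Longrightarrow> J +> x \<in> carrier TL"
  by (simp add: carrier_TL)

lemma proj_add: "x \<in> carrier H \<Longrightarrow> y \<in> carrier H \<Longrightarrow> (J +> x) \<oplus>\<^bsub>TL\<^esub> (J +> y) = J +> (x \<oplus> y)"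
  and proj_mult: "x \<in> carrier H \<Longrightarrow> y \<in> carrier H \<Longrightarrow> (J +> x) \<otimes>\<^bsub>TL\<^esub> (J +> y) = J +> (x \<otimes> y)"
  unfolding TL_simps using ideal.a_rcos_sum[OF J_ideal] ideal.rcoset_mult_add[OF J_ideal] by simp_all

lemma proj_eq_iff:
  assumes "x \<in> carrier H" "y \<in> carrier H"
  shows "J +> x = J +> y \<longleftrightarrow> reg x - reg y \<in> rep.J_all"
proof -
  have "reg (x \<ominus> y) + reg y = reg x"
    using reg_add[of "x \<ominus> y" y] assms by (simp add: minus_eq a_assoc l_neg)
  then have "reg (x \<ominus> y) = reg x - reg y" by (simp add: eq_diff_eq)
  then show ?thesis
    using quotient_eq_iff_same_a_r_cos[OF J_ideal assms] J_iff[of "x \<ominus> y"] assms by simp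
qed

lemma proj_zero: "J +> \<zero> = J"
proof -
  interpret J: ideal J H by (rule J_ideal)
  show ?thesis using J.a_rcos_const by simp
qed

lemma proj_smult:
  assumes "x \<in> carrier H"
  shows "a \<odot>\<^bsub>TL\<^esub> (J +> x) = J +> (a \<odot> x)"
proof -
  interpret J: ideal J H by (rule J_ideal)
  have "J +> (a \<odot> y) = J +> (a \<odot> x)" if y: "y \<in> J +> x" for y
  proof -
    obtain j where j: "j \<in> J" "y = j \<oplus> x" using y by (auto simp: a_r_coset_def')
    then have jH: "j \<in> carrier H" by simp
    have "a \<odot> y = a \<odot> j \<oplus> a \<odot> x" using j jH assms smult_r_distr by simp
    then have "reg (a \<odot> y) - reg (a \<odot> x) = reg (a \<odot> j)" using jH assms by (simp add: reg_add)
    moreover have "reg (a \<odot> j) \<in> rep.J_all" using J_smult[OF j(1)] J_iff jH by simp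
    ultimately show ?thesis using proj_eq_iff[of "a \<odot> y" "a \<odot> x"] j jH assms by simp
  qed
  moreover have "x \<in> J +> x" using assms J.a_rcos_self by simp
  ultimately show ?thesis unfolding TL_simps by blast
qed

lemma TL_cases:
  assumes "C \<in> carrier TL"
  obtains x where "x \<in> carrier H" "C = J +> x"
  using assms by (auto simp: carrier_TL)

lemma TL_ring: "ring TL"
proof -
  interpret Q: ring "H Quot J" by (rule ideal.quotient_is_ring[OF J_ideal])
  have eq: "carrier TL = carrier (H Quot J)" "(\<otimes>\<^bsub>TL\<^esub>) = (\<otimes>\<^bsub>H Quot J\<^esub>)" "\<one>\<^bsub>TL\<^esub> = \<one>\<^bsub>H Quot J\<^esub>"
    "\<zero>\<^bsub>TL\<^esub> = \<zero>\<^bsub>H Quot J\<^esub>" "(\<oplus>\<^bsub>TL\<^esub>) = (\<oplus>\<^bsub>H Quot J\<^esub>)"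
    by (simp_all add: TL_def FactRing_def ring.defs)
  show ?thesis
  proof (rule ringI)
    show "abelian_group TL"
    proof (rule abelian_groupI)
      show "\<exists>y\<in>carrier TL. y \<oplus>\<^bsub>TL\<^esub> x = \<zero>\<^bsub>TL\<^esub>" if "x \<in> carrier TL" for x
        using that Q.l_neg[of x] Q.a_inv_closed[of x] unfolding eq by (intro bexI[of _ "\<ominus>\<^bsub>H Quot J\<^esub> x"]) simp_all
    qed (simp_all add: eq Q.a_ac)
    show "Group.monoid TL"
      by (rule monoidI) (auto simp: eq Q.m_assoc)
  qed (auto simp: eq Q.l_distr Q.r_distr)
qed

text \<open>
  The coordinates with respect to \<open>normalized_t\<close>, by way of an arbitrary representative.
\<close>

definition coord :: "'h set \<Rightarrow> ('s list set \<Rightarrow>\<^sub>0 laurent)"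
  where "coord C = rep.normal_form (reg (SOME x. x \<in> carrier H \<and> J +> x = C))"

lemma coord_proj:
  assumes "x \<in> carrier H"
  shows "coord (J +> x) = rep.normal_form (reg x)"
proof -
  define y where "y = (SOME y. y \<in> carrier H \<and> J +> y = J +> x)"
  have "y \<in> carrier H \<and> J +> y = J +> x"
    unfolding y_def by (rule someI[of _ x]) (use assms in simp)
  then have "rep.normal_form (reg y) = rep.normal_form (reg x)"
    using proj_eq_iff[of y x] assms by (simp add: rep.normal_form_eq_iff reg_H_all)
  then show ?thesis by (simp add: coord_def y_def)
qed

lemma coord_keys: "C \<in> carrier TL \<Longrightarrow> keys (coord C) \<subseteq> W\<^sub>c"
  by (erule TL_cases) (simp add: coord_proj rep.normal_form_props reg_H_all)

lemma coord_add:
  "C \<in> carrier TL \<Longrightarrow> D \<in> carrier TL \<Longrightarrow> coord (C \<oplus>\<^bsub>TL\<^esub> D) = coord C + coord D"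
  by (erule TL_cases, erule TL_cases) (simp add: proj_add coord_proj reg_add rep.normal_form_add reg_H_all)

lemma coord_smult: "C \<in> carrier TL \<Longrightarrow> coord (a \<odot>\<^bsub>TL\<^esub> C) = scal a (coord C)"
  by (erule TL_cases) (simp add: proj_smult coord_proj reg_smult rep.normal_form_scale reg_H_all)

lemma smult_TL_closed [simp]: "C \<in> carrier TL \<Longrightarrow> a \<odot>\<^bsub>TL\<^esub> C \<in> carrier TL"
  by (erule TL_cases) (simp add: proj_smult)

lemma coord_inj: "C \<in> carrier TL \<Longrightarrow> D \<in> carrier TL \<Longrightarrow> coord C = coord D \<Longrightarrow> C = D"
  by (erule TL_cases, erule TL_cases) (simp add: coord_proj proj_eq_iff rep.normal_form_eq_iff reg_H_all)

lemma coord_zero: "coord \<zero>\<^bsub>TL\<^esub> = 0"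
proof -
  interpret TL: ring TL by (rule TL_ring)
  show ?thesis using coord_add[of "\<zero>\<^bsub>TL\<^esub>" "\<zero>\<^bsub>TL\<^esub>"] by simp
qed

lemma coord_surj:
  assumes "keys p \<subseteq> W\<^sub>c"
  obtains C where "C \<in> carrier TL" "coord C = p"
proof -
  obtain x where "x \<in> carrier H" "reg x = rep.lincomb rep.\<nu> p"
    using rep.lincomb_\<nu>_H_all[OF assms] by (rule H_all_reg)
  then show thesis using that[of "J +> x"] rep.normal_form_lincomb[OF assms] by (simp add: coord_proj)
qed

lemma t_elem_closed [simp]: "w \<in> carrier W \<Longrightarrow> t_elem w \<in> carrier TL"
  by (simp add: t_elem_def)

lemma normalized_t_closed: "w \<in> carrier W \<Longrightarrow> normalized_t w \<in> carrier TL"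
  by (simp add: normalized_t_def)

lemma coord_normalized_t:
  assumes "w \<in> W\<^sub>c"
  shows "coord (normalized_t w) = single w 1"
proof -
  have w: "w \<in> carrier W" using assms by (rule rep.Wc_carrier)
  have "coord (normalized_t w) = rep.normal_form (rep.\<nu> w)"
    using w by (simp add: normalized_t_def t_elem_def proj_smult coord_proj reg_smult rep.\<nu>_def)
  also have "\<dots> = single w 1" using rep.normal_form_lincomb[of "single w 1"] assms by simp
  finally show ?thesis .
qed

section \<open>The bar involution of the quotient\<close>

interpretation \<beta>: bar_module W\<^sub>c len rep.\<beta>
  by (rule rep.bar_module_\<beta>)

text \<open>The conditions by which \<open>bar\<close> is defined.\<close>

definition is_bar :: "('h set \<Rightarrow> 'h set) \<Rightarrow> bool"
  where "is_bar f \<longleftrightarrow> f \<in> extensional (carrier TL) \<and> f \<in> ring_iso TL TL \<and>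
    (\<forall>x\<in>carrier TL. f (f x) = x) \<and>
    f (v_pow 1 \<odot>\<^bsub>TL\<^esub> \<one>\<^bsub>TL\<^esub>) = v_pow (- 1) \<odot>\<^bsub>TL\<^esub> \<one>\<^bsub>TL\<^esub> \<and>
    (\<forall>w\<in>carrier W. f (t_elem w) = inv\<^bsub>TL\<^esub> (t_elem (inv\<^bsub>W\<^esub> w)))"

definition bar\<^sub>0 :: "'h set \<Rightarrow> 'h set"
  where "bar\<^sub>0 = (\<lambda>C\<in>carrier TL. THE D. D \<in> carrier TL \<and> coord D = rep.\<beta> (coord C))"

lemma bar\<^sub>0_proj:
  assumes "x \<in> carrier H" "y \<in> carrier H" "reg y = rep.hbar (reg x)"
  shows "bar\<^sub>0 (J +> x) = J +> y"
proof -
  have c: "coord (J +> y) = rep.\<beta> (coord (J +> x))"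
    using assms rep.\<beta>_normal_form[OF reg_H_all] by (simp add: coord_proj)
  have "(THE D. D \<in> carrier TL \<and> coord D = rep.\<beta> (coord (J +> x))) = J +> y"
    by (rule the_equality) (use c assms coord_inj in auto)
  then show ?thesis using assms by (simp add: bar\<^sub>0_def)
qed

lemma bar_lift:
  assumes "x \<in> carrier H"
  obtains y where "y \<in> carrier H" "reg y = rep.hbar (reg x)"
  using H_all_reg[OF rep.hbar_H_all[OF reg_H_all[OF assms]]] by blast

lemma bar\<^sub>0_closed: "C \<in> carrier TL \<Longrightarrow> bar\<^sub>0 C \<in> carrier TL"
  and coord_bar\<^sub>0: "C \<in> carrier TL \<Longrightarrow> coord (bar\<^sub>0 C) = rep.\<beta> (coord C)"
proof -
  assume "C \<in> carrier TL"
  then obtain x where x: "x \<in> carrier H" "C = J +> x" by (rule TL_cases)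
  obtain y where y: "y \<in> carrier H" "reg y = rep.hbar (reg x)" using x(1) by (rule bar_lift)
  show "bar\<^sub>0 C \<in> carrier TL" "coord (bar\<^sub>0 C) = rep.\<beta> (coord C)"
    using bar\<^sub>0_proj[OF x(1) y] x y rep.\<beta>_normal_form[OF reg_H_all[OF x(1)]] by (simp_all add: coord_proj)
qed

lemma bar\<^sub>0_invol: "C \<in> carrier TL \<Longrightarrow> bar\<^sub>0 (bar\<^sub>0 C) = C"
  using coord_inj bar\<^sub>0_closed coord_bar\<^sub>0 \<beta>.\<beta>_\<beta>[OF coord_keys] by metis

lemma bar\<^sub>0_add: "C \<in> carrier TL \<Longrightarrow> D \<in> carrier TL \<Longrightarrow> bar\<^sub>0 (C \<oplus>\<^bsub>TL\<^esub> D) = bar\<^sub>0 C \<oplus>\<^bsub>TL\<^esub> bar\<^sub>0 D"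
proof -
  interpret TL: ring TL by (rule TL_ring)
  assume CD: "C \<in> carrier TL" "D \<in> carrier TL"
  then show ?thesis
    using \<beta>.\<beta>_add[OF coord_keys coord_keys, OF CD]
    by (intro coord_inj) (simp_all add: bar\<^sub>0_closed coord_bar\<^sub>0 coord_add)
qed

lemma bar\<^sub>0_smult: "C \<in> carrier TL \<Longrightarrow> bar\<^sub>0 (a \<odot>\<^bsub>TL\<^esub> C) = lbar a \<odot>\<^bsub>TL\<^esub> bar\<^sub>0 C"
  using \<beta>.\<beta>_scal[OF coord_keys, of C a]
  by (intro coord_inj) (simp_all add: bar\<^sub>0_closed coord_bar\<^sub>0 coord_smult)

lemma bar\<^sub>0_mult:
  assumes "C \<in> carrier TL" "D \<in> carrier TL"
  shows "bar\<^sub>0 (C \<otimes>\<^bsub>TL\<^esub> D) = bar\<^sub>0 C \<otimes>\<^bsub>TL\<^esub> bar\<^sub>0 D"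
proof -
  obtain x where x: "x \<in> carrier H" "C = J +> x" using assms(1) by (rule TL_cases)
  obtain z where z: "z \<in> carrier H" "D = J +> z" using assms(2) by (rule TL_cases)
  obtain x' where x': "x' \<in> carrier H" "reg x' = rep.hbar (reg x)" using x(1) by (rule bar_lift)
  obtain z' where z': "z' \<in> carrier H" "reg z' = rep.hbar (reg z)" using z(1) by (rule bar_lift)
  have "reg (x' \<otimes> z') = rep.hbar (reg (x \<otimes> z))"
    using x z x' z' rep.hbar_mult[OF reg_H_all reg_H_all] by (simp add: reg_mult)
  then have "bar\<^sub>0 (J +> (x \<otimes> z)) = J +> (x' \<otimes> z')" using x z x' z' by (intro bar\<^sub>0_proj) auto
  then show ?thesis
    using bar\<^sub>0_proj[OF x(1) x'] bar\<^sub>0_proj[OF z(1) z'] x z x' z' by (simp add: proj_mult)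
qed

lemma reg_one: "reg \<one> = reg (T (word_class []))"
  using T_one by (simp add: one_W)

lemma bar\<^sub>0_one: "bar\<^sub>0 \<one>\<^bsub>TL\<^esub> = \<one>\<^bsub>TL\<^esub>"
  unfolding TL_simps by (rule bar\<^sub>0_proj) (simp_all add: reg_one)

lemma bar\<^sub>0_t:
  assumes w: "w \<in> carrier W"
  shows "bar\<^sub>0 (t_elem w) = inv\<^bsub>TL\<^esub> (t_elem (inv\<^bsub>W\<^esub> w))"
proof -
  interpret TL: ring TL by (rule TL_ring)
  interpret W: group W by (rule group_W)
  obtain y where y: "y \<in> carrier H" "reg y = rep.hbar (reg (T w))" using T_closed[OF w] by (rule bar_lift)
  have iw: "inv\<^bsub>W\<^esub> w \<in> carrier W" using w by simp
  have "reg (y \<otimes> T (inv\<^bsub>W\<^esub> w)) = reg \<one>" "reg (T (inv\<^bsub>W\<^esub> w) \<otimes> y) = reg \<one>"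
    using rep.hbar_\<tau>_inverse[OF w] y iw by (simp_all add: reg_mult reg_one)
  then have "y \<otimes> T (inv\<^bsub>W\<^esub> w) = \<one>" "T (inv\<^bsub>W\<^esub> w) \<otimes> y = \<one>"
    using y iw by (auto intro: reg_inj)
  then have "(J +> T (inv\<^bsub>W\<^esub> w)) \<otimes>\<^bsub>TL\<^esub> (J +> y) = \<one>\<^bsub>TL\<^esub>" "(J +> y) \<otimes>\<^bsub>TL\<^esub> (J +> T (inv\<^bsub>W\<^esub> w)) = \<one>\<^bsub>TL\<^esub>"
    using y iw by (simp_all add: proj_mult TL_simps(3))
  then have "J +> y = inv\<^bsub>TL\<^esub> (J +> T (inv\<^bsub>W\<^esub> w))"
    using y iw by (intro TL.inv_unique') auto
  then show ?thesis using bar\<^sub>0_proj[OF T_closed[OF w] y] by (simp add: t_elem_def)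
qed

lemma is_bar_bar\<^sub>0: "is_bar bar\<^sub>0"
proof -
  interpret TL: ring TL by (rule TL_ring)
  have "bar\<^sub>0 \<in> ring_hom TL TL"
    by (rule ring_hom_memI) (auto simp: bar\<^sub>0_closed bar\<^sub>0_mult bar\<^sub>0_add bar\<^sub>0_one)
  moreover have "bij_betw bar\<^sub>0 (carrier TL) (carrier TL)"
    by (rule bij_betw_byWitness[where f' = bar\<^sub>0]) (auto simp: bar\<^sub>0_invol bar\<^sub>0_closed)
  moreover have "bar\<^sub>0 \<in> extensional (carrier TL)" by (simp add: bar\<^sub>0_def)
  ultimately show ?thesis
    unfolding is_bar_def ring_iso_def using bar\<^sub>0_invol bar\<^sub>0_t bar\<^sub>0_smult[of "\<one>\<^bsub>TL\<^esub>"] bar\<^sub>0_one by simp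
qed

lemma smult_TL_one:
  "C \<in> carrier TL \<Longrightarrow> a \<odot>\<^bsub>TL\<^esub> C = (a \<odot>\<^bsub>TL\<^esub> \<one>\<^bsub>TL\<^esub>) \<otimes>\<^bsub>TL\<^esub> C"
  by (erule TL_cases) (simp add: TL_simps(3) proj_smult proj_mult smult_mult_left)

text \<open>
  A ring homomorphism that inverts \<open>v\<close> inverts all powers of \<open>v\<close>, and by additivity it
  conjugates every Laurent polynomial.
\<close>

lemma is_bar_smult_one:
  assumes f: "is_bar f"
  shows "f (a \<odot>\<^bsub>TL\<^esub> \<one>\<^bsub>TL\<^esub>) = lbar a \<odot>\<^bsub>TL\<^esub> \<one>\<^bsub>TL\<^esub>"
proof -
  interpret TL: ring TL by (rule TL_ring)
  let ?s = "\<lambda>a. a \<odot>\<^bsub>TL\<^esub> \<one>\<^bsub>TL\<^esub>"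
  have hom: "f \<in> ring_hom TL TL" using f by (simp add: is_bar_def ring_iso_def)
  have sc: "?s a \<in> carrier TL" for a by simp
  have mult: "?s (a * b) = ?s a \<otimes>\<^bsub>TL\<^esub> ?s b" for a b
    using smult_TL_one[of "?s b" a] smult_assoc1[of a b \<one>]
    by (simp add: TL_simps(3) proj_smult)
  have add: "?s (a + b) = ?s a \<oplus>\<^bsub>TL\<^esub> ?s b" for a b
    using smult_l_distr[of a b \<one>] by (simp add: TL_simps(3) proj_smult proj_add)
  have v: "f (?s (v_pow 1)) = ?s (v_pow (- 1))" using f by (simp add: is_bar_def)
  then have v': "f (?s (v_pow (- 1))) = ?s (v_pow 1)" using f sc by (metis is_bar_def)
  have pow: "f (?s (v_pow k)) = ?s (v_pow (- k))" for k
  proof (induction k rule: int_induct[where k = 0])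
    case base
    have "?s 1 = \<one>\<^bsub>TL\<^esub>" using smult_one[of \<one>] by (simp add: TL_simps(3) proj_smult)
    then show ?case using ring_hom_one[OF hom] by simp
  next
    case (step1 i)
    have "v_pow (i + 1) = v_pow i * v_pow 1" by (simp add: v_pow_mult)
    then have "f (?s (v_pow (i + 1))) = ?s (v_pow (- i)) \<otimes>\<^bsub>TL\<^esub> ?s (v_pow (- 1))"
      using ring_hom_mult[OF hom sc sc] mult step1 v by simp
    then show ?case by (simp add: v_pow_mult flip: mult)
  next
    case (step2 i)
    have "v_pow (i - 1) = v_pow i * v_pow (- 1)" by (simp add: v_pow_mult)
    then have "f (?s (v_pow (i - 1))) = ?s (v_pow (- i)) \<otimes>\<^bsub>TL\<^esub> ?s (v_pow 1)"
      using ring_hom_mult[OF hom sc sc] mult step2 v' by simp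
    then show ?case by (simp add: v_pow_mult flip: mult)
  qed
  have fadd: "f (?s (a + b)) = f (?s a) \<oplus>\<^bsub>TL\<^esub> f (?s b)" for a b
    unfolding add by (rule ring_hom_add[OF hom sc sc])
  show ?thesis
  proof (rule frag_induction[of a UNIV])
    have "f (?s 0) = f (?s 0) \<oplus>\<^bsub>TL\<^esub> f (?s 0)" using fadd[of 0 0] by simp
    then have "f (?s 0) = \<zero>\<^bsub>TL\<^esub>" using ring_hom_closed[OF hom sc]
      by (metis TL.add.l_cancel_one)
    moreover have "?s 0 = \<zero>\<^bsub>TL\<^esub>" using add[of 0 0] sc[of 0] by (metis TL.add.l_cancel_one add_0)
    ultimately show "f (?s 0) = ?s (lbar 0)" by simp
  next
    fix k show "f (?s (frag_of k)) = ?s (lbar (frag_of k))" using pow[of k] lbar_v_pow[of k] by (simp add: v_pow_def)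
  next
    fix a b assume a: "f (?s a) = ?s (lbar a)" and b: "f (?s b) = ?s (lbar b)"
    have "f (?s (a - b)) \<oplus>\<^bsub>TL\<^esub> ?s (lbar b) = ?s (lbar a)" using fadd[of "a - b" b] a b by simp
    also have "?s (lbar a) = ?s (lbar (a - b)) \<oplus>\<^bsub>TL\<^esub> ?s (lbar b)" using add[of "lbar (a - b)" "lbar b"] by (simp add: lbar_diff)
    finally show "f (?s (a - b)) = ?s (lbar (a - b))"
      using TL.add.right_cancel[OF sc ring_hom_closed[OF hom sc] sc] by simp
  qed simp
qed

text \<open>
  The involution is semilinear by \<open>is_bar_smult_one\<close>, and the \<open>t\<^sub>w\<close>, \<open>w \<in> W\<close>, span the
  quotient. The induction runs over the Hecke algebra, where the expansion in basis elements
  is available.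
\<close>

lemma is_bar_unique:
  assumes f: "is_bar f"
  shows "f = bar\<^sub>0"
proof (rule extensionalityI)
  interpret TL: ring TL by (rule TL_ring)
  show "f \<in> extensional (carrier TL)" using f by (simp add: is_bar_def)
  show "bar\<^sub>0 \<in> extensional (carrier TL)" by (simp add: bar\<^sub>0_def)
  have hom: "f \<in> ring_hom TL TL" using f by (simp add: is_bar_def ring_iso_def)
  have smult: "f (a \<odot>\<^bsub>TL\<^esub> C) = lbar a \<odot>\<^bsub>TL\<^esub> f C" if "C \<in> carrier TL" for a C
    using that ring_hom_closed[OF hom that] ring_hom_mult[OF hom, of "a \<odot>\<^bsub>TL\<^esub> \<one>\<^bsub>TL\<^esub>" C]
      is_bar_smult_one[OF f, of a] smult_TL_one[of C a] smult_TL_one[of "f C" "lbar a"] by simp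
  have t: "f (t_elem w) = bar\<^sub>0 (t_elem w)" if "w \<in> carrier W" for w
    using f that bar\<^sub>0_t by (simp add: is_bar_def)
  have zero: "f \<zero>\<^bsub>TL\<^esub> = \<zero>\<^bsub>TL\<^esub>"
    using ring_hom_add[OF hom, of "\<zero>\<^bsub>TL\<^esub>" "\<zero>\<^bsub>TL\<^esub>"] ring_hom_closed[OF hom, of "\<zero>\<^bsub>TL\<^esub>"]
    by (metis TL.add.l_cancel_one TL.l_zero TL.zero_closed)
  have zero': "bar\<^sub>0 \<zero>\<^bsub>TL\<^esub> = \<zero>\<^bsub>TL\<^esub>"
    by (rule coord_inj) (simp_all add: bar\<^sub>0_closed coord_bar\<^sub>0 coord_zero)
  fix C assume "C \<in> carrier TL"
  then obtain x where x: "x \<in> carrier H" "C = J +> x" by (rule TL_cases)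
  have "\<forall>x\<in>carrier H. reg x = h \<longrightarrow> f (J +> x) = bar\<^sub>0 (J +> x)" if "h \<in> rep.H_all" for h
    using that
  proof (induction rule: rep.H_all_induct)
    case zero
    have "x = \<zero>" if "x \<in> carrier H" "reg x = 0" for x
      using reg_inj[of x \<zero>] that reg_zero by simp
    then show ?case using \<open>f \<zero>\<^bsub>TL\<^esub> = \<zero>\<^bsub>TL\<^esub>\<close> zero' proj_zero TL_simps(4) by metis
  next
    case (step a w y)
    obtain z where z: "z \<in> carrier H" "reg z = y" using step.hyps(2) by (rule H_all_reg)
    show ?case
    proof (intro ballI impI)
      fix x assume x: "x \<in> carrier H" "reg x = escale a (reg (T w)) + y"
      then have "x = a \<odot> T w \<oplus> z"
        using step.hyps(1) z by (intro reg_inj) (simp_all add: reg_add reg_smult)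
      then have xs: "J +> x = (a \<odot>\<^bsub>TL\<^esub> t_elem w) \<oplus>\<^bsub>TL\<^esub> (J +> z)"
        using step.hyps(1) z by (simp add: t_elem_def proj_smult proj_add)
      have "f (J +> x) = lbar a \<odot>\<^bsub>TL\<^esub> f (t_elem w) \<oplus>\<^bsub>TL\<^esub> f (J +> z)"
        unfolding xs using step.hyps(1) z smult ring_hom_add[OF hom] by simp
      also have "\<dots> = lbar a \<odot>\<^bsub>TL\<^esub> bar\<^sub>0 (t_elem w) \<oplus>\<^bsub>TL\<^esub> bar\<^sub>0 (J +> z)"
        using t step z by simp
      also have "\<dots> = bar\<^sub>0 (J +> x)"
        unfolding xs using step.hyps(1) z by (simp add: bar\<^sub>0_add bar\<^sub>0_smult)
      finally show "f (J +> x) = bar\<^sub>0 (J +> x)" .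
    qed
  qed
  then show "f C = bar\<^sub>0 C" using x reg_H_all by blast
qed

lemma bar_eq: "bar = bar\<^sub>0"
proof -
  have "bar = (THE f. is_bar f)" by (simp add: bar_def is_bar_def)
  also have "\<dots> = bar\<^sub>0" using is_bar_bar\<^sub>0 is_bar_unique by (rule the_equality)
  finally show ?thesis .
qed

section \<open>The lattice and its bases\<close>

lemma laurent_minus_simps: "\<zero>\<^bsub>\<A>minus\<^esub> = 0" "carrier \<A>minus = {a. keys a \<subseteq> {..0}}"
  by (simp_all add: laurent_minus_ring_def laurent_ring_def)

lemma lattice_coefficients: "bij_betw (\<lambda>p. restrict (lookup p) W\<^sub>c) (lattice_of W\<^sub>c) (coefficients \<A>minus W\<^sub>c)"
  using coefficients_bij[of \<A>minus W\<^sub>c] by (simp add: laurent_minus_simps lattice_of_def)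

text \<open>
  The module \<open>M\<close> is either the whole quotient or the lattice \<open>\<L>\<close>.
\<close>

lemma coord_lin_comb:
  fixes M :: "(laurent, 'h set, 'x) module_scheme"
  assumes M: "abelian_monoid M" "carrier M \<subseteq> carrier TL" "(\<oplus>\<^bsub>M\<^esub>) = (\<oplus>\<^bsub>TL\<^esub>)" "\<zero>\<^bsub>M\<^esub> = \<zero>\<^bsub>TL\<^esub>" "(\<odot>\<^bsub>M\<^esub>) = (\<odot>\<^bsub>TL\<^esub>)"
    and smult: "\<And>a C. keys a \<subseteq> {..0} \<Longrightarrow> C \<in> carrier M \<Longrightarrow> a \<odot>\<^bsub>M\<^esub> C \<in> carrier M"
    and b: "b \<in> W\<^sub>c \<rightarrow> carrier M" and p: "p \<in> lattice_of W\<^sub>c"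
  shows "lin_comb \<A>minus M W\<^sub>c b (restrict (lookup p) W\<^sub>c) \<in> carrier M"
    and "coord (lin_comb \<A>minus M W\<^sub>c b (restrict (lookup p) W\<^sub>c)) =
      pm.lincomb (\<lambda>w. coord (b w)) p"
proof -
  interpret M: abelian_monoid M by fact
  let ?a = "restrict (lookup p) W\<^sub>c"
  have keys: "keys p \<subseteq> W\<^sub>c" using p by (simp add: lattice_of_def)
  then have set: "{i \<in> W\<^sub>c. ?a i \<noteq> \<zero>\<^bsub>\<A>minus\<^esub>} = keys p"
    by (auto simp: in_keys_iff laurent_minus_simps)
  have cl: "?a i \<odot>\<^bsub>M\<^esub> b i \<in> carrier M" if "i \<in> keys p" for i
    using that keys b p by (intro smult) (auto simp: lattice_of_def)
  then show "lin_comb \<A>minus M W\<^sub>c b ?a \<in> carrier M"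
    unfolding lin_comb_def set by (intro M.finsum_closed) auto
  have "coord (lin_comb \<A>minus M W\<^sub>c b ?a) = (\<Sum>i\<in>keys p. coord (?a i \<odot>\<^bsub>M\<^esub> b i))"
    unfolding lin_comb_def set using M cl by (intro hom_finsum) (auto simp: coord_zero coord_add subset_iff)
  also have "\<dots> = pm.lincomb (\<lambda>w. coord (b w)) p"
    unfolding pm.lincomb_def
  proof (rule sum.cong)
    fix i assume i: "i \<in> keys p"
    then have "b i \<in> carrier TL" "i \<in> W\<^sub>c" using keys b M(2) by blast+
    then show "coord (?a i \<odot>\<^bsub>M\<^esub> b i) = scal (lookup p i) (coord (b i))"
      using M(5) by (simp add: coord_smult)
  qed simp
  finally show "coord (lin_comb \<A>minus M W\<^sub>c b ?a) = pm.lincomb (\<lambda>w. coord (b w)) p" .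
qed

lemma carrier_\<L>: "carrier \<L> = {C \<in> carrier TL. coord C \<in> lattice_of W\<^sub>c}"
proof -
  interpret TL: ring TL by (rule TL_ring)
  have n: "normalized_t \<in> W\<^sub>c \<rightarrow> carrier TL" using normalized_t_closed rep.Wc_carrier by blast
  let ?g = "\<lambda>p. lin_comb \<A>minus TL W\<^sub>c normalized_t (restrict (lookup p) W\<^sub>c)"
  have g: "?g p \<in> carrier TL" "coord (?g p) = p" if p: "p \<in> lattice_of W\<^sub>c" for p
  proof -
    note lc = coord_lin_comb[OF TL.abelian_monoid_axioms order_refl HOL.refl HOL.refl HOL.refl _ n p]
    show "?g p \<in> carrier TL" by (rule lc(1)) simp
    have "coord (?g p) = pm.lincomb (\<lambda>w. coord (normalized_t w)) p" by (rule lc(2)) simp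
    also have "\<dots> = pm.lincomb (\<lambda>w. single w 1) p"
      using p coord_normalized_t by (intro pm.lincomb_cong) (auto simp: lattice_of_def)
    also have "\<dots> = p" by (rule lincomb_single_id)
    finally show "coord (?g p) = p" .
  qed
  have "carrier \<L> = lin_comb \<A>minus TL W\<^sub>c normalized_t ` coefficients \<A>minus W\<^sub>c"
    by (simp add: \<L>_def lin_span_def)
  also have "\<dots> = ?g ` lattice_of W\<^sub>c"
    unfolding bij_betw_imp_surj_on[OF lattice_coefficients, symmetric] by (simp add: image_image)
  also have "\<dots> = {C \<in> carrier TL. coord C \<in> lattice_of W\<^sub>c}"
  proof (intro equalityI subsetI)
    fix C assume "C \<in> {C \<in> carrier TL. coord C \<in> lattice_of W\<^sub>c}"
    then have "C = ?g (coord C)" using g by (intro coord_inj) auto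
    then show "C \<in> ?g ` lattice_of W\<^sub>c" using \<open>C \<in> _\<close> by blast
  qed (use g in auto)
  finally show ?thesis .
qed

lemma \<L>_simps: "(\<oplus>\<^bsub>\<L>\<^esub>) = (\<oplus>\<^bsub>TL\<^esub>)" "\<zero>\<^bsub>\<L>\<^esub> = \<zero>\<^bsub>TL\<^esub>" "(\<odot>\<^bsub>\<L>\<^esub>) = (\<odot>\<^bsub>TL\<^esub>)"
  by (simp_all add: \<L>_def)

lemma \<L>_abelian_monoid: "abelian_monoid \<L>"
proof -
  interpret TL: ring TL by (rule TL_ring)
  show ?thesis
    by (rule abelian_monoidI)
      (simp_all add: \<L>_simps carrier_\<L> coord_add coord_zero lattice_zero lattice_add TL.a_closed TL.a_ac)
qed

lemma coord_\<L>_bij: "bij_betw coord (carrier \<L>) (lattice_of W\<^sub>c)"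
proof (rule bij_betw_imageI)
  show "inj_on coord (carrier \<L>)" by (rule inj_onI, rule coord_inj) (simp_all add: carrier_\<L>)
  show "coord ` carrier \<L> = lattice_of W\<^sub>c"
  proof
    show "lattice_of W\<^sub>c \<subseteq> coord ` carrier \<L>"
    proof
      fix p assume p: "p \<in> lattice_of W\<^sub>c"
      then obtain C where "C \<in> carrier TL" "coord C = p"
        using coord_surj[of p] by (auto simp: lattice_of_def)
      then show "p \<in> coord ` carrier \<L>" using p by (auto simp: carrier_\<L>)
    qed
  qed (auto simp: carrier_\<L>)
qed

lemma is_basis_\<L>:
  assumes b: "b \<in> W\<^sub>c \<rightarrow> carrier \<L>"
    and bij: "bij_betw (pm.lincomb (\<lambda>w. coord (b w))) (lattice_of W\<^sub>c) (lattice_of W\<^sub>c)"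
  shows "is_basis \<A>minus \<L> W\<^sub>c b"
proof -
  let ?r = "\<lambda>p. restrict (lookup p) W\<^sub>c"
  have smult: "a \<odot>\<^bsub>\<L>\<^esub> C \<in> carrier \<L>" if "keys a \<subseteq> {..0}" "C \<in> carrier \<L>" for a C
    using that by (simp add: \<L>_simps carrier_\<L> coord_smult lattice_scal)
  have sub: "carrier \<L> \<subseteq> carrier TL" by (auto simp: carrier_\<L>)
  note lc = coord_lin_comb[OF \<L>_abelian_monoid sub \<L>_simps smult b]
  have "bij_betw (coord \<circ> (lin_comb \<A>minus \<L> W\<^sub>c b \<circ> ?r)) (lattice_of W\<^sub>c) (lattice_of W\<^sub>c)"
    using lc(2) by (intro iffD2[OF bij_betw_cong bij]) simp
  moreover have "(lin_comb \<A>minus \<L> W\<^sub>c b \<circ> ?r) ` lattice_of W\<^sub>c \<subseteq> carrier \<L>"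
    using lc(1) by auto
  ultimately have "bij_betw (lin_comb \<A>minus \<L> W\<^sub>c b \<circ> ?r) (lattice_of W\<^sub>c) (carrier \<L>)"
    using bij_betw_comp_iff2[OF coord_\<L>_bij] by blast
  then have "bij_betw (lin_comb \<A>minus \<L> W\<^sub>c b) (coefficients \<A>minus W\<^sub>c) (carrier \<L>)"
    using bij_betw_comp_iff[OF lattice_coefficients] by blast
  then show ?thesis using b by (simp add: is_basis_def)
qed

lemma \<pi>_eq_iff:
  assumes "C \<in> carrier \<L>" "D \<in> carrier \<L>"
  shows "\<pi> C = \<pi> D \<longleftrightarrow> coord C - coord D \<in> sublattice_of W\<^sub>c"
proof -
  interpret L: abelian_monoid \<L> by (rule \<L>_abelian_monoid)
  let ?V = "{v_pow (- 1) \<odot>\<^bsub>\<L>\<^esub> y | y. y \<in> carrier \<L>}"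
  have \<pi>: "\<pi> C = {z \<oplus>\<^bsub>TL\<^esub> C | z. z \<in> ?V}" for C
    unfolding \<pi>_def a_r_coset_def' by (auto simp: \<L>_simps)
  have V: "z \<in> ?V \<longleftrightarrow> z \<in> carrier TL \<and> coord z \<in> sublattice_of W\<^sub>c" for z
  proof
    assume "z \<in> ?V"
    then show "z \<in> carrier TL \<and> coord z \<in> sublattice_of W\<^sub>c"
      by (auto simp: \<L>_simps carrier_\<L> coord_smult sublattice_eq_shift)
  next
    assume z: "z \<in> carrier TL \<and> coord z \<in> sublattice_of W\<^sub>c"
    then obtain r where r: "r \<in> lattice_of W\<^sub>c" "coord z = scal (v_pow (- 1)) r"
      using sublattice_eq_shift by blast
    then obtain y where y: "y \<in> carrier TL" "coord y = r" using coord_surj[of r] by (auto simp: lattice_of_def)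
    then have "z = v_pow (- 1) \<odot>\<^bsub>TL\<^esub> y" using z r by (intro coord_inj) (simp_all add: coord_smult)
    then show "z \<in> ?V" using y r by (auto simp: \<L>_simps carrier_\<L>)
  qed
  interpret TL: ring TL by (rule TL_ring)
  have CD: "C \<in> carrier TL" "D \<in> carrier TL" using assms by (auto simp: carrier_\<L>)
  have sub: "\<pi> C \<subseteq> \<pi> D" if CD: "C \<in> carrier TL" "D \<in> carrier TL" and d: "coord C - coord D \<in> sublattice_of W\<^sub>c" for C D
  proof
    fix x assume "x \<in> \<pi> C"
    then obtain z where z: "z \<in> carrier TL" "coord z \<in> sublattice_of W\<^sub>c" "x = z \<oplus>\<^bsub>TL\<^esub> C"
      unfolding \<pi> V by blast
    have s: "coord z + (coord C - coord D) \<in> sublattice_of W\<^sub>c" using z d by (intro sublattice_add)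
    then obtain z' where z': "z' \<in> carrier TL" "coord z' = coord z + (coord C - coord D)"
      using coord_surj[of "coord z + (coord C - coord D)"] by (auto simp: sublattice_of_def)
    have "x = z' \<oplus>\<^bsub>TL\<^esub> D" using z z' CD by (intro coord_inj) (simp_all add: coord_add)
    then show "x \<in> \<pi> D" unfolding \<pi> V using z' s by auto
  qed
  show ?thesis
  proof
    assume eq: "\<pi> C = \<pi> D"
    have "\<zero>\<^bsub>TL\<^esub> \<oplus>\<^bsub>TL\<^esub> C \<in> \<pi> C"
      unfolding \<pi> V by (intro CollectI exI[of _ "\<zero>\<^bsub>TL\<^esub>"]) (simp add: coord_zero sublattice_of_def)
    then have "C \<in> \<pi> D" using eq CD by simp
    then obtain z where "z \<in> carrier TL" "coord z \<in> sublattice_of W\<^sub>c" "C = z \<oplus>\<^bsub>TL\<^esub> D"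
      unfolding \<pi> V by blast
    then show "coord C - coord D \<in> sublattice_of W\<^sub>c" using CD by (simp add: coord_add)
  next
    assume d: "coord C - coord D \<in> sublattice_of W\<^sub>c"
    have "0 \<in> sublattice_of W\<^sub>c" by (simp add: sublattice_of_def)
    from sublattice_diff[OF this d] have "coord D - coord C \<in> sublattice_of W\<^sub>c" by simp
    then show "\<pi> C = \<pi> D" using sub d CD by blast
  qed
qed

text \<open>
  By \<open>coord\<close>, the statement becomes one about \<open>rep.\<beta>\<close>. Two IC bases have coordinates that
  are invariant and congruent modulo the sublattice, hence equal.
\<close>

lemma IC_basis_exists_unique: "\<exists>!c. c \<in> extensional W\<^sub>c \<and> is_IC_basis c"
proof -
  have "\<forall>w\<in>W\<^sub>c. \<exists>p. rep.\<beta> p = p \<and> p - single w 1 \<in> sublattice_of {v \<in> W\<^sub>c. len v < len w}"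
    using \<beta>.invariant_exists by blast
  from bchoice[OF this] obtain d where d: "\<And>w. w \<in> W\<^sub>c \<Longrightarrow> rep.\<beta> (d w) = d w"
    "\<And>w. w \<in> W\<^sub>c \<Longrightarrow> d w - single w 1 \<in> sublattice_of {v \<in> W\<^sub>c. len v < len w}"
    by auto
  have dsub: "d w - single w 1 \<in> sublattice_of W\<^sub>c" if "w \<in> W\<^sub>c" for w
    using d(2)[OF that] by (auto simp: sublattice_of_def)
  have single: "single w 1 \<in> lattice_of W\<^sub>c" if "w \<in> W\<^sub>c" for w
    using that by (auto simp: lattice_of_def lookup_single when_def)
  have dl: "d w \<in> lattice_of W\<^sub>c" if "w \<in> W\<^sub>c" for w
    using lattice_add[OF subsetD[OF sublattice_lattice dsub[OF that]] single[OF that]] by simp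
  have "\<forall>w\<in>W\<^sub>c. \<exists>C. C \<in> carrier \<L> \<and> coord C = d w"
  proof
    fix w assume "w \<in> W\<^sub>c"
    then have "d w \<in> coord ` carrier \<L>" using coord_\<L>_bij dl by (simp add: bij_betw_def)
    then show "\<exists>C. C \<in> carrier \<L> \<and> coord C = d w" by auto
  qed
  from bchoice[OF this] obtain c0 where c0: "\<And>w. w \<in> W\<^sub>c \<Longrightarrow> c0 w \<in> carrier \<L>" "\<And>w. w \<in> W\<^sub>c \<Longrightarrow> coord (c0 w) = d w"
    by auto
  define c where "c = restrict c0 W\<^sub>c"
  have c: "c w \<in> carrier \<L>" "coord (c w) = d w" if "w \<in> W\<^sub>c" for w
    using c0 that by (simp_all add: c_def)
  have L_TL: "C \<in> carrier TL" if "C \<in> carrier \<L>" for C using that by (simp add: carrier_\<L>)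
  have nL: "normalized_t w \<in> carrier \<L>" if "w \<in> W\<^sub>c" for w
    using that normalized_t_closed[OF rep.Wc_carrier] coord_normalized_t single by (simp add: carrier_\<L>)
  have "is_basis \<A>minus \<L> W\<^sub>c c"
  proof (rule is_basis_\<L>)
    show "bij_betw (pm.lincomb (\<lambda>w. coord (c w))) (lattice_of W\<^sub>c) (lattice_of W\<^sub>c)"
      by (rule \<beta>.unitriangular_basis) (simp add: c d)
  qed (use c in auto)
  moreover have "bar (c w) = c w" if "w \<in> W\<^sub>c" for w
    using c[OF that] d(1)[OF that] L_TL unfolding bar_eq by (intro coord_inj) (simp_all add: bar\<^sub>0_closed coord_bar\<^sub>0)
  moreover have "\<pi> (c w) = \<pi> (normalized_t w)" if "w \<in> W\<^sub>c" for w
    using \<pi>_eq_iff[OF c(1)[OF that] nL[OF that]] c(2)[OF that] dsub[OF that] coord_normalized_t[OF that] by simp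
  ultimately have IC: "is_IC_basis c" by (simp add: is_IC_basis_def)
  show ?thesis
  proof (rule ex1I)
    show "c \<in> extensional W\<^sub>c \<and> is_IC_basis c" using IC by (simp add: c_def)
    fix c' assume c': "c' \<in> extensional W\<^sub>c \<and> is_IC_basis c'"
    show "c' = c"
    proof (rule extensionalityI)
      show "c' \<in> extensional W\<^sub>c" "c \<in> extensional W\<^sub>c" using c' by (simp_all add: c_def)
      fix w assume w: "w \<in> W\<^sub>c"
      have c'L: "c' w \<in> carrier \<L>" and inv: "bar (c' w) = c' w" and "\<pi> (c' w) = \<pi> (normalized_t w)"
        using c' w by (auto simp: is_IC_basis_def is_basis_def)
      then have "coord (c' w) - single w 1 \<in> sublattice_of W\<^sub>c"
        using \<pi>_eq_iff[OF c'L nL[OF w]] coord_normalized_t[OF w] by simp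
      then have "(coord (c' w) - single w 1) - (d w - single w 1) \<in> sublattice_of W\<^sub>c"
        using dsub[OF w] by (rule sublattice_diff)
      then have sub: "coord (c' w) - d w \<in> sublattice_of W\<^sub>c" by simp
      have k: "keys (coord (c' w)) \<subseteq> W\<^sub>c" "keys (d w) \<subseteq> W\<^sub>c"
        "keys (coord (c' w) - d w) \<subseteq> W\<^sub>c"
        using coord_keys[OF L_TL[OF c'L]] dl[OF w] sub by (auto simp: lattice_of_def sublattice_of_def)
      have "rep.\<beta> (coord (c' w)) = coord (c' w)"
        using coord_bar\<^sub>0[OF L_TL[OF c'L]] inv by (simp add: bar_eq)
      then have "rep.\<beta> (coord (c' w) - d w) = coord (c' w) - d w"
        using \<beta>.\<beta>_add[OF k(3,2)] d(1)[OF w] by (simp add: eq_diff_eq)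
      then have "coord (c' w) - d w = 0" using sub by (intro \<beta>.invariant_sublattice_zero)
      then show "c' w = c w" using c[OF w] c'L L_TL by (intro coord_inj) simp_all
    qed
  qed
qed

end

theorem theorem2p3:
  fixes S :: "'s set" and m :: "'s \<Rightarrow> 's \<Rightarrow> enat"
    and H :: "(laurent, 'h, 'n) module_scheme" and T :: "'s list set \<Rightarrow> 'h"
  assumes "hecke_algebra S m H T"
  shows "\<exists>!c. c \<in> extensional (coxeter_graph.W\<^sub>c S m) \<and> hecke_algebra.is_IC_basis S m H T c"
proof -
  interpret hecke_algebra S m H T by fact
  show ?thesis by (rule IC_basis_exists_unique)
qed

end
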